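(* Let $F=\frac1n\sum_{i=1}^n f_i:\mathbb{R}^d\to\mathbb{R}$ and $\mathbf{x}_0\in\mathbb{R}^d$ satisfy the following, with positive finite constants $\Delta_F,L,\rho,M$: (i) $F(\mathbf{x}_0)-\inf_{\mathbf{x}}F(\mathbf{x})\le\Delta_F$; (ii) for every $i$ and all $\mathbf{x},\mathbf{y}\in\mathbb{R}^d$, $\|\nabla f_i(\mathbf{x})-\nabla f_i(\mathbf{y})\|_2\le L\|\mathbf{x}-\mathbf{y}\|_2$ and $\|\nabla^2 f_i(\mathbf{x})-\nabla^2 f_i(\mathbf{y})\|_2\le\rho\|\mathbf{x}-\mathbf{y}\|_2$; (iii) $\|\nabla f_i(\mathbf{x})-\nabla F(\mathbf{x})\|_2\le M$ for all $\mathbf{x}\in\mathbb{R}^d$ and $i\in\{1,\dots,n\}$. Let $\epsilon>0$, $\xi\in(0,1)$. Run the algorithm SRVRC (defined in the context) from $\mathbf{x}_0$ with $M_t=4\rho$ for all $t$, $$S^{(g)}=\frac{\sqrt{\rho\epsilon}}{L}\sqrt{n\land\frac{M^2}{\epsilon^2}},\qquad S^{(h)}=\sqrt{n\land\frac{L^2}{\rho\epsilon}},\qquad T=40\Delta_F\rho^{1/2}\epsilon^{-3/2},$$ and batch sizes $$B_t^{(g)}=n\land\frac{1440L^2S^{(g)}\|\mathbf{h}_{t-1}\|_2^2\log^2(2T/\xi)}{\epsilon^2}\ \text{ if } t\bmod S^{(g)}\ne0,\qquad B_t^{(g)}=n\land\frac{1440M^2\log^2(2T/\xi)}{\epsilon^2}\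 \text{ if } t\bmod S^{(g)}=0,$$ $$B_t^{(h)}=n\land\frac{800\rho S^{(h)}\|\mathbf{h}_{t-1}\|_2^2\log^2(2Td/\xi)}{\epsilon}\ \text{ if } t\bmod S^{(h)}\ne0,\qquad B_t^{(h)}=n\land\frac{800L^2\log^2(2Td/\xi)}{\rho\epsilon}\ \text{ if } t\bmod S^{(h)}=0.$$ Then with probability at least $1-\xi$, SRVRC outputs an $(\epsilon,\sqrt{\rho\epsilon})$-approximate local minimum of $F$ (up to absolute constants, in the sense that $\mu(\mathbf{x}_{\mathrm{out}})\le 600\,\epsilon^{3/2}$) within $$\tilde O\bigg(n\land\frac{L^2}{\rho\epsilon}+\frac{\sqrt{\rho}\,\Delta_F}{\epsilon^{3/2}}\sqrt{n\land\frac{L^2}{\rho\epsilon}}\bigg)$$ stochastic Hessian evaluations and $$\tilde O\bigg(n\land\frac{M^2}{\epsilon^2}+\frac{\Delta_F}{\epsilon^{3/2}}\bigg[\sqrt{\rho}\,n\land\frac{L\sqrt n}{\sqrt\epsilon}\land\frac{LM}{\epsilon^{3/2}}\bigg]\bigg)$$ stochastic gradient evaluations.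
   Context: Notation: $a\land b=\min\{a,b\}$; $\|\cdot\|_2$ is the Euclidean norm for vectors and the spectral norm for matrices; $\lambda_{\min}$ is the minimum eigenvalue. $\tilde O(\cdot)$ hides absolute constants and logarithmic factors (polylogarithmic in $T$, $d$, $1/\xi$). A stochastic gradient (resp. Hessian) evaluation is one query of $\nabla f_i(\mathbf{x})$ (resp. $\nabla^2f_i(\mathbf{x})$) for some $i,\mathbf{x}$; up to a factor of at most 2 their total numbers are $\sum_tB_t^{(g)}$ and $\sum_tB_t^{(h)}$ over the executed iterations. Integrality is ignored: $T$, $S^{(g)},S^{(h)}$ and the batch sizes are understood as rounded up to positive integers where needed, and the extra query per iteration caused by rounding batch sizes is not counted. All $f_i$ are twice differentiable. Define $\mu(\mathbf{x})=\max\{\|\nabla F(\mathbf{x})\|_2^{3/2},\,-\lambda_{\min}^3(\nabla^2F(\mathbf{x}))/\rho^{3/2}\}$. A point $\mathbf{x}$ is an $(\epsilon_g,\epsilon_H)$-approximate local minimum if $\|\nabla F(\mathbf{x})\|_2\le\epsilon_g$ and $\lambda_{\min}(\nabla^2F(\mathbf{x}))\ge-\epsilon_H$; thus $\mu(\mathbf{x})\le\epsilon^{3/2}$ iff $\mathbf{x}$ is an $(\epsilon,\sqrt{\rho\epsilon})$-approximate local minimum. Index sets are multisets. For an index multiset $\mathcal{I}$, $\nabla f_{\mathcal{I}}(\mathbf{x})=\frac1{|\mathcal{I}|}\sum_{i\in\mathcal{I}}\nabla f_i(\mathbf{x})$ if $|\mathcal{I}|<n$ and $\nabla f_{\mathcal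 I}(\mathbf{x})=\nabla F(\mathbf{x})$ otherwise; $\nabla^2 f_{\mathcal{I}}(\mathbf{x})$ is defined in the same way with Hessians. Sampling an index set of size $B$ means drawing $B$ indices i.i.d. uniformly from $\{1,\dots,n\}$, independently of everything previously drawn. Algorithm SRVRC (inputs $T$, $B^{(g)}_t,B^{(h)}_t$, $M_t$, $S^{(g)},S^{(h)}$, $\mathbf{x}_0$, $\epsilon$, $\rho$). For $t=0,\dots,T-1$: sample $\mathcal{J}_t$ with $|\mathcal{J}_t|=B_t^{(g)}$ and $\mathcal{I}_t$ with $|\mathcal{I}_t|=B_t^{(h)}$; set - $\mathbf{v}_t=\nabla f_{\mathcal{J}_t}(\mathbf{x}_t)$ if $t\bmod S^{(g)}=0$, and $\mathbf{v}_t=\nabla f_{\mathcal{J}_t}(\mathbf{x}_t)-\nabla f_{\mathcal{J}_t}(\mathbf{x}_{t-1})+\mathbf{v}_{t-1}$ otherwise; - $\mathbf{U}_t=\nabla^2 f_{\mathcal{I}_t}(\mathbf{x}_t)$ if $t\bmod S^{(h)}=0$, and $\mathbf{U}_t=\nabla^2 f_{\mathcal{I}_t}(\mathbf{x}_t)-\nabla^2 f_{\mathcal{I}_t}(\mathbf{x}_{t-1})+\mathbf{U}_{t-1}$ otherwise; - $\mathbf{h}_t\in\arg\min_{\mathbf{h}\in\mathbb{R}^d}m_t(\mathbf{h})$, where $m_t(\mathbf{h})=\langle\mathbf{v}_t,\mathbf{h}\rangle+\frac12\langle\mathbf{U}_t\mathbf{h},\mathbf{h}\rangle+\frac{M_t}{6}\|\mathbf{h}\|_2^3$;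 - $\mathbf{x}_{t+1}=\mathbf{x}_t+\mathbf{h}_t$. If $\|\mathbf{h}_t\|_2\le\sqrt{\epsilon/\rho}$, stop and output $\mathbf{x}_{\mathrm{out}}=\mathbf{x}_{t+1}$. *)

theory Defs
  imports "HOL-Probability.Probability"
begin

section \<open>Gradients, Hessians and spectral quantities\<close>

definition grad :: "(real^'d \<Rightarrow> real) \<Rightarrow> real^'d \<Rightarrow> real^'d" where
  "grad f x = (THE g. GDERIV f x :> g)"

definition hess :: "(real^'d \<Rightarrow> real) \<Rightarrow> real^'d \<Rightarrow> real^'d^'d" where
  "hess f x = jacobian (grad f) (at x)"

definition twice_differentiable :: "(real^'d \<Rightarrow> real) \<Rightarrow> bool" where
  "twice_differentiable f \<longleftrightarrow>
     (\<forall>x. f differentiable (at x)) \<and> (\<forall>x. grad f differentiable (at x))"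

text \<open>The library norm on matrices is the Frobenius norm, hence the explicit operator norm.\<close>

definition spectral_norm :: "real^'d^'d \<Rightarrow> real" where
  "spectral_norm A = onorm ((*v) A)"

text \<open>Only used for symmetric matrices, whose set of real eigenvalues is finite and nonempty.\<close>

definition lambda_min :: "real^'d^'d \<Rightarrow> real" where
  "lambda_min A = Min {c. \<exists>v. v \<noteq> 0 \<and> A *v v = c *\<^sub>R v}"

definition mu :: "(real^'d \<Rightarrow> real) \<Rightarrow> real \<Rightarrow> real^'d \<Rightarrow> real" where
  "mu F \<rho> x = max (norm (grad F x) powr (3/2))
                   (- (lambda_min (hess F x) ^ 3) / \<rho> powr (3/2))"

section \<open>Finite sums and subsampled derivatives\<close>

definition finite_sum :: "nat \<Rightarrow> (nat \<Rightarrow> real^'d \<Rightarrow> real) \<Rightarrow> real^'d \<Rightarrow> real" where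
  "finite_sum n f x = (\<Sum>i=1..n. f i x) / real n"

definition batch_grad ::
  "nat \<Rightarrow> (nat \<Rightarrow> real^'d \<Rightarrow> real) \<Rightarrow> nat multiset \<Rightarrow> real^'d \<Rightarrow> real^'d" where
  "batch_grad n f J x =
     (if size J < n then (1 / real (size J)) *\<^sub>R (\<Sum>i\<in>#J. grad (f i) x)
      else grad (finite_sum n f) x)"

definition batch_hess ::
  "nat \<Rightarrow> (nat \<Rightarrow> real^'d \<Rightarrow> real) \<Rightarrow> nat multiset \<Rightarrow> real^'d \<Rightarrow> real^'d^'d" where
  "batch_hess n f I x =
     (if size I < n then (1 / real (size I)) *\<^sub>R (\<Sum>i\<in>#I. hess (f i) x)
      else hess (finite_sum n f) x)"

definition sample :: "nat \<Rightarrow> nat \<Rightarrow> nat multiset pmf" where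
  "sample n B = map_pmf mset (replicate_pmf B (pmf_of_set {1..n}))"

definition round_up :: "real \<Rightarrow> nat" where
  "round_up r = max 1 (nat \<lceil>r\<rceil>)"

section \<open>The algorithm SRVRC\<close>

text \<open>An iteration records the sampled index multisets \<open>J\<^sub>t\<close>, \<open>I\<^sub>t\<close>, the iterate \<open>x\<^sub>t\<close>,
  the estimators \<open>v\<^sub>t\<close>, \<open>U\<^sub>t\<close> and the step \<open>h\<^sub>t\<close>.  A run is the chronological list of
  the executed iterations, so its length is the index of the iteration to come.\<close>

datatype ('d::finite) iteration = Iteration
  (grad_batch: "nat multiset") (hess_batch: "nat multiset")
  (iterate: "real^'d") (grad_est: "real^'d") (hess_est: "real^'d^'d") (step: "real^'d")

type_synonym 'd run = "'d iteration list"

definition next_iterate :: "real^('d::finite) \<Rightarrow> 'd run \<Rightarrow> real^'d" where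
  "next_iterate x0 r = (if r = [] then x0 else iterate (last r) + step (last r))"

text \<open>The step \<open>h\<^sub>t\<^sub>-\<^sub>1\<close>; its value for the empty run is a dummy, as iteration 0 is a
  checkpoint and its batch sizes do not depend on a previous step.\<close>

definition prev_step :: "('d::finite) run \<Rightarrow> real^'d" where
  "prev_step r = (if r = [] then 0 else step (last r))"

definition stopped :: "real \<Rightarrow> real \<Rightarrow> ('d::finite) run \<Rightarrow> bool" where
  "stopped \<epsilon> \<rho> r \<longleftrightarrow> r \<noteq> [] \<and> norm (step (last r)) \<le> sqrt (\<epsilon> / \<rho>)"

definition next_grad_est ::
  "nat \<Rightarrow> (nat \<Rightarrow> real^('d::finite) \<Rightarrow> real) \<Rightarrow> nat \<Rightarrow> real^'d \<Rightarrow> 'd run \<Rightarrow> nat multiset \<Rightarrow> real^'d" where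
  "next_grad_est n f Sg x0 r J =
     (if length r mod Sg = 0 then batch_grad n f J (next_iterate x0 r)
      else batch_grad n f J (next_iterate x0 r) - batch_grad n f J (iterate (last r))
             + grad_est (last r))"

definition next_hess_est ::
  "nat \<Rightarrow> (nat \<Rightarrow> real^('d::finite) \<Rightarrow> real) \<Rightarrow> nat \<Rightarrow> real^'d \<Rightarrow> 'd run \<Rightarrow> nat multiset \<Rightarrow> real^'d^'d" where
  "next_hess_est n f Sh x0 r I =
     (if length r mod Sh = 0 then batch_hess n f I (next_iterate x0 r)
      else batch_hess n f I (next_iterate x0 r) - batch_hess n f I (iterate (last r))
             + hess_est (last r))"

definition cubic_model :: "real^'d \<Rightarrow> real^'d^'d \<Rightarrow> real \<Rightarrow> real^'d \<Rightarrow> real" where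
  "cubic_model v U m h = v \<bullet> h + (1/2) * ((U *v h) \<bullet> h) + (m / 6) * norm h ^ 3"

text \<open>How ties between global minimizers of the cubic model are broken is left open: a rule
  may depend on the whole past and on the current samples (but not on future ones), and it
  may be randomized.\<close>

type_synonym 'd rule = "'d run \<Rightarrow> nat multiset \<Rightarrow> nat multiset \<Rightarrow> (real^'d) pmf"

definition minimizing_rule ::
  "nat \<Rightarrow> (nat \<Rightarrow> real^'d \<Rightarrow> real) \<Rightarrow> (nat \<Rightarrow> real) \<Rightarrow> nat \<Rightarrow> nat \<Rightarrow> real^'d \<Rightarrow> 'd rule \<Rightarrow> bool" where
  "minimizing_rule n f Mt Sg Sh x0 sel \<longleftrightarrow>
     (\<forall>r J I. \<forall>h \<in> set_pmf (sel r J I).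
        is_arg_min (cubic_model (next_grad_est n f Sg x0 r J) (next_hess_est n f Sh x0 r I)
                      (Mt (length r))) (\<lambda>_. True) h)"

text \<open>The batch size functions \<open>Bg\<close>, \<open>Bh\<close> give real values as functions of \<open>t\<close> and
  \<open>h\<^sub>t\<^sub>-\<^sub>1\<close>; rounding takes place when sampling.\<close>

definition srvrc_iteration ::
  "nat \<Rightarrow> (nat \<Rightarrow> real^('d::finite) \<Rightarrow> real) \<Rightarrow> (nat \<Rightarrow> real^'d \<Rightarrow> real) \<Rightarrow> (nat \<Rightarrow> real^'d \<Rightarrow> real) \<Rightarrow>
   nat \<Rightarrow> nat \<Rightarrow> real^'d \<Rightarrow> 'd rule \<Rightarrow> 'd run \<Rightarrow> 'd run pmf" where
  "srvrc_iteration n f Bg Bh Sg Sh x0 sel r =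
     do { J \<leftarrow> sample n (round_up (Bg (length r) (prev_step r)));
          I \<leftarrow> sample n (round_up (Bh (length r) (prev_step r)));
          h \<leftarrow> sel r J I;
          return_pmf (r @ [Iteration J I (next_iterate x0 r)
                             (next_grad_est n f Sg x0 r J) (next_hess_est n f Sh x0 r I) h]) }"

primrec srvrc ::
  "nat \<Rightarrow> (nat \<Rightarrow> real^('d::finite) \<Rightarrow> real) \<Rightarrow> (nat \<Rightarrow> real^'d \<Rightarrow> real) \<Rightarrow> (nat \<Rightarrow> real^'d \<Rightarrow> real) \<Rightarrow>
   nat \<Rightarrow> nat \<Rightarrow> real^'d \<Rightarrow> real \<Rightarrow> real \<Rightarrow> 'd rule \<Rightarrow> nat \<Rightarrow> 'd run pmf" where
  "srvrc n f Bg Bh Sg Sh x0 \<epsilon> \<rho> sel 0 = return_pmf []"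
| "srvrc n f Bg Bh Sg Sh x0 \<epsilon> \<rho> sel (Suc T) =
     do { r \<leftarrow> srvrc n f Bg Bh Sg Sh x0 \<epsilon> \<rho> sel T;
          if stopped \<epsilon> \<rho> r then return_pmf r
          else srvrc_iteration n f Bg Bh Sg Sh x0 sel r }"

text \<open>The output exists only if the stopping criterion was met within the \<open>T\<close> iterations.\<close>

definition srvrc_output :: "real \<Rightarrow> real \<Rightarrow> real^('d::finite) \<Rightarrow> 'd run \<Rightarrow> (real^'d) option" where
  "srvrc_output \<epsilon> \<rho> x0 r = (if stopped \<epsilon> \<rho> r then Some (next_iterate x0 r) else None)"

text \<open>Derivative queries over the executed iterations: one per sampled index at a checkpoint
  and two otherwise, because the sampled derivatives are then needed at both \<open>x\<^sub>t\<close> and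
  \<open>x\<^sub>t\<^sub>-\<^sub>1\<close>.  Queries caused by rounding up a batch size are not counted, so the unrounded
  batch sizes enter.\<close>

definition evaluations :: "nat \<Rightarrow> (nat \<Rightarrow> real^('d::finite) \<Rightarrow> real) \<Rightarrow> 'd run \<Rightarrow> real" where
  "evaluations S B r =
     (\<Sum>t<length r. (if t mod S = 0 then 1 else 2) * B t (prev_step (take t r)))"

end

theory Submission
  imports Defs
begin

text \<open>
  The errors of the estimators are martingales that restart at every checkpoint.  For a centered
  increment \<open>Y\<close> of size at most \<open>b\<close> one has \<open>E cosh (norm (x + Y)) \<le> cosh b * cosh (norm x)\<close>, and
  likewise \<open>E tr cosh (X + Y) \<le> cosh b * tr cosh X\<close> for symmetric matrices.  Both follow from a
  second-derivative inequality \<open>u\<^sub>k'' \<le> b\<^sup>2 u\<^sub>k\<^sub>-\<^sub>1\<close> between consecutive terms of the power series along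
  the line \<open>x + s Y\<close>.  The batch sizes keep the exponent accumulated over one period proportional to the
  squared logarithm, so by Markov's inequality and a union bound all gradient errors are at most
  \<open>\<epsilon> / 3\<close> and all Hessian errors at most \<open>2/5 sqrt (\<rho> \<epsilon>)\<close>, with probability at least \<open>1 - \<xi>\<close>.

  On this event a step \<open>h\<close> longer than \<open>sqrt (\<epsilon> / \<rho>)\<close> decreases \<open>F\<close> by at least \<open>\<rho> / 4 * norm h ^ 3\<close>.
  This bounds the number of such steps, and hence the checkpoints, as well as the sum of \<open>norm h ^ 2\<close>, which
  controls the remaining batches.  The first short step leads to an approximate local minimum, by the
  first and second order optimality conditions of the cubic model.
\<close>

section \<open>Hyperbolic cosine potentials\<close>

text \<open>The potentials are handled term by term because the norm is not differentiable at the
  origin and functions of non-commuting sums of matrices are awkward to differentiate, whereas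
  \<open>(x \<bullet> x) ^ k\<close> and the traces of even powers are polynomials along a line.
  Integrating the inequality between consecutive terms twice produces the coefficients of cosh and
  sinh: the sinh part is linear in the increment and disappears on averaging, the cosh part is a
  Cauchy product. Since cosh is even, one potential controls both signs of an eigenvalue. Away from
  checkpoints the uncapped batch size grows with the square of the previous step, as does the
  squared increment. So the batch sizes are random, but the conditional expectation of the potential
  grows at most by a constant factor. A checkpoint contributes at most
  \<open>4 * \<psi>\<^sup>2\<close> to the exponent and the rest of its period at most as much
  again, against a threshold of \<open>16 * \<psi>\<^sup>2\<close>; the surplus pays for the union
  bound.\<close>

lemma nonneg_of_second_derivative_nonneg:
  fixes D D' D'' :: "real \<Rightarrow> real"
  assumes D: "\<And>s. (D has_real_derivative D' s) (at s)"
    and D': "\<And>s. (D' has_real_derivative D'' s) (at s)"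
    and convex: "\<And>s. 0 \<le> s \<Longrightarrow> 0 \<le> D'' s"
    and zero: "D 0 = 0" "D' 0 = 0" and s: "0 \<le> s"
  shows "0 \<le> D s"
proof -
  have "0 \<le> D' t" if "0 \<le> t" for t
    using DERIV_nonneg_imp_nondecreasing[of 0 t D'] D' convex that zero by (metis order_trans)
  then show ?thesis
    using DERIV_nonneg_imp_nondecreasing[of 0 s D] D s zero by (metis order_trans)
qed

text \<open>The induction on \<open>k\<close> integrates twice from 0: the bound for
  \<open>u k\<close>, multiplied by \<open>b\<^sup>2\<close>, dominates the second derivative of
  \<open>u (Suc k)\<close>. Even powers build the cosh series and odd ones the sinh series; the
  latter carry the first derivatives at 0.\<close>

lemma iterated_second_derivative_bound:
  fixes u u' u'' :: "nat \<Rightarrow> real \<Rightarrow> real" and b s :: real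
  assumes u: "\<And>k s. (u k has_real_derivative u' k s) (at s)"
    and u': "\<And>k s. (u' k has_real_derivative u'' k s) (at s)"
    and zero: "\<And>s. u'' 0 s \<le> 0"
    and Suc: "\<And>k s. u'' (Suc k) s \<le> b\<^sup>2 * u k s"
    and s: "0 \<le> s"
  shows "u k s \<le> (\<Sum>j\<le>k. b ^ (2 * j) * (s ^ (2 * j) / fact (2 * j) * u (k - j) 0
                                     + s ^ (2 * j + 1) / fact (2 * j + 1) * u' (k - j) 0))"
  using s
proof (induction k arbitrary: s)
  case 0
  have "0 \<le> (u 0 0 + s * u' 0 0) - u 0 s"
    by (rule nonneg_of_second_derivative_nonneg[where D' = "\<lambda>s. u' 0 0 - u' 0 s"
          and D'' = "\<lambda>s. - u'' 0 s" and D = "\<lambda>s. (u 0 0 + s * u' 0 0) - u 0 s"])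
      (auto intro!: derivative_eq_intros u u' zero 0)
  then show ?case by simp
next
  case (Suc k)
  define R where "R s = (\<Sum>j\<le>k. b ^ (2 * j) * (s ^ (2 * j) / fact (2 * j) * u (k - j) 0
                                     + s ^ (2 * j + 1) / fact (2 * j + 1) * u' (k - j) 0))" for s
  \<comment> \<open>\<open>Q'\<close> and \<open>Q\<close> are the first and second antiderivatives
    of \<open>b\<^sup>2 * R\<close>, where \<open>R\<close> is the bound of the induction
    hypothesis, with the initial data of \<open>u (Suc k)\<close>.\<close>
  define Q' where "Q' s = u' (Suc k) 0 + (\<Sum>j\<le>k. b ^ (2 * j + 2) *
      (s ^ (2 * j + 1) / fact (2 * j + 1) * u (k - j) 0
       + s ^ (2 * j + 2) / fact (2 * j + 2) * u' (k - j) 0))" for s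
  define Q where "Q s = u (Suc k) 0 + s * u' (Suc k) 0 + (\<Sum>j\<le>k. b ^ (2 * j + 2) *
      (s ^ (2 * j + 2) / fact (2 * j + 2) * u (k - j) 0
       + s ^ (2 * j + 3) / fact (2 * j + 3) * u' (k - j) 0))" for s
  have pow: "((\<lambda>s. s ^ Suc m / fact (Suc m) * c :: real) has_real_derivative s ^ m / fact m * c) (at s)"
    for m c s
  proof -
    have "((\<lambda>s. s ^ Suc m / fact (Suc m) * c) has_real_derivative (real (Suc m) * s ^ m) / fact (Suc m) * c) (at s)"
      using DERIV_pow[of "Suc m" s] by (intro DERIV_cmult_right DERIV_cdivide) simp
    then show ?thesis by simp
  qed
  have pow2: "((\<lambda>s. s ^ (2 * j + 2) / fact (2 * j + 2) * c :: real) has_real_derivative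
      s ^ (2 * j + 1) / fact (2 * j + 1) * c) (at s)" for j c s
  proof -
    have "2 * j + 2 = Suc (2 * j + 1)" by simp
    then show ?thesis using pow[of "2 * j + 1" c s] by (simp only:)
  qed
  have pow3: "((\<lambda>s. s ^ (2 * j + 3) / fact (2 * j + 3) * c :: real) has_real_derivative
      s ^ (2 * j + 2) / fact (2 * j + 2) * c) (at s)" for j c s
  proof -
    have "2 * j + 3 = Suc (2 * j + 2)" by simp
    then show ?thesis using pow[of "2 * j + 2" c s] by (simp only:)
  qed
  have pow1: "((\<lambda>s. s ^ (2 * j + 1) / fact (2 * j + 1) * c :: real) has_real_derivative
      s ^ (2 * j) / fact (2 * j) * c) (at s)" for j c s
  proof -
    have "2 * j + 1 = Suc (2 * j)" by simp
    then show ?thesis using pow[of "2 * j" c s] by (simp only:)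
  qed
  have Q: "(Q has_real_derivative Q' s) (at s)" for s
  proof -
    have "((\<lambda>s. u (Suc k) 0 + s * u' (Suc k) 0) has_real_derivative u' (Suc k) 0) (at s)"
      by (auto intro!: derivative_eq_intros)
    then show ?thesis
      unfolding Q_def Q'_def by (intro DERIV_add DERIV_sum DERIV_cmult pow2 pow3)
  qed
  have Q': "(Q' has_real_derivative b\<^sup>2 * R s) (at s)" for s
  proof -
    have "b\<^sup>2 * R s = 0 + (\<Sum>j\<le>k. b ^ (2 * j + 2) * (s ^ (2 * j) / fact (2 * j) * u (k - j) 0
                                     + s ^ (2 * j + 1) / fact (2 * j + 1) * u' (k - j) 0))"
      unfolding R_def sum_distrib_left power_add by (simp add: mult_ac)
    then show ?thesis
      unfolding Q'_def by (simp only:) (intro DERIV_add DERIV_const DERIV_sum DERIV_cmult pow1 pow2)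
  qed
  have "0 \<le> Q s - u (Suc k) s"
  proof (rule nonneg_of_second_derivative_nonneg[where D' = "\<lambda>s. Q' s - u' (Suc k) s"
        and D'' = "\<lambda>s. b\<^sup>2 * R s - u'' (Suc k) s" and D = "\<lambda>s. Q s - u (Suc k) s"])
    show "((\<lambda>s. Q s - u (Suc k) s) has_real_derivative Q' s - u' (Suc k) s) (at s)" for s
      by (intro derivative_intros Q u)
    show "((\<lambda>s. Q' s - u' (Suc k) s) has_real_derivative b\<^sup>2 * R s - u'' (Suc k) s) (at s)" for s
      by (intro derivative_intros Q' u')
    show "0 \<le> b\<^sup>2 * R s - u'' (Suc k) s" if "0 \<le> s" for s
      using Suc.IH[OF that] assms(4)[of k s] mult_left_mono[of "u k s" "R s" "b\<^sup>2"]
      by (simp add: R_def)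
  qed (auto simp: Q_def Q'_def Suc.prems zero_power)
  moreover have "Q s = (\<Sum>j\<le>Suc k. b ^ (2 * j) * (s ^ (2 * j) / fact (2 * j) * u (Suc k - j) 0
                                     + s ^ (2 * j + 1) / fact (2 * j + 1) * u' (Suc k - j) 0))"
    unfolding Q_def sum.atMost_Suc_shift
    by (simp add: numeral_3_eq_3 del: fact_Suc power_Suc)
  ultimately show ?case by simp
qed

lemma cosh_real_sums: "(\<lambda>n. x ^ (2 * n) / fact (2 * n)) sums cosh (x :: real)"
proof -
  have "(\<lambda>n. if even n then x ^ n /\<^sub>R fact n else 0) sums cosh x"
    by (rule cosh_converges)
  also have "?this \<longleftrightarrow> (\<lambda>n. if even (2 * n) then x ^ (2 * n) /\<^sub>R fact (2 * n) else 0) sums cosh x"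
    by (subst sums_mono_reindex[of "\<lambda>n. 2 * n"])
       (auto simp: strict_mono_def elim!: evenE)
  finally show ?thesis by (simp add: divide_inverse mult.commute)
qed

text \<open>Termwise comparison of power series, by
  \<open>2 ^ k * fact k \<le> fact (2 * k)\<close>. It turns products of cosh factors into sums of
  squares in an exponent.\<close>

lemma cosh_le_exp_half_square: "cosh (x :: real) \<le> exp (x\<^sup>2 / 2)"
proof -
  have le: "x ^ (2 * k) / fact (2 * k) \<le> (x\<^sup>2 / 2) ^ k /\<^sub>R fact k" for k
  proof -
    have "(2::real) ^ k * fact k \<le> fact (2 * k)"
    proof (induction k)
      case (Suc k)
      have "(2::real) ^ Suc k * fact (Suc k) = (2 * real k + 2) * (2 ^ k * fact k)"
        by (simp add: algebra_simps)
      also have "\<dots> \<le> (2 * real k + 2) * ((2 * real k + 1) * fact (2 * k))"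
        using Suc by (intro mult_left_mono) (auto intro: order_trans simp: algebra_simps)
      also have "\<dots> = fact (2 * Suc k)"
        by (simp add: algebra_simps)
      finally show ?case .
    qed simp
    then have "x ^ (2 * k) / fact (2 * k) \<le> x ^ (2 * k) / (2 ^ k * fact k)"
      by (intro divide_left_mono) (auto simp: power_mult)
    then show ?thesis
      by (simp add: power_mult[symmetric] power_divide divide_simps mult.commute)
  qed
  show ?thesis
    by (rule sums_le[OF le cosh_real_sums exp_converges])
qed

text \<open>\<open>q k\<close> plays the role of \<open>x\<^sup>2\<^sup>k / (2k)!\<close> and \<open>bd b y\<close> says that the increment \<open>y\<close> has size at most
  \<open>b\<close>.  The linear term \<open>l\<close> averages to 0 over centered increments.\<close>

locale cosh_potential =
  fixes q :: "nat \<Rightarrow> 'v::real_vector \<Rightarrow> real" and adm :: "'v set" and bd :: "real \<Rightarrow> 'v \<Rightarrow> bool"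
  assumes adm_subspace: "subspace adm"
    and bd_scale: "\<And>b c y. bd b y \<Longrightarrow> bd (\<bar>c\<bar> * b) (c *\<^sub>R y)"
    and q_nonneg: "\<And>k x. x \<in> adm \<Longrightarrow> 0 \<le> q k x"
    and q_summable: "\<And>x. x \<in> adm \<Longrightarrow> summable (\<lambda>k. q k x)"
    and q_step: "\<And>x b k. x \<in> adm \<Longrightarrow> 0 \<le> b \<Longrightarrow> \<exists>l. linear l \<and>
      (\<forall>y\<in>adm. bd b y \<longrightarrow> q k (x + y) \<le> (\<Sum>j\<le>k. b ^ (2 * j) / fact (2 * j) * q (k - j) x) + l y)"
begin

definition potential :: "'v \<Rightarrow> real" where
  "potential x = (\<Sum>k. q k x)"

lemma potential_nonneg: "x \<in> adm \<Longrightarrow> 0 \<le> potential x"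
  by (simp add: potential_def suminf_nonneg q_nonneg q_summable)

lemma potential_step:
  assumes x: "x \<in> adm" and y: "\<And>i. i \<in> A \<Longrightarrow> y i \<in> adm" "\<And>i. i \<in> A \<Longrightarrow> bd b (y i)"
    and b: "0 \<le> b" and centered: "(\<Sum>i\<in>A. y i) = 0"
  shows "(\<Sum>i\<in>A. potential (x + y i)) \<le> real (card A) * (cosh b * potential x)"
proof -
  have xy: "x + y i \<in> adm" if "i \<in> A" for i
    using adm_subspace x y(1)[OF that] by (simp add: subspace_add)
  define c where "c k = (\<Sum>j\<le>k. b ^ (2 * j) / fact (2 * j) * q (k - j) x)" for k
  have le: "(\<Sum>i\<in>A. q k (x + y i)) \<le> real (card A) * c k" for k
  proof -
    obtain l where l: "linear l"
      "\<And>z. z \<in> adm \<Longrightarrow> bd b z \<Longrightarrow> q k (x + z) \<le> c k + l z"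
      using q_step[OF x b, of k] unfolding c_def by blast
    have "(\<Sum>i\<in>A. q k (x + y i)) \<le> (\<Sum>i\<in>A. c k + l (y i))"
      using l(2) y by (intro sum_mono) auto
    also have "\<dots> = real (card A) * c k + l (\<Sum>i\<in>A. y i)"
      by (simp add: sum.distrib linear_sum[OF l(1)])
    finally show ?thesis
      by (simp add: centered linear_0[OF l(1)])
  qed
  \<comment> \<open>Cauchy product of the two series; nonnegative terms give the absolute
    convergence that it requires.\<close>
  have "c sums (cosh b * potential x)"
    unfolding c_def potential_def
    using Cauchy_product_sums[of "\<lambda>j. b ^ (2 * j) / fact (2 * j)" "\<lambda>k. q k x"]
      cosh_real_sums[of b] q_summable[OF x] q_nonneg[OF x]
    by (simp add: sums_iff power_mult)
  then have 1: "(\<lambda>k. real (card A) * c k) sums (real (card A) * (cosh b * potential x))"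
    by (rule sums_mult)
  have 2: "(\<lambda>k. \<Sum>i\<in>A. q k (x + y i)) sums (\<Sum>i\<in>A. potential (x + y i))"
    unfolding potential_def by (intro sums_sum summable_sums q_summable xy)
  show ?thesis
    by (rule sums_le[OF le 2 1])
qed

end

section \<open>The cosh of the Euclidean norm\<close>

interpretation vec: cosh_potential
  "\<lambda>k x. (x \<bullet> x) ^ k / fact (2 * k)" "UNIV :: 'a::real_inner set" "\<lambda>b y. norm y \<le> b"
proof
  fix x :: 'a and k
  show "summable (\<lambda>k. (x \<bullet> x) ^ k / fact (2 * k))"
    using sums_summable[OF cosh_real_sums[of "norm x"]] by (simp add: power_mult dot_square_norm)
  fix b :: real assume b: "0 \<le> b"
  \<comment> \<open>First derivative of the \<open>k\<close>-th term along
    \<open>x + s *\<^sub>R y\<close>; at \<open>s = 0\<close> it is linear in \<open>y\<close>. For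
    \<open>k = 0\<close> the truncated exponent \<open>k - 1\<close> is harmless because of the
    factor \<open>real k\<close>.\<close>
  define u' where "u' y k s = 2 * real k * (norm (x + s *\<^sub>R y))\<^sup>2 ^ (k - 1) * ((x + s *\<^sub>R y) \<bullet> y) / fact (2 * k)"
    for y k and s :: real
  define l where "l y = (\<Sum>j\<le>k. b ^ (2 * j) / fact (2 * j + 1) * u' y (k - j) 0)" for y
  have "l = (\<lambda>y. (\<Sum>j\<le>k. b ^ (2 * j) / fact (2 * j + 1) *
      (2 * real (k - j) * (norm x)\<^sup>2 ^ (k - j - 1) / fact (2 * (k - j)))) * (x \<bullet> y))"
    unfolding l_def u'_def sum_distrib_right by (intro ext sum.cong refl) (simp del: fact_Suc)
  then have "linear l"
    by (simp only:) (intro linearI, simp_all only: inner_add_right inner_scaleR_right real_scaleR_def algebra_simps)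
  moreover have "((x + y) \<bullet> (x + y)) ^ k / fact (2 * k) \<le>
      (\<Sum>j\<le>k. b ^ (2 * j) / fact (2 * j) * ((x \<bullet> x) ^ (k - j) / fact (2 * (k - j)))) + l y"
    if y: "norm y \<le> b" for y
  proof -
    define z where "z s = x + s *\<^sub>R y" for s
    define w where "w s = z s \<bullet> z s" for s
    have w: "(w has_real_derivative 2 * (z s \<bullet> y)) (at s)" for s
    proof -
      have w_eq: "w = (\<lambda>s. x \<bullet> x + 2 * s * (x \<bullet> y) + s\<^sup>2 * (y \<bullet> y))"
        by (auto simp: w_def z_def algebra_simps inner_commute power2_eq_square)
      show ?thesis unfolding w_eq z_def
        by (rule derivative_eq_intros refl | simp add: algebra_simps inner_commute)+
    qed
    have zy: "((\<lambda>s. z s \<bullet> y) has_real_derivative y \<bullet> y) (at s)" for s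
      unfolding z_def inner_add_left inner_scaleR_left
      by (rule derivative_eq_intros refl | simp)+
    define u where "u k s = w s ^ k / fact (2 * k)" for k s
    define v where "v k s = 2 * real k * w s ^ (k - 1) * (z s \<bullet> y) / fact (2 * k)" for k s
    define v' where "v' k s = 2 * real k * (real (k - 1) * w s ^ (k - 1 - 1) * (2 * (z s \<bullet> y)) * (z s \<bullet> y)
       + w s ^ (k - 1) * (y \<bullet> y)) / fact (2 * k)" for k s
    have yb: "y \<bullet> y \<le> b\<^sup>2"
      using y by (simp add: dot_square_norm power_mono)
    have w0: "0 \<le> w s" for s
      by (simp add: w_def)
    have "u k 1 \<le> (\<Sum>j\<le>k. b ^ (2 * j) * (1 ^ (2 * j) / fact (2 * j) * u (k - j) 0
                                     + 1 ^ (2 * j + 1) / fact (2 * j + 1) * v (k - j) 0))"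
    proof (rule iterated_second_derivative_bound[where u'' = v'])
      show "(u k has_real_derivative v k s) (at s)" for k s
        unfolding u_def v_def
        by (rule derivative_eq_intros w refl | simp)+
      show "(v k has_real_derivative v' k s) (at s)" for k s
        unfolding v'_def v_def
        by (rule DERIV_cdivide) (rule derivative_eq_intros w zy refl | simp add: algebra_simps)+
      show "v' 0 s \<le> 0" for s by (simp add: v'_def)
      show "v' (Suc k) s \<le> b\<^sup>2 * u k s" for k s
      proof -
        have cs: "(z s \<bullet> y)\<^sup>2 \<le> w s * b\<^sup>2"
          using Cauchy_Schwarz_ineq[of "z s" y] mult_left_mono[OF yb w0[of s]] by (simp add: w_def)
        \<comment> \<open>Cauchy-Schwarz makes both parts of the second derivative multiples of
          \<open>w s ^ k * b\<^sup>2\<close>. The total multiplicity \<open>2 * k + 1\<close>, with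
          the outer factor \<open>2 * (k + 1)\<close>, is exactly the quotient of
          \<open>fact (2 * k + 2)\<close> by \<open>fact (2 * k)\<close>.\<close>
        have "real k * w s ^ (k - 1) * (2 * (z s \<bullet> y)\<^sup>2) + w s ^ k * (y \<bullet> y)
           \<le> real k * w s ^ (k - 1) * (2 * (w s * b\<^sup>2)) + w s ^ k * b\<^sup>2"
          using cs yb w0[of s] by (intro add_mono mult_left_mono) auto
        also have "\<dots> = (2 * real k + 1) * (w s ^ k * b\<^sup>2)"
          by (cases k) (auto simp: algebra_simps)
        finally have "2 * real (Suc k) * (real k * w s ^ (k - 1) * (2 * (z s \<bullet> y)\<^sup>2) + w s ^ k * (y \<bullet> y)) / fact (2 * Suc k)
          \<le> 2 * real (Suc k) * ((2 * real k + 1) * (w s ^ k * b\<^sup>2)) / fact (2 * Suc k)"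
          by (intro divide_right_mono mult_left_mono) auto
        also have "\<dots> = b\<^sup>2 * u k s"
        proof -
          have "(fact (2 * Suc k) :: real) = (2 * real (Suc k)) * (2 * real k + 1) * fact (2 * k)"
            by (simp add: algebra_simps)
          then show ?thesis
            by (simp add: u_def divide_simps del: fact_Suc of_nat_Suc) 
        qed
        finally show ?thesis by (simp add: v'_def power2_eq_square mult.assoc)
      qed
    qed simp
    then show ?thesis
      by (simp add: u_def v_def l_def u'_def w_def z_def dot_square_norm sum.distrib distrib_left)
  qed
  ultimately show "\<exists>l. linear l \<and> (\<forall>y\<in>UNIV. norm y \<le> b \<longrightarrow> ((x + y) \<bullet> (x + y)) ^ k / fact (2 * k) \<le>
      (\<Sum>j\<le>k. b ^ (2 * j) / fact (2 * j) * ((x \<bullet> x) ^ (k - j) / fact (2 * (k - j)))) + l y)"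
    by blast
qed (auto simp: subspace_UNIV mult_left_mono)

lemma vec_potential_eq: "vec.potential x = cosh (norm x)"
  unfolding vec.potential_def
  using cosh_real_sums[of "norm x"] by (simp add: sums_iff power_mult dot_square_norm)

section \<open>Matrix powers and the trace of cosh on symmetric matrices\<close>

primrec mpow :: "real^'n^'n \<Rightarrow> nat \<Rightarrow> real^'n^'n" where
  "mpow A 0 = mat 1"
| "mpow A (Suc k) = A ** mpow A k"

lemma mpow_add: "mpow A (i + j) = mpow A i ** mpow A j"
  by (induction i) (simp_all add: matrix_mul_assoc)

lemma mpow_commute: "mpow A k ** A = A ** mpow A k"
  by (induction k) (simp_all add: matrix_mul_assoc[symmetric])

lemma transpose_mpow:
  assumes "transpose A = A"
  shows "transpose (mpow A k) = mpow A k"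
  by (induction k) (simp_all add: matrix_transpose_mul assms mpow_commute)

lemma inner_matrix_eq_trace: "A \<bullet> B = trace (A ** transpose B)" for A B :: "real^'n^'n"
  by (simp add: inner_vec_def trace_def matrix_matrix_mult_def transpose_def)

lemma trace_cmul: "trace (c *\<^sub>R A) = c * trace A" for A :: "real^'n^'n"
  by (simp add: trace_def sum_distrib_left)

lemma scaleR_matrix_mult: "(c *\<^sub>R A) ** B = c *\<^sub>R (A ** B)" "A ** (c *\<^sub>R B) = c *\<^sub>R (A ** B)"
  for A B :: "real^'n^'n"
  by (simp_all add: matrix_scalar_ac flip: scalar_matrix_assoc)

lemma matrix_mult_add_left: "(A + B) ** C = A ** C + B ** C" for A B C :: "real^'n^'n"
  by (simp add: matrix_matrix_mult_def vec_eq_iff sum.distrib distrib_right)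

lemma transpose_add: "transpose (A + B) = transpose A + transpose B" for A B :: "real^'n^'n"
  by (simp add: transpose_def vec_eq_iff)

lemma transpose_diff: "transpose (A - B) = transpose A - transpose B" for A B :: "real^'n^'n"
  by (simp add: transpose_def vec_eq_iff)

lemma transpose_scaleR: "transpose (c *\<^sub>R A) = c *\<^sub>R transpose A" for A :: "real^'n^'n"
  by (simp add: transpose_def vec_eq_iff)

text \<open>The squared Frobenius norm is the sum of the squared column norms, and left
  multiplication acts column by column. Hence an operator bound on \<open>Y\<close> suffices and no
  dimension factor appears.\<close>

lemma inner_matrix_mult_le:
  fixes Y Z :: "real^'n^'n"
  assumes "\<And>v. norm (Y *v v) \<le> b * norm v"
  shows "(Y ** Z) \<bullet> (Y ** Z) \<le> b\<^sup>2 * (Z \<bullet> Z)"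
proof -
  have column_mult: "column j (Y ** Z) = Y *v column j Z" for j
    by (simp add: column_def matrix_matrix_mult_def matrix_vector_mult_def)
  have columns: "A \<bullet> A = (\<Sum>j\<in>UNIV. (norm (column j A))\<^sup>2)" for A :: "real^'n^'n"
    unfolding dot_square_norm[symmetric] inner_vec_def column_def by (subst sum.swap) simp
  have "(norm (column j (Y ** Z)))\<^sup>2 \<le> b\<^sup>2 * (norm (column j Z))\<^sup>2" for j
    using power_mono[OF assms[of "column j Z"] norm_ge_zero, of 2]
    by (simp add: column_mult power_mult_distrib)
  then show ?thesis
    unfolding columns sum_distrib_left by (intro sum_mono)
qed

lemma norm_matrix_vector_le: "norm (A *v x) \<le> norm A * norm x" for A :: "real^'n^'m"
proof (rule power2_le_imp_le)
  have "(norm (A *v x))\<^sup>2 = (\<Sum>i\<in>UNIV. (A $ i \<bullet> x)\<^sup>2)"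
    unfolding power2_norm_eq_inner inner_vec_def[of "A *v x"] matrix_vector_mul_component
    by (simp add: power2_eq_square)
  also have "\<dots> \<le> (\<Sum>i\<in>UNIV. (A $ i \<bullet> A $ i) * (x \<bullet> x))"
    by (intro sum_mono Cauchy_Schwarz_ineq)
  also have "\<dots> = (norm A * norm x)\<^sup>2"
    by (simp add: power_mult_distrib dot_square_norm[symmetric] inner_vec_def[of A] sum_distrib_right)
  finally show "(norm (A *v x))\<^sup>2 \<le> (norm A * norm x)\<^sup>2" .
qed simp

text \<open>The extra factor \<open>W\<close> closes the induction: cyclicity moves one factor
  \<open>Z s\<close> behind \<open>W\<close>, and since \<open>Z s\<close> is affine in
  \<open>s\<close>, the hypothesis applies to the constant matrices \<open>W ** X\<close> and
  \<open>W ** Y\<close>. Later \<open>W = mat 1\<close> gives the first derivative of a term and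
  \<open>W = Y\<close> the second.\<close>

lemma trace_mpow_has_derivative:
  fixes X Y W :: "real^'n^'n"
  defines "Z \<equiv> \<lambda>s. X + s *\<^sub>R Y"
  shows "((\<lambda>s. trace (mpow (Z s) k ** W)) has_real_derivative
      (\<Sum>a<k. trace (mpow (Z s) a ** Y ** mpow (Z s) (k - 1 - a) ** W))) (at s)"
proof (induction k arbitrary: W)
  case (Suc k)
  let ?D = "\<lambda>W. \<Sum>a<k. trace (mpow (Z s) a ** Y ** mpow (Z s) (k - 1 - a) ** W)"
  have cyc: "trace (A ** B ** W) = trace (B ** (W ** A))" for A B W :: "real^'n^'n"
    using trace_mul_sym[of A "B ** W"] by (simp add: matrix_mul_assoc)
  have eq: "trace (mpow (Z s) (Suc k) ** W)
      = trace (mpow (Z s) k ** (W ** X)) + s * trace (mpow (Z s) k ** (W ** Y))" for s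
    by (simp add: cyc[symmetric] Z_def matrix_mult_add_left scaleR_matrix_mult trace_add trace_cmul)
  have split: "trace (A ** (W ** Z s)) = trace (A ** (W ** X)) + s * trace (A ** (W ** Y))"
    for A :: "real^'n^'n"
    by (simp add: Z_def matrix_add_ldistrib scaleR_matrix_mult trace_add trace_cmul)
  have "((\<lambda>s. trace (mpow (Z s) (Suc k) ** W)) has_real_derivative
      ?D (W ** X) + (s * ?D (W ** Y) + trace (mpow (Z s) k ** (W ** Y)))) (at s)"
    unfolding eq
    by (intro DERIV_add Suc.IH) (rule derivative_eq_intros Suc.IH refl | simp)+
  also have "?D (W ** X) + (s * ?D (W ** Y) + trace (mpow (Z s) k ** (W ** Y)))
      = trace (mpow (Z s) k ** (W ** Y)) + ?D (W ** Z s)"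
    by (simp add: split sum.distrib sum_distrib_left)
  also have "\<dots> = (\<Sum>a<Suc k. trace (mpow (Z s) a ** Y ** mpow (Z s) (Suc k - 1 - a) ** W))"
  proof -
    have "trace (mpow (Z s) a ** Y ** mpow (Z s) (k - 1 - a) ** (W ** Z s))
        = trace (mpow (Z s) (Suc a) ** Y ** mpow (Z s) (Suc k - 1 - Suc a) ** W)" for a
      by (simp add: matrix_mul_assoc trace_mul_sym[of _ "Z s"])
    moreover have "trace (mpow (Z s) k ** (W ** Y)) = trace (Y ** mpow (Z s) k ** W)"
      by (simp add: cyc)
    ultimately show ?thesis
      unfolding sum.lessThan_Suc_shift by simp
  qed
  finally show ?case .
qed simp

text \<open>The values at even indices are discretely convex, so their maximum is attained at an
  end, and both ends agree. An odd index is the midpoint of its even neighbours.\<close>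

lemma midpoint_convex_le_endpoint:
  fixes g :: "nat \<Rightarrow> real"
  assumes convex: "\<And>i k. i \<le> m \<Longrightarrow> k \<le> m \<Longrightarrow> 2 * g (i + k) \<le> g (2 * i) + g (2 * k)"
    and ends: "g (2 * m) = g 0" and a: "a \<le> 2 * m"
  shows "g a \<le> g 0"
proof -
  define h where "h = (\<lambda>i. g (2 * i))"
  define P where "P i \<longleftrightarrow> i \<le> m \<and> (\<forall>j\<le>m. h j \<le> h i)" for i
  have "\<exists>i. P i"
  proof -
    have "Max (h ` {..m}) \<in> h ` {..m}" by (intro Max_in) auto
    then obtain i where "i \<le> m" "Max (h ` {..m}) = h i" unfolding image_iff by blast
    then show ?thesis unfolding P_def by (metis Max_ge atMost_iff finite_atMost finite_imageI imageI)
  qed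
  \<comment> \<open>For the least maximizer the left neighbour is strictly smaller, which
    contradicts convexity at an interior index.\<close>
  define i where "i = (LEAST i. P i)"
  have i: "P i"
    unfolding i_def using \<open>\<exists>i. P i\<close> by (rule LeastI_ex)
  have "h i = h 0"
  proof (cases "i = 0 \<or> i = m")
    case True
    then show ?thesis using ends by (auto simp: h_def)
  next
    case False
    then have "0 < i" "i < m" using i by (auto simp: P_def)
    have "\<not> P (i - 1)"
      using \<open>0 < i\<close> not_less_Least[of "i - 1" P] by (simp add: i_def)
    then have "h (i - 1) < h i"
    proof -
      have "i - 1 \<le> m" using \<open>i < m\<close> by simp
      with \<open>\<not> P (i - 1)\<close> obtain j where "j \<le> m" "\<not> h j \<le> h (i - 1)" unfolding P_def by blast
      then show ?thesis using i unfolding P_def by force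
    qed
    moreover have "h (i + 1) \<le> h i"
      using i \<open>i < m\<close> by (simp add: P_def)
    moreover have "2 * h i \<le> h (i - 1) + h (i + 1)"
    proof -
      obtain j where j: "i = Suc j" using \<open>0 < i\<close> gr0_conv_Suc by blast
      have "j + (j + 2) = 2 * Suc j" by simp
      then show ?thesis
        using convex[of j "j + 2"] \<open>i < m\<close> unfolding h_def j by (simp only:) simp
    qed
    ultimately show ?thesis by linarith
  qed
  then have even: "g (2 * j) \<le> g 0" if "j \<le> m" for j
    using i that by (simp add: P_def h_def)
  show ?thesis
  proof (cases "even a")
    case True
    then show ?thesis using even a by (auto elim!: evenE)
  next
    case False
    then obtain j where "a = 2 * j + 1" by (rule oddE)
    then have j: "a = j + (j + 1)" by simp
    with convex[of j "j + 1"] even[of j] even[of "j + 1"] a show ?thesis by simp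
  qed
qed

text \<open>The Frobenius product of \<open>Z\<^sup>i Y Z\<^sup>m\<^sup>-\<^sup>i\<close> and \<open>Z\<^sup>k Y Z\<^sup>m\<^sup>-\<^sup>k\<close> depends only on \<open>i + k\<close>, so
  the Cauchy-Schwarz inequality makes the traces midpoint convex in \<open>a\<close>.\<close>

lemma trace_two_insertions_le:
  fixes Z Y :: "real^'n^'n"
  assumes Z: "transpose Z = Z" and Y: "transpose Y = Y" and a: "a \<le> 2 * m"
  shows "trace (mpow Z a ** Y ** mpow Z (2 * m - a) ** Y) \<le> trace (mpow Z (2 * m) ** Y ** Y)"
proof -
  define g where "g a = trace (mpow Z a ** Y ** mpow Z (2 * m - a) ** Y)" for a
  define P where "P i = mpow Z i ** Y ** mpow Z (m - i)" for i
  have inner: "P i \<bullet> P k = g (i + k)" if "i \<le> m" "k \<le> m" for i k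
  proof -
    have "P i \<bullet> P k = trace (mpow Z i ** Y ** (mpow Z (m - i) ** mpow Z (m - k)) ** Y ** mpow Z k)"
      by (simp add: inner_matrix_eq_trace P_def matrix_transpose_mul transpose_mpow Z Y matrix_mul_assoc)
    also have "\<dots> = trace (mpow Z k ** mpow Z i ** Y ** (mpow Z (m - i) ** mpow Z (m - k)) ** Y)"
      by (subst trace_mul_sym) (simp add: matrix_mul_assoc)
    also have "\<dots> = g (i + k)"
      using that by (simp add: g_def mult_2 add.commute flip: mpow_add)
    finally show ?thesis .
  qed
  have "g a \<le> g 0"
  proof (rule midpoint_convex_le_endpoint[OF _ _ a])
    show "2 * g (i + k) \<le> g (2 * i) + g (2 * k)" if "i \<le> m" "k \<le> m" for i k
    proof -
      have "0 \<le> P i \<bullet> P i - P i \<bullet> P k - (P k \<bullet> P i - P k \<bullet> P k)"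
        using inner_ge_zero[of "P i - P k"] by (simp only: inner_diff_left inner_diff_right)
      also have "\<dots> = g (i + i) - g (i + k) - (g (k + i) - g (k + k))"
        using that by (simp only: inner)
      finally show ?thesis by (simp only: mult_2 add.commute[of k i])
    qed
    show "g (2 * m) = g 0"
      using trace_mul_sym[of Y "mpow Z (2 * m) ** Y"] by (simp add: g_def matrix_mul_assoc)
  qed
  also have "g 0 = trace (mpow Z (2 * m) ** Y ** Y)"
    using trace_mul_sym[of Y "mpow Z (2 * m) ** Y"] by (simp add: g_def matrix_mul_assoc)
  finally show ?thesis by (simp add: g_def)
qed

lemma trace_mpow_even: "transpose X = X \<Longrightarrow> trace (mpow X (2 * k)) = mpow X k \<bullet> mpow X k"
  by (simp add: inner_matrix_eq_trace transpose_mpow mult_2 mpow_add)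

interpretation mat: cosh_potential
  "\<lambda>k X. trace (mpow X (2 * k)) / fact (2 * k)" "{X :: real^'n^'n. transpose X = X}"
  "\<lambda>b Y. \<forall>v. norm (Y *v v) \<le> b * norm v"
proof
  show "subspace {X :: real^'n^'n. transpose X = X}"
    by (auto simp: subspace_def transpose_add transpose_scaleR) (simp add: transpose_def vec_eq_iff)
  show "\<forall>v. norm ((c *\<^sub>R Y) *v v) \<le> \<bar>c\<bar> * b * norm v"
    if "\<forall>v. norm (Y *v v) \<le> b * norm v" for b c and Y :: "real^'n^'n"
    using that by (auto simp: scaleR_matrix_vector_assoc[symmetric] mult.assoc intro!: mult_left_mono)
  fix X :: "real^'n^'n" and k assume "X \<in> {X. transpose X = X}"
  then have X: "transpose X = X" by simp
  show "0 \<le> trace (mpow X (2 * k)) / fact (2 * k)"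
    by (simp add: trace_mpow_even X)
  show "summable (\<lambda>k. trace (mpow X (2 * k)) / fact (2 * k))"
  proof (rule summable_comparison_test')
    have "mpow X k \<bullet> mpow X k \<le> real CARD('n) * (norm X) ^ (2 * k)" for k
    proof (induction k)
      case 0
      then show ?case by (simp add: inner_matrix_eq_trace trace_I)
    next
      case (Suc k)
      then show ?case
        using inner_matrix_mult_le[of X "norm X" "mpow X k", OF norm_matrix_vector_le]
          mult_left_mono[OF Suc, of "(norm X)\<^sup>2"]
        by (simp add: power2_eq_square algebra_simps)
    qed
    then show "norm (trace (mpow X (2 * k)) / fact (2 * k)) \<le> real CARD('n) * (norm X ^ (2 * k) / fact (2 * k))"
      if "0 \<le> k" for k
      using that by (simp add: trace_mpow_even X abs_of_nonneg divide_right_mono)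
    show "summable (\<lambda>k. real CARD('n) * (norm X ^ (2 * k) / fact (2 * k)))"
      by (intro summable_mult sums_summable[OF cosh_real_sums])
  qed
  fix b :: real assume b: "0 \<le> b"
  define u' where "u' Y k s = 2 * real k * trace (mpow (X + s *\<^sub>R Y) (2 * k - 1) ** Y) / fact (2 * k)"
    for Y :: "real^'n^'n" and k and s :: real
  define l where "l Y = (\<Sum>j\<le>k. b ^ (2 * j) / fact (2 * j + 1) * u' Y (k - j) 0)" for Y
  have lin: "linear (\<lambda>Y. a * (c * trace (B ** Y) / d))" for a c d and B :: "real^'n^'n"
    by (rule linearI)
      (simp_all add: matrix_add_ldistrib scaleR_matrix_mult trace_add trace_cmul distrib_left add_divide_distrib)
  have "linear l"
    unfolding l_def u'_def scaleR_zero_left add_0_right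
    by (rule linear_compose_sum) (intro ballI lin)
  moreover have "trace (mpow (X + Y) (2 * k)) / fact (2 * k) \<le>
      (\<Sum>j\<le>k. b ^ (2 * j) / fact (2 * j) * (trace (mpow X (2 * (k - j))) / fact (2 * (k - j)))) + l Y"
    if Y: "transpose Y = Y" "\<And>v. norm (Y *v v) \<le> b * norm v" for Y
  proof -
    define Z where "Z s = X + s *\<^sub>R Y" for s
    have Z: "transpose (Z s) = Z s" for s
      by (simp add: Z_def transpose_add transpose_scaleR X Y)
    define u where "u k s = trace (mpow (Z s) (2 * k)) / fact (2 * k)" for k s
    define v where "v k s = 2 * real k * trace (mpow (Z s) (2 * k - 1) ** Y) / fact (2 * k)" for k s
    define v' where "v' k s = 2 * real k *
      (\<Sum>a<2 * k - 1. trace (mpow (Z s) a ** Y ** mpow (Z s) (2 * k - 1 - 1 - a) ** Y)) / fact (2 * k)" for k s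
    have "u k 1 \<le> (\<Sum>j\<le>k. b ^ (2 * j) * (1 ^ (2 * j) / fact (2 * j) * u (k - j) 0
                                     + 1 ^ (2 * j + 1) / fact (2 * j + 1) * v (k - j) 0))"
    proof (rule iterated_second_derivative_bound[where u'' = v'])
      show "(u k has_real_derivative v k s) (at s)" for k s
      proof -
        have "trace (mpow (Z s) a ** Y ** mpow (Z s) (2 * k - 1 - a) ** mat 1)
            = trace (mpow (Z s) (2 * k - 1) ** Y)" if "a < 2 * k" for a
        proof -
          have "trace (mpow (Z s) a ** Y ** mpow (Z s) (2 * k - 1 - a) ** mat 1)
            = trace (mpow (Z s) ((2 * k - 1 - a) + a) ** Y)"
            unfolding mpow_add matrix_mul_rid trace_mul_sym[of "mpow (Z s) a ** Y"] matrix_mul_assoc ..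
          then show ?thesis using that by simp
        qed
        then have "(\<Sum>a<2 * k. trace (mpow (Z s) a ** Y ** mpow (Z s) (2 * k - 1 - a) ** mat 1))
            = 2 * real k * trace (mpow (Z s) (2 * k - 1) ** Y)"
          by simp
        with trace_mpow_has_derivative[of X Y "2 * k" "mat 1" s]
        show ?thesis unfolding u_def v_def Z_def
          by (intro DERIV_cdivide) (simp del: One_nat_def)
      qed
      show "(v k has_real_derivative v' k s) (at s)" for k s
        unfolding v_def v'_def Z_def
        by (intro DERIV_cdivide DERIV_cmult trace_mpow_has_derivative)
      show "v' 0 s \<le> 0" for s by (simp add: v'_def)
      show "v' (Suc k) s \<le> b\<^sup>2 * u k s" for k s
      proof -
        \<comment> \<open>Each of the \<open>2 * k + 1\<close> placements is bounded by the one with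
          the two factors \<open>Y\<close> adjacent, which is the squared Frobenius norm of
          \<open>Y ** mpow (Z s) k\<close>.\<close>
        have "trace (mpow (Z s) a ** Y ** mpow (Z s) (2 * k - a) ** Y) \<le> b\<^sup>2 * trace (mpow (Z s) (2 * k))"
          if "a < 2 * k + 1" for a
        proof -
          have "trace (mpow (Z s) a ** Y ** mpow (Z s) (2 * k - a) ** Y) \<le> trace (mpow (Z s) (2 * k) ** Y ** Y)"
            using that by (intro trace_two_insertions_le Z Y) simp
          also have "\<dots> = (Y ** mpow (Z s) k) \<bullet> (Y ** mpow (Z s) k)"
            using trace_mul_sym[of Y "mpow (Z s) k ** mpow (Z s) k ** Y"]
            by (simp add: inner_matrix_eq_trace matrix_transpose_mul transpose_mpow Z Y mult_2 mpow_add
                matrix_mul_assoc)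
          also have "\<dots> \<le> b\<^sup>2 * (mpow (Z s) k \<bullet> mpow (Z s) k)"
            by (rule inner_matrix_mult_le) (rule Y)
          finally show ?thesis by (simp add: trace_mpow_even Z)
        qed
        then have "(\<Sum>a<2 * k + 1. trace (mpow (Z s) a ** Y ** mpow (Z s) (2 * k - a) ** Y))
            \<le> of_nat (card {..<2 * k + 1}) * (b\<^sup>2 * trace (mpow (Z s) (2 * k)))"
          by (intro sum_bounded_above) simp
        then have "2 * real (Suc k) * (\<Sum>a<2 * k + 1. trace (mpow (Z s) a ** Y ** mpow (Z s) (2 * k - a) ** Y)) / fact (2 * Suc k)
          \<le> 2 * real (Suc k) * ((2 * real k + 1) * (b\<^sup>2 * trace (mpow (Z s) (2 * k)))) / fact (2 * Suc k)"
          by (intro divide_right_mono mult_left_mono) (simp_all add: add.commute)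
        also have "\<dots> = b\<^sup>2 * u k s"
        proof -
          have "(fact (2 * Suc k) :: real) = (2 * real (Suc k)) * (2 * real k + 1) * fact (2 * k)"
            by (simp add: algebra_simps)
          then show ?thesis
            by (simp add: u_def divide_simps del: fact_Suc of_nat_Suc)
        qed
        finally show ?thesis by (simp add: v'_def)
      qed
    qed simp
    then show ?thesis
      by (simp add: u_def v_def l_def u'_def Z_def sum.distrib distrib_left)
  qed
  ultimately show "\<exists>l. linear l \<and> (\<forall>Y\<in>{X. transpose X = X}. (\<forall>v. norm (Y *v v) \<le> b * norm v) \<longrightarrow>
      trace (mpow (X + Y) (2 * k)) / fact (2 * k) \<le>
      (\<Sum>j\<le>k. b ^ (2 * j) / fact (2 * j) * (trace (mpow X (2 * (k - j))) / fact (2 * (k - j)))) + l Y)"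
    by blast
qed

text \<open>Source of the dimension inside the logarithm of the Hessian batch sizes: at a checkpoint
  the error restarts from this value.\<close>

lemma mat_potential_zero: "mat.potential (0 :: real^'n^'n) = real CARD('n)"
proof -
  have "trace (mpow (0 :: real^'n^'n) (2 * k)) / fact (2 * k) = (if k = 0 then real CARD('n) else 0)" for k
    by (cases k) (simp_all add: trace_I, simp add: trace_def)
  then show ?thesis
    unfolding mat.potential_def by (simp only:) (subst suminf_finite[of "{0}"], auto)
qed

text \<open>Compared term by term: \<open>c ^ k\<close> is an eigenvalue of \<open>mpow X k\<close>,
  so its absolute value is at most the Frobenius norm, whose square is the trace of
  \<open>mpow X (2 * k)\<close>. No diagonalization is involved.\<close>

lemma cosh_eigenvalue_le_mat_potential:
  fixes X :: "real^'n^'n"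
  assumes X: "transpose X = X" and v: "v \<noteq> 0" "X *v v = c *\<^sub>R v"
  shows "cosh c \<le> mat.potential X"
proof -
  have pow: "mpow X k *v v = c ^ k *\<^sub>R v" for k
    by (induction k) (simp_all add: v matrix_vector_mul_assoc[symmetric] matrix_vector_mult_scaleR)
  have le: "c ^ (2 * k) / fact (2 * k) \<le> trace (mpow X (2 * k)) / fact (2 * k)" for k
  proof -
    have "\<bar>c\<bar> ^ k \<le> norm (mpow X k)"
      using norm_matrix_vector_le[of "mpow X k" v] v by (simp add: pow power_abs)
    then have "(\<bar>c\<bar> ^ k)\<^sup>2 \<le> (norm (mpow X k))\<^sup>2"
      by (intro power_mono) auto
    moreover have "(\<bar>c\<bar> ^ k)\<^sup>2 = c ^ (2 * k)"
      by (simp add: power_mult[symmetric] mult.commute power_even_abs)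
    ultimately show ?thesis
      by (intro divide_right_mono) (simp_all only: trace_mpow_even[OF X] dot_square_norm, simp)
  qed
  show ?thesis
    unfolding mat.potential_def
    by (rule sums_le[OF le cosh_real_sums summable_sums]) (use mat.q_summable X in auto)
qed

section \<open>Symmetric matrices\<close>

lemma inner_symmetric_matrix:
  fixes A :: "real^'n^'n"
  assumes "transpose A = A"
  shows "x \<bullet> (A *v y) = y \<bullet> (A *v x)"
  using dot_lmul_matrix[of x A y] transpose_matrix_vector[of A x] assms by (simp add: inner_commute)

text \<open>A minimizer of the quadratic form on the unit sphere is an eigenvector: otherwise moving
  along the residual \<open>w\<close> would make the nonnegative form \<open>B\<close>
  negative.\<close>

lemma symmetric_min_eigenvector:
  fixes A :: "real^'n^'n"
  assumes A: "transpose A = A"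
  obtains v c where "v \<noteq> 0" "A *v v = c *\<^sub>R v" "\<And>x. c * (norm x)\<^sup>2 \<le> x \<bullet> (A *v x)"
proof -
  note sym = inner_symmetric_matrix[OF A]
  have "continuous_on (sphere 0 1) (\<lambda>x. x \<bullet> (A *v x))"
    by (intro continuous_intros)
  moreover have "sphere (0::real^'n) 1 \<noteq> {}" by simp
  ultimately obtain v where v: "norm v = 1" and min: "\<And>y. norm y = 1 \<Longrightarrow> v \<bullet> (A *v v) \<le> y \<bullet> (A *v y)"
    using continuous_attains_inf[OF compact_sphere, of 0 1 "\<lambda>x. x \<bullet> (A *v x)"] by auto
  define c where "c = v \<bullet> (A *v v)"
  have ge: "c * (norm x)\<^sup>2 \<le> x \<bullet> (A *v x)" for x
  proof (cases "x = 0")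
    case False
    have "c \<le> (inverse (norm x) *\<^sub>R x) \<bullet> (A *v (inverse (norm x) *\<^sub>R x))"
      unfolding c_def using False by (intro min) simp
    also have "\<dots> = (x \<bullet> (A *v x)) / (norm x)\<^sup>2"
      by (simp add: matrix_vector_mult_scaleR divide_inverse power2_eq_square)
    finally show ?thesis using False by (simp add: field_simps)
  qed simp
  define w where "w = A *v v - c *\<^sub>R v"
  define B where "B x = x \<bullet> (A *v x) - c * (x \<bullet> x)" for x
  have B0: "0 \<le> B x" for x
    using ge[of x] by (simp add: B_def dot_square_norm)
  have "w \<bullet> w = 0"
  proof (rule ccontr)
    assume "w \<bullet> w \<noteq> 0"
    then have pos: "0 < w \<bullet> w" by simp
    have expand: "B (v + t *\<^sub>R w) = 2 * t * (w \<bullet> w) + t\<^sup>2 * B w" for t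
    proof -
      have "v \<bullet> v = 1" using v by (simp add: dot_square_norm)
      have "B (v + t *\<^sub>R w) = (v \<bullet> (A *v v) - c * (v \<bullet> v)) + 2 * t * (w \<bullet> (A *v v) - c * (w \<bullet> v)) + t\<^sup>2 * B w"
        unfolding B_def
        by (simp add: matrix_vector_right_distrib matrix_vector_mult_scaleR inner_add_left inner_add_right
            sym[of v w] inner_commute[of v w] power2_eq_square algebra_simps)
      moreover have "w \<bullet> (A *v v) - c * (w \<bullet> v) = w \<bullet> w"
        by (simp add: w_def inner_diff_right)
      ultimately show ?thesis by (simp add: c_def \<open>v \<bullet> v = 1\<close>)
    qed
    \<comment> \<open>Close to the minimizer of
      \<open>2 * t * (w \<bullet> w) + t\<^sup>2 * B w\<close>; the added 1 avoids a division by
      zero when \<open>B w = 0\<close>.\<close>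
    define t where "t = - (w \<bullet> w) / (B w + 1)"
    have "B w * (w \<bullet> w) < 2 * (B w + 1) * (w \<bullet> w)"
      using B0[of w] pos by (intro mult_strict_right_mono) auto
    then have "2 * t * (w \<bullet> w) + t\<^sup>2 * B w < 0"
      using B0[of w] pos unfolding t_def by (simp add: divide_simps power2_eq_square)
    with expand[of t] B0[of "v + t *\<^sub>R w"] show False by simp
  qed
  then have "A *v v = c *\<^sub>R v" by (simp add: w_def)
  then show thesis using that v ge by (metis norm_zero zero_neq_one)
qed

text \<open>\<open>Min\<close> is informative only on a finite nonempty set. Eigenvectors of
  different eigenvalues are orthogonal, hence independent, which gives finiteness; the minimal
  eigenvector gives nonemptiness.\<close>

lemma lambda_min_ge:
  fixes A :: "real^'n^'n"
  assumes A: "transpose A = A" and ge: "\<And>x. c * (norm x)\<^sup>2 \<le> x \<bullet> (A *v x)"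
  shows "c \<le> lambda_min A"
proof -
  define S where "S = {c. \<exists>v. v \<noteq> 0 \<and> A *v v = c *\<^sub>R v}"
  have "\<forall>c\<in>S. \<exists>v. v \<noteq> 0 \<and> A *v v = c *\<^sub>R v" by (simp add: S_def)
  then obtain e where e: "\<And>c. c \<in> S \<Longrightarrow> e c \<noteq> 0 \<and> A *v e c = c *\<^sub>R e c" by metis
  have orth: "e a \<bullet> e b = 0" if "a \<in> S" "b \<in> S" "a \<noteq> b" for a b
  proof -
    have "b * (e a \<bullet> e b) = a * (e b \<bullet> e a)"
      using inner_symmetric_matrix[OF A, of "e a" "e b"] e[OF that(1)] e[OF that(2)]
      by (simp del: mult_cancel_left mult_cancel_right)
    then have "a * (e a \<bullet> e b) = b * (e a \<bullet> e b)"
      by (simp only: inner_commute[of "e b"])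
    with that show ?thesis by auto
  qed
  have inj: "inj_on e S"
  proof (rule inj_onI, rule ccontr)
    fix a b assume "a \<in> S" "b \<in> S" "e a = e b" "a \<noteq> b"
    with orth[of a b] e[of b] show False by simp
  qed
  have "pairwise orthogonal (e ` S)"
    using orth by (auto simp: pairwise_def orthogonal_def)
  moreover have "0 \<notin> e ` S" using e by auto
  ultimately have "independent (e ` S)"
    by (rule pairwise_orthogonal_independent)
  then have "finite S"
    using independent_bound inj by (metis finite_imageD)
  moreover have "S \<noteq> {}"
    using symmetric_min_eigenvector[OF A] unfolding S_def by (metis (mono_tags, lifting) empty_Collect_eq)
  moreover have "c \<le> a" if "a \<in> S" for a
    using e[OF that] ge[of "e a"] by (simp add: dot_square_norm)
  ultimately show ?thesis
    unfolding lambda_min_def S_def[symmetric] by simp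
qed

text \<open>Polarization: with \<open>y\<close> the image \<open>A *v x\<close> rescaled to the norm
  of \<open>x\<close>, \<open>y \<bullet> (A *v x)\<close> is a difference of two quadratic values,
  and the parallelogram law adds up their bounds.\<close>

lemma norm_matrix_vector_le_of_quadratic_form:
  fixes A :: "real^'n^'n"
  assumes A: "transpose A = A" and le: "\<And>x. \<bar>x \<bullet> (A *v x)\<bar> \<le> r * (norm x)\<^sup>2"
  shows "norm (A *v x) \<le> r * norm x"
proof (cases "A *v x = 0 \<or> x = 0")
  case True
  have "0 \<le> r * (norm x)\<^sup>2" using le[of x] by linarith
  then show ?thesis using True by (auto simp: zero_le_mult_iff)
next
  case False
  define y where "y = (norm x / norm (A *v x)) *\<^sub>R (A *v x)"
  have y: "norm y = norm x" "y \<bullet> (A *v x) = norm x * norm (A *v x)"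
    using False by (simp_all add: y_def dot_square_norm power2_eq_square)
  note sym = inner_symmetric_matrix[OF A, of x y]
  have "4 * (y \<bullet> (A *v x)) = (x + y) \<bullet> (A *v (x + y)) - (x - y) \<bullet> (A *v (x - y))"
    by (simp add: matrix_vector_right_distrib matrix_vector_mult_diff_distrib inner_add_left inner_diff_left
        inner_add_right inner_diff_right sym)
  also have "\<dots> \<le> r * (norm (x + y))\<^sup>2 + r * (norm (x - y))\<^sup>2"
    using le[of "x + y"] le[of "x - y"] by linarith
  also have "\<dots> = 4 * (r * (norm x)\<^sup>2)"
    using y(1) by (simp add: dot_square_norm[symmetric] inner_add_left inner_diff_left
        inner_add_right inner_diff_right algebra_simps) (simp add: dot_square_norm)
  finally have "norm x * norm (A *v x) \<le> norm x * (r * norm x)"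
    by (simp add: y(2) power2_eq_square mult_ac)
  then show ?thesis using False by simp
qed

text \<open>The extreme eigenvalues of \<open>A\<close> are found as the minimal ones of
  \<open>A\<close> and of \<open>- A\<close>. As cosh is even and increasing on the nonnegative
  reals, one bound on the potential limits both in absolute value.\<close>

lemma norm_matrix_vector_le_of_mat_potential:
  fixes A :: "real^'n^'n"
  assumes A: "transpose A = A" and \<theta>: "0 < \<theta>" and r: "0 \<le> r"
    and le: "mat.potential (\<theta> *\<^sub>R A) \<le> cosh (\<theta> * r)"
  shows "norm (A *v x) \<le> r * norm x"
proof -
  have minus_mult: "(- B) *v x = - (B *v x)" for B :: "real^'n^'n" and x
    using matrix_vector_mult_diff_rdistrib[of 0 B x] by simp
  have lower: "- r * (norm x)\<^sup>2 \<le> x \<bullet> (B *v x)" if B: "B = A \<or> B = - A" for B x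
  proof -
    have sym: "transpose B = B"
      using B A transpose_scaleR[of "-1" A] by auto
    obtain v c where v: "v \<noteq> 0" "B *v v = c *\<^sub>R v" "\<And>x. c * (norm x)\<^sup>2 \<le> x \<bullet> (B *v x)"
      using symmetric_min_eigenvector[OF sym] by blast
    have "\<exists>c'. \<bar>c'\<bar> = \<bar>\<theta> * c\<bar> \<and> (\<theta> *\<^sub>R A) *v v = c' *\<^sub>R v"
    proof (cases "B = A")
      case True
      then show ?thesis using v(2) by (intro exI[of _ "\<theta> * c"]) (simp flip: scaleR_matrix_vector_assoc)
    next
      case False
      then have "A *v v = - (c *\<^sub>R v)"
        using B v(2) by (metis add.inverse_inverse minus_mult)
      then show ?thesis
        by (intro exI[of _ "- (\<theta> * c)"]) (simp flip: scaleR_matrix_vector_assoc)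
    qed
    then obtain c' where c': "\<bar>c'\<bar> = \<bar>\<theta> * c\<bar>" "(\<theta> *\<^sub>R A) *v v = c' *\<^sub>R v" by blast
    have "cosh \<bar>\<theta> * c\<bar> = cosh c'"
      unfolding c'(1)[symmetric] by simp
    also have "\<dots> \<le> mat.potential (\<theta> *\<^sub>R A)"
      by (rule cosh_eigenvalue_le_mat_potential[OF _ v(1) c'(2)]) (simp add: transpose_scaleR A)
    also note le
    finally have "cosh \<bar>\<theta> * c\<bar> \<le> cosh (\<theta> * r)" .
    then have "\<bar>\<theta> * c\<bar> \<le> \<theta> * r"
      using \<theta> r by (subst (asm) cosh_real_nonneg_le_iff) auto
    then have "\<bar>c\<bar> \<le> r" using \<theta> by (simp add: abs_mult)
    then have "- r * (norm x)\<^sup>2 \<le> c * (norm x)\<^sup>2"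
      by (intro mult_right_mono) auto
    with v(3)[of x] show ?thesis by linarith
  qed
  show ?thesis
  proof (rule norm_matrix_vector_le_of_quadratic_form[OF A])
    show "\<bar>x \<bullet> (A *v x)\<bar> \<le> r * (norm x)\<^sup>2" for x
      using lower[of A x] lower[of "- A" x] by (simp add: minus_mult abs_le_iff)
  qed
qed

section \<open>Functions with Lipschitz continuous Hessian\<close>

lemma has_derivative_grad:
  assumes "f differentiable (at x)"
  shows "(f has_derivative (\<lambda>h. h \<bullet> grad f x)) (at x)"
proof -
  obtain f' where f': "(f has_derivative f') (at x)"
    using assms by (auto simp: differentiable_def)
  define g where "g = (\<chi> i. f' (axis i 1))"
  have lin: "linear f'" by (rule has_derivative_linear[OF f'])
  have "f' h = h \<bullet> g" for h
  proof -
    have "f' h = f' (\<Sum>i\<in>UNIV. h $ i *\<^sub>R axis i 1)"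
      by (simp add: basis_expansion flip: scalar_mult_eq_scaleR)
    also have "\<dots> = h \<bullet> g"
      by (simp add: linear_sum[OF lin] linear_scale[OF lin] inner_vec_def g_def)
    finally show ?thesis .
  qed
  then have "GDERIV f x :> g"
    using f' by (simp add: gderiv_def) (metis (no_types, lifting) ext)
  moreover have "g' = g" if "GDERIV f x :> g'" for g'
  proof -
    have "(\<lambda>h. h \<bullet> g') = (\<lambda>h. h \<bullet> g)"
      using that \<open>GDERIV f x :> g\<close> unfolding gderiv_def by (rule has_derivative_unique)
    then have "(g' - g) \<bullet> g' = (g' - g) \<bullet> g" by metis
    then have "(g' - g) \<bullet> (g' - g) = 0" by (simp add: inner_diff_right)
    then show ?thesis by simp
  qed
  ultimately have "grad f x = g"
    unfolding grad_def by (rule the_equality)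
  with \<open>GDERIV f x :> g\<close> show ?thesis by (simp add: gderiv_def)
qed

lemma grad_eqI:
  assumes "(f has_derivative (\<lambda>h. h \<bullet> g)) (at x)"
  shows "grad f x = g"
proof -
  have "f differentiable (at x)" using assms by (auto simp: differentiable_def)
  then have "(\<lambda>h. h \<bullet> grad f x) = (\<lambda>h. h \<bullet> g)"
    using has_derivative_unique[OF has_derivative_grad assms] by blast
  then have "(grad f x - g) \<bullet> grad f x = (grad f x - g) \<bullet> g" by metis
  then have "(grad f x - g) \<bullet> (grad f x - g) = 0" by (simp add: inner_diff_right)
  then show ?thesis by simp
qed

lemma twice_differentiableD:
  assumes "twice_differentiable f"
  shows "(f has_derivative (\<lambda>h. h \<bullet> grad f x)) (at x)"
    and "(grad f has_derivative (\<lambda>h. hess f x *v h)) (at x)"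
  using assms by (auto simp: twice_differentiable_def hess_def has_derivative_grad simp flip: jacobian_works)

lemma hess_eqI:
  assumes "(grad f has_derivative (\<lambda>h. A *v h)) (at x)"
  shows "hess f x = A"
proof -
  have "grad f differentiable (at x)" using assms by (auto simp: differentiable_def)
  then have "(\<lambda>h. hess f x *v h) = (\<lambda>h. A *v h)"
    using has_derivative_unique assms unfolding hess_def jacobian_works by blast
  then show ?thesis by (simp add: matrix_eq fun_eq_iff)
qed

lemma norm_matrix_vector_le_spectral_norm: "norm (A *v x) \<le> spectral_norm A * norm x"
  unfolding spectral_norm_def by (rule onorm) simp

text \<open>Pairing with \<open>w = f' h\<close> itself reduces the claim to a real difference
  quotient. Applied to gradients it bounds the Hessians by \<open>L\<close>, as the Hessian
  checkpoints require.\<close>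

lemma linear_le_of_lipschitz:
  fixes f :: "'a::real_normed_vector \<Rightarrow> 'b::real_inner"
  assumes f: "(f has_derivative f') (at x)" and lip: "\<And>y. norm (f x - f y) \<le> L * norm (x - y)"
  shows "norm (f' h) \<le> L * norm h"
proof -
  define w where "w = f' h"
  have "((\<lambda>t. f (x + t *\<^sub>R h) \<bullet> w) has_derivative (\<lambda>t. f' (t *\<^sub>R h) \<bullet> w)) (at 0)"
    by (intro has_derivative_inner_left has_derivative_compose[where g = f and f = "\<lambda>t. x + t *\<^sub>R h"])
      (auto intro!: derivative_eq_intros f)
  then have "((\<lambda>t. f (x + t *\<^sub>R h) \<bullet> w) has_real_derivative w \<bullet> w) (at 0)"
    using linear_scale[OF has_derivative_linear[OF f]]
    by (simp add: has_field_derivative_def mult_commute_abs w_def)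
  then have lim: "((\<lambda>t. (f (x + t *\<^sub>R h) \<bullet> w - f x \<bullet> w) / t) \<longlongrightarrow> w \<bullet> w) (at 0)"
    by (simp add: DERIV_def)
  have "norm (w \<bullet> w) \<le> L * norm h * norm w"
  proof (rule Lim_norm_ubound[OF _ lim])
    have "norm ((f (x + t *\<^sub>R h) \<bullet> w - f x \<bullet> w) / t) \<le> L * norm h * norm w" if "t \<noteq> 0" for t
    proof -
      have "\<bar>(f (x + t *\<^sub>R h) - f x) \<bullet> w\<bar> \<le> norm (f (x + t *\<^sub>R h) - f x) * norm w"
        by (rule Cauchy_Schwarz_ineq2)
      also have "\<dots> \<le> (L * norm (x - (x + t *\<^sub>R h))) * norm w"
        by (intro mult_right_mono) (use lip[of "x + t *\<^sub>R h"] in \<open>simp_all add: norm_minus_commute\<close>)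
      finally show ?thesis using that by (simp add: inner_diff_left divide_le_eq mult_ac)
    qed
    then show "\<forall>\<^sub>F t in at 0. norm ((f (x + t *\<^sub>R h) \<bullet> w - f x \<bullet> w) / t) \<le> L * norm h * norm w"
      by (auto simp: eventually_at_filter intro!: always_eventually)
  qed simp
  then have "norm w * norm w \<le> (L * norm h) * norm w"
    by (simp add: dot_square_norm power2_eq_square)
  moreover have "0 \<le> L * norm h"
    using order_trans[OF norm_ge_zero lip[of "x + h"]] by simp
  ultimately show ?thesis
    unfolding w_def[symmetric] by (cases "norm w = 0") auto
qed

text \<open>The Lipschitz condition is phrased through the action on vectors, so that it passes to
  averages by the triangle inequality and serves each \<open>f i\<close> as well as
  \<open>F\<close>.\<close>

locale hessian_lipschitz =
  fixes f :: "real^'d \<Rightarrow> real" and \<rho> :: real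
  assumes rho: "0 \<le> \<rho>" and twice_diff: "twice_differentiable f"
    and lipschitz: "\<And>x y v. norm ((hess f x - hess f y) *v v) \<le> \<rho> * norm (x - y) * norm v"
begin

lemma along_line:
  shows "((\<lambda>t. f (x + t *\<^sub>R h)) has_real_derivative grad f (x + t *\<^sub>R h) \<bullet> h) (at t)"
    and "((\<lambda>t. grad f (x + t *\<^sub>R h) \<bullet> w) has_real_derivative (hess f (x + t *\<^sub>R h) *v h) \<bullet> w) (at t)"
proof -
  have line: "((\<lambda>t. x + t *\<^sub>R h) has_derivative (\<lambda>t. t *\<^sub>R h)) (at t)"
    by (auto intro!: derivative_eq_intros)
  have "((\<lambda>t. f (x + t *\<^sub>R h)) has_derivative (\<lambda>s. (s *\<^sub>R h) \<bullet> grad f (x + t *\<^sub>R h))) (at t)"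
    by (rule has_derivative_compose[OF line twice_differentiableD(1)[OF twice_diff]])
  then show "((\<lambda>t. f (x + t *\<^sub>R h)) has_real_derivative grad f (x + t *\<^sub>R h) \<bullet> h) (at t)"
    by (simp add: has_field_derivative_def mult_commute_abs inner_commute)
  have "((\<lambda>t. grad f (x + t *\<^sub>R h) \<bullet> w) has_derivative (\<lambda>s. (hess f (x + t *\<^sub>R h) *v (s *\<^sub>R h)) \<bullet> w)) (at t)"
    by (intro has_derivative_inner_left has_derivative_compose[OF line twice_differentiableD(2)[OF twice_diff]])
  then show "((\<lambda>t. grad f (x + t *\<^sub>R h) \<bullet> w) has_real_derivative (hess f (x + t *\<^sub>R h) *v h) \<bullet> w) (at t)"
    by (simp add: has_field_derivative_def mult_commute_abs matrix_vector_mult_scaleR)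
qed

text \<open>Pairing with a fixed \<open>w\<close> leaves a real function of \<open>t\<close> with a
  controlled derivative. The choice of \<open>w\<close> stays open: later it is the remainder
  itself, \<open>h\<close> with a sign, or \<open>u\<close> with a sign.\<close>

lemma gradient_taylor_along:
  assumes "0 \<le> t"
  shows "(grad f (x + t *\<^sub>R h) - grad f x - t *\<^sub>R (hess f x *v h)) \<bullet> w \<le> \<rho> * t\<^sup>2 / 2 * (norm h)\<^sup>2 * norm w"
proof -
  define D where "D t = grad f (x + t *\<^sub>R h) \<bullet> w - t * ((hess f x *v h) \<bullet> w)
      - \<rho> * t\<^sup>2 / 2 * ((norm h)\<^sup>2 * norm w)" for t
  have "D t \<le> D 0"
  proof (rule DERIV_nonpos_imp_nonincreasing[OF assms])
    fix s assume s: "0 \<le> s" "s \<le> t"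
    have "(D has_real_derivative (hess f (x + s *\<^sub>R h) *v h) \<bullet> w - (hess f x *v h) \<bullet> w
        - \<rho> * s * ((norm h)\<^sup>2 * norm w)) (at s)"
      unfolding D_def by (rule derivative_eq_intros along_line refl | simp)+
    moreover have "(hess f (x + s *\<^sub>R h) *v h) \<bullet> w - (hess f x *v h) \<bullet> w \<le> \<rho> * s * ((norm h)\<^sup>2 * norm w)"
    proof -
      have "(hess f (x + s *\<^sub>R h) *v h) \<bullet> w - (hess f x *v h) \<bullet> w
          = ((hess f (x + s *\<^sub>R h) - hess f x) *v h) \<bullet> w"
        by (simp add: matrix_vector_mult_diff_rdistrib inner_diff_left)
      also have "\<dots> \<le> norm ((hess f (x + s *\<^sub>R h) - hess f x) *v h) * norm w"
        by (rule norm_cauchy_schwarz)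
      also have "\<dots> \<le> (\<rho> * norm ((x + s *\<^sub>R h) - x) * norm h) * norm w"
        by (intro mult_right_mono lipschitz) simp
      also have "\<dots> = \<rho> * s * ((norm h)\<^sup>2 * norm w)"
        using s by (simp add: power2_eq_square)
      finally show ?thesis .
    qed
    ultimately show "\<exists>y. (D has_real_derivative y) (at s) \<and> y \<le> 0" by (intro exI conjI) auto
  qed
  then show ?thesis by (simp add: D_def inner_diff_left)
qed

lemma gradient_taylor:
  "norm (grad f (x + h) - grad f x - hess f x *v h) \<le> \<rho> / 2 * (norm h)\<^sup>2"
proof -
  define w where "w = grad f (x + h) - grad f x - hess f x *v h"
  have "w \<bullet> w \<le> \<rho> / 2 * (norm h)\<^sup>2 * norm w"
    using gradient_taylor_along[of 1 x h w] by (simp add: w_def)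
  then have "norm w * norm w \<le> (\<rho> / 2 * (norm h)\<^sup>2) * norm w"
    by (simp add: dot_square_norm power2_eq_square)
  moreover have "0 \<le> \<rho> / 2 * (norm h)\<^sup>2"
    by (simp add: rho)
  ultimately show ?thesis
    unfolding w_def[symmetric] by (cases "norm w = 0") auto
qed

lemma value_taylor:
  shows "f (x + h) \<le> f x + grad f x \<bullet> h + (hess f x *v h) \<bullet> h / 2 + \<rho> / 6 * norm h ^ 3"
    and "f x + grad f x \<bullet> h + (hess f x *v h) \<bullet> h / 2 - \<rho> / 6 * norm h ^ 3 \<le> f (x + h)"
proof -
  \<comment> \<open>The sign \<open>\<sigma>\<close> is 1 for the upper and -1 for the lower
    estimate.\<close>
  define D where "D \<sigma> t = \<sigma> * (f (x + t *\<^sub>R h) - t * (grad f x \<bullet> h) - t\<^sup>2 / 2 * ((hess f x *v h) \<bullet> h))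
      - \<rho> * t ^ 3 / 6 * norm h ^ 3" for \<sigma> t
  have "D \<sigma> 1 \<le> D \<sigma> 0" if \<sigma>: "\<bar>\<sigma>\<bar> = 1" for \<sigma>
  proof (rule DERIV_nonpos_imp_nonincreasing[of 0 1 "D \<sigma>"])
    fix s :: real assume s: "0 \<le> s" "s \<le> 1"
    have "(D \<sigma> has_real_derivative \<sigma> * (grad f (x + s *\<^sub>R h) \<bullet> h - grad f x \<bullet> h - s * ((hess f x *v h) \<bullet> h))
        - \<rho> * s\<^sup>2 / 2 * norm h ^ 3) (at s)"
      unfolding D_def by (rule derivative_eq_intros along_line refl | simp add: power2_eq_square)+
    moreover have "\<sigma> * (grad f (x + s *\<^sub>R h) \<bullet> h - grad f x \<bullet> h - s * ((hess f x *v h) \<bullet> h))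
        \<le> \<rho> * s\<^sup>2 / 2 * norm h ^ 3"
      using gradient_taylor_along[OF s(1), of x h "\<sigma> *\<^sub>R h"] \<sigma>
      by (simp add: inner_diff_left power2_eq_square power3_eq_cube mult_ac)
    ultimately show "\<exists>y. (D \<sigma> has_real_derivative y) (at s) \<and> y \<le> 0" by (intro exI conjI) auto
  qed simp
  from this[of 1] this[of "-1"]
  show "f (x + h) \<le> f x + grad f x \<bullet> h + (hess f x *v h) \<bullet> h / 2 + \<rho> / 6 * norm h ^ 3"
    and "f x + grad f x \<bullet> h + (hess f x *v h) \<bullet> h / 2 - \<rho> / 6 * norm h ^ 3 \<le> f (x + h)"
    by (simp_all add: D_def)
qed

text \<open>The second difference is symmetric in \<open>u\<close> and \<open>v\<close>, so letting \<open>s\<close> tend to 0 gives the symmetry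
  of the Hessian.\<close>

lemma second_difference:
  assumes s: "0 \<le> s"
  shows "\<bar>f (x + s *\<^sub>R v + s *\<^sub>R u) - f (x + s *\<^sub>R v) - (f (x + s *\<^sub>R u) - f x) - s\<^sup>2 * ((hess f x *v v) \<bullet> u)\<bar>
      \<le> \<rho> * (norm u + norm v) ^ 3 * s ^ 3"
proof -
  define a b where "a = norm u" and "b = norm v"
  have ab: "0 \<le> a" "0 \<le> b" by (simp_all add: a_def b_def)
  have T: "\<bar>f (y + s *\<^sub>R u) - f y - s * (grad f y \<bullet> u) - s\<^sup>2 / 2 * ((hess f y *v u) \<bullet> u)\<bar> \<le> \<rho> / 6 * a ^ 3 * s ^ 3"
    for y
    using value_taylor[of y "s *\<^sub>R u"] s
    by (intro abs_leI) (simp_all add: matrix_vector_mult_scaleR power_mult_distrib a_def power2_eq_square algebra_simps)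
  have G: "\<bar>s * ((grad f (x + s *\<^sub>R v) - grad f x) \<bullet> u) - s\<^sup>2 * ((hess f x *v v) \<bullet> u)\<bar> \<le> \<rho> / 2 * b\<^sup>2 * a * s ^ 3"
  proof -
    have "\<bar>(grad f (x + s *\<^sub>R v) - grad f x - s *\<^sub>R (hess f x *v v)) \<bullet> u\<bar> \<le> \<rho> * s\<^sup>2 / 2 * b\<^sup>2 * a"
      using gradient_taylor_along[OF s, of x v u] gradient_taylor_along[OF s, of x v "- u"]
      by (simp add: a_def b_def abs_le_iff)
    then have "s * \<bar>(grad f (x + s *\<^sub>R v) - grad f x - s *\<^sub>R (hess f x *v v)) \<bullet> u\<bar> \<le> s * (\<rho> * s\<^sup>2 / 2 * b\<^sup>2 * a)"
      using s by (rule mult_left_mono)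
    moreover have "\<bar>s * ((grad f (x + s *\<^sub>R v) - grad f x) \<bullet> u) - s\<^sup>2 * ((hess f x *v v) \<bullet> u)\<bar>
       = s * \<bar>(grad f (x + s *\<^sub>R v) - grad f x - s *\<^sub>R (hess f x *v v)) \<bullet> u\<bar>"
    proof -
      have "s * ((grad f (x + s *\<^sub>R v) - grad f x) \<bullet> u) - s\<^sup>2 * ((hess f x *v v) \<bullet> u)
          = s * ((grad f (x + s *\<^sub>R v) - grad f x - s *\<^sub>R (hess f x *v v)) \<bullet> u)"
        by (simp add: inner_diff_left power2_eq_square algebra_simps)
      then show ?thesis using s by (simp only: abs_mult abs_of_nonneg)
    qed
    ultimately show ?thesis by (simp add: power2_eq_square power3_eq_cube mult_ac)
  qed
  have H: "\<bar>s\<^sup>2 / 2 * ((hess f (x + s *\<^sub>R v) *v u) \<bullet> u) - s\<^sup>2 / 2 * ((hess f x *v u) \<bullet> u)\<bar> \<le> \<rho> / 2 * b * a\<^sup>2 * s ^ 3"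
  proof -
    have "\<bar>((hess f (x + s *\<^sub>R v) - hess f x) *v u) \<bullet> u\<bar> \<le> norm ((hess f (x + s *\<^sub>R v) - hess f x) *v u) * norm u"
      by (rule Cauchy_Schwarz_ineq2)
    also have "\<dots> \<le> (\<rho> * norm ((x + s *\<^sub>R v) - x) * norm u) * norm u"
      by (intro mult_right_mono lipschitz) simp
    finally have "s\<^sup>2 / 2 * \<bar>((hess f (x + s *\<^sub>R v) - hess f x) *v u) \<bullet> u\<bar> \<le> s\<^sup>2 / 2 * (\<rho> * (s * b) * a * a)"
      using s by (intro mult_left_mono) (simp_all add: a_def b_def)
    moreover have "\<bar>s\<^sup>2 / 2 * ((hess f (x + s *\<^sub>R v) *v u) \<bullet> u) - s\<^sup>2 / 2 * ((hess f x *v u) \<bullet> u)\<bar>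
      = s\<^sup>2 / 2 * \<bar>((hess f (x + s *\<^sub>R v) - hess f x) *v u) \<bullet> u\<bar>"
      unfolding right_diff_distrib[symmetric] abs_mult
      by (simp add: matrix_vector_mult_diff_rdistrib inner_diff_left)
    ultimately show ?thesis by (simp add: power2_eq_square power3_eq_cube mult_ac)
  qed
  have "\<bar>f (x + s *\<^sub>R v + s *\<^sub>R u) - f (x + s *\<^sub>R v) - (f (x + s *\<^sub>R u) - f x) - s\<^sup>2 * ((hess f x *v v) \<bullet> u)\<bar>
      \<le> \<rho> / 6 * a ^ 3 * s ^ 3 + \<rho> / 6 * a ^ 3 * s ^ 3 + \<rho> / 2 * b\<^sup>2 * a * s ^ 3 + \<rho> / 2 * b * a\<^sup>2 * s ^ 3"
    using T[of "x + s *\<^sub>R v"] T[of x] G H unfolding inner_diff_left right_diff_distrib by linarith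
  also have "\<dots> = \<rho> * (a ^ 3 / 3 + b\<^sup>2 * a / 2 + b * a\<^sup>2 / 2) * s ^ 3"
    by (simp add: field_simps)
  also have "\<dots> \<le> \<rho> * (a + b) ^ 3 * s ^ 3"
  proof (intro mult_right_mono mult_left_mono rho)
    have "(a + b) ^ 3 = a ^ 3 + 3 * (b * a\<^sup>2) + 3 * (b\<^sup>2 * a) + b ^ 3"
      by (simp add: power2_eq_square power3_eq_cube algebra_simps)
    moreover have "0 \<le> a ^ 3" "0 \<le> b ^ 3" "0 \<le> b * a\<^sup>2" "0 \<le> b\<^sup>2 * a" using ab by simp_all
    ultimately show "a ^ 3 / 3 + b\<^sup>2 * a / 2 + b * a\<^sup>2 / 2 \<le> (a + b) ^ 3" by linarith
  qed (use s in simp)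
  finally show ?thesis by (simp add: a_def b_def)
qed

text \<open>\<open>hess\<close> is the Jacobian of the gradient, so its symmetry has to be proved.
  Admissibility for the matrix potential and the spectral arguments depend on it.\<close>

lemma transpose_hess: "transpose (hess f x) = hess f x"
proof -
  have sym: "(hess f x *v v) \<bullet> u = (hess f x *v u) \<bullet> v" for u v
  proof -
    define K where "K = 2 * (\<rho> * (norm u + norm v) ^ 3)"
    have le: "\<bar>(hess f x *v v) \<bullet> u - (hess f x *v u) \<bullet> v\<bar> \<le> K * s" if s: "0 < s" for s
    proof -
      have "\<bar>s\<^sup>2 * ((hess f x *v v) \<bullet> u) - s\<^sup>2 * ((hess f x *v u) \<bullet> v)\<bar> \<le> K * s ^ 3"
      proof -
        have eq: "x + s *\<^sub>R v + s *\<^sub>R u = x + s *\<^sub>R u + s *\<^sub>R v" by simp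
        show ?thesis
          using second_difference[of s x v u] second_difference[of s x u v] s
          unfolding K_def eq add.commute[of "norm v"] by linarith
      qed
      then have "s\<^sup>2 * \<bar>(hess f x *v v) \<bullet> u - (hess f x *v u) \<bullet> v\<bar> \<le> s\<^sup>2 * (K * s)"
        by (simp add: abs_mult power2_eq_square power3_eq_cube mult_ac flip: right_diff_distrib)
      then show ?thesis using s by simp
    qed
    have "((\<lambda>s. K * s) \<longlongrightarrow> K * 0) (at_right 0)"
      by (intro tendsto_intros)
    then have "\<bar>(hess f x *v v) \<bullet> u - (hess f x *v u) \<bullet> v\<bar> \<le> K * 0"
      by (rule tendsto_lowerbound) (auto simp: eventually_at_filter intro!: always_eventually le)
    then show ?thesis by simp
  qed
  have "transpose (hess f x) *v u = hess f x *v u" for u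
  proof (rule vector_eq_ldot[THEN iffD1, rule_format])
    fix v
    show "v \<bullet> (transpose (hess f x) *v u) = v \<bullet> (hess f x *v u)"
      using sym[of u v] dot_lmul_matrix[of u "hess f x" v]
      by (simp add: inner_commute transpose_matrix_vector)
  qed
  then show ?thesis by (simp add: matrix_eq)
qed

end

section \<open>Minimizers of the cubic model\<close>

lemma nonpos_of_le_small_multiples:
  fixes a K :: real
  assumes le: "\<And>s. 0 < s \<Longrightarrow> s \<le> 1 \<Longrightarrow> a \<le> s * K"
  shows "a \<le> 0"
proof (rule ccontr)
  assume "\<not> a \<le> 0"
  moreover from this have K: "0 < K" using le[of 1] by simp
  ultimately have "a \<le> min 1 (a / (2 * K)) * K" by (intro le) auto
  also have "\<dots> \<le> a / (2 * K) * K" using K by (intro mult_right_mono) auto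
  finally show False using \<open>\<not> a \<le> 0\<close> K by simp
qed

context
  fixes v h :: "real^'d" and U :: "real^'d^'d" and m :: real
  assumes U: "transpose U = U" and m: "0 < m"
    and min: "\<And>w. cubic_model v U m h \<le> cubic_model v U m w"
begin

text \<open>The competitor \<open>h - s *\<^sub>R g\<close> lowers the model by
  \<open>s * (g \<bullet> g)\<close> up to an explicit remainder \<open>s\<^sup>2 * K\<close>, so
  minimality forces \<open>g = 0\<close>. This avoids differentiating the cubed norm and covers
  \<open>h = 0\<close> as well.\<close>

lemma cubic_minimizer_stationary: "v + U *v h + (m / 2 * norm h) *\<^sub>R h = 0"
proof -
  note sym = inner_symmetric_matrix[OF U]
  define g where "g = v + U *v h + (m / 2 * norm h) *\<^sub>R h"
  have cube: "norm (h - s *\<^sub>R g) ^ 3 \<le> norm h ^ 3 - 3 * norm h * s * (h \<bullet> g) + s\<^sup>2 * ((norm g)\<^sup>2 * (3 * norm h + norm g))"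
    if s: "0 < s" "s \<le> 1" for s
  proof -
    define a b where "a = norm (h - s *\<^sub>R g)" and "b = norm h"
    have ab: "0 \<le> a" "0 \<le> b" by (simp_all add: a_def b_def)
    have "\<bar>a - b\<bar> \<le> s * norm g"
      using norm_triangle_ineq3[of "h - s *\<^sub>R g" h] s by (simp add: a_def b_def)
    then have sq: "(a - b)\<^sup>2 \<le> (s * norm g)\<^sup>2"
      by (simp add: abs_le_square_iff[symmetric])
    have "s * norm g \<le> norm g"
      using s by (simp add: mult_left_le_one_le)
    then have "a \<le> b + norm g" using \<open>\<bar>a - b\<bar> \<le> s * norm g\<close> by linarith
    then have "(a - b)\<^sup>2 * (a + b / 2) \<le> (s * norm g)\<^sup>2 * (3 / 2 * b + norm g)"
      using sq ab by (intro mult_mono) auto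
    \<comment> \<open>The cube is expanded in \<open>a\<^sup>2 - b\<^sup>2\<close>, which is
      polynomial in \<open>s\<close>, with an error quadratic in \<open>a - b\<close>.\<close>
    moreover have "a ^ 3 = b ^ 3 + 3 / 2 * b * (a\<^sup>2 - b\<^sup>2) + (a - b)\<^sup>2 * (a + b / 2)"
      by (simp add: power2_eq_square power3_eq_cube field_simps)
    ultimately have "a ^ 3 \<le> b ^ 3 + 3 / 2 * b * (a\<^sup>2 - b\<^sup>2) + (s * norm g)\<^sup>2 * (3 / 2 * b + norm g)"
      by linarith
    also have "a\<^sup>2 - b\<^sup>2 = - 2 * s * (h \<bullet> g) + s\<^sup>2 * (norm g)\<^sup>2"
      unfolding a_def b_def power2_norm_eq_inner
      by (simp add: inner_diff_left inner_diff_right inner_commute[of g h] power2_eq_square algebra_simps)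
    also have "b ^ 3 + 3 / 2 * b * (- 2 * s * (h \<bullet> g) + s\<^sup>2 * (norm g)\<^sup>2) + (s * norm g)\<^sup>2 * (3 / 2 * b + norm g)
        = b ^ 3 - 3 * b * s * (h \<bullet> g) + s\<^sup>2 * ((norm g)\<^sup>2 * (3 * b + norm g))"
      by (simp add: power_mult_distrib field_simps)
    finally show ?thesis by (simp only: a_def b_def)
  qed
  define K where "K = g \<bullet> (U *v g) / 2 + m / 6 * ((norm g)\<^sup>2 * (3 * norm h + norm g))"
  have "g \<bullet> g \<le> s * K" if s: "0 < s" "s \<le> 1" for s
  proof -
    have "cubic_model v U m h \<le> cubic_model v U m (h - s *\<^sub>R g)" by (rule min)
    also have "cubic_model v U m (h - s *\<^sub>R g) = v \<bullet> h + (U *v h) \<bullet> h / 2 - s * (v \<bullet> g + (U *v h) \<bullet> g)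
        + s\<^sup>2 * (g \<bullet> (U *v g)) / 2 + m / 6 * norm (h - s *\<^sub>R g) ^ 3"
      unfolding cubic_model_def
      by (simp add: matrix_vector_mult_diff_distrib matrix_vector_mult_scaleR inner_diff_left inner_diff_right
          inner_commute[of "U *v _"] sym[of h g] power2_eq_square algebra_simps)
    also have "m / 6 * norm (h - s *\<^sub>R g) ^ 3 \<le> m / 6 * (norm h ^ 3 - 3 * norm h * s * (h \<bullet> g)
        + s\<^sup>2 * ((norm g)\<^sup>2 * (3 * norm h + norm g)))"
      using cube[OF s] m by (intro mult_left_mono) auto
    finally have "s * (v \<bullet> g + (U *v h) \<bullet> g + m / 2 * norm h * (h \<bullet> g)) \<le> s * (s * K)"
      by (simp add: cubic_model_def K_def power2_eq_square algebra_simps)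
    moreover have "v \<bullet> g + (U *v h) \<bullet> g + m / 2 * norm h * (h \<bullet> g) = g \<bullet> g"
      unfolding g_def[THEN arg_cong[where f = "\<lambda>x. x \<bullet> g"]] by (simp add: inner_add_left)
    ultimately show ?thesis using s by simp
  qed
  then have "g \<bullet> g \<le> 0" by (rule nonpos_of_le_small_multiples)
  then have "g = 0" by (metis inner_gt_zero_iff not_le)
  then show ?thesis by (simp add: g_def)
qed

text \<open>Reflecting \<open>h\<close> in the hyperplane orthogonal to \<open>y\<close> gives a competitor \<open>w\<close> of the same norm,
  on which the model differs only by a quadratic form in \<open>y\<close>; directions orthogonal to \<open>h\<close> are
  reached by a limit.\<close>

lemma cubic_minimizer_psd: "- (m / 2 * norm h) * (norm y)\<^sup>2 \<le> y \<bullet> (U *v y)"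
proof -
  note sym = inner_symmetric_matrix[OF U]
  define lam where "lam = m / 2 * norm h"
  define Q where "Q y = y \<bullet> (U *v y) + lam * (y \<bullet> y)" for y
  have v: "v = - (U *v h) - lam *\<^sub>R h"
    using cubic_minimizer_stationary by (simp add: lam_def eq_neg_iff_add_eq_0 algebra_simps)
  have generic: "0 \<le> Q y" if "h \<bullet> y \<noteq> 0" for y
  proof -
    have y: "y \<bullet> y \<noteq> 0" using that by auto
    define t where "t = - 2 * (h \<bullet> y) / (y \<bullet> y)"
    define w where "w = h + t *\<^sub>R y"
    have ty: "t * (y \<bullet> y) = - 2 * (h \<bullet> y)" using y by (simp add: t_def)
    have "w \<bullet> w = h \<bullet> h + t * (2 * (h \<bullet> y) + t * (y \<bullet> y))"
      by (simp add: w_def inner_add_left inner_add_right inner_commute[of y h] algebra_simps)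
    then have "w \<bullet> w = h \<bullet> h" by (simp add: ty)
    then have "norm w = norm h" by (simp add: norm_eq_sqrt_inner)
    then have "v \<bullet> h + (U *v h) \<bullet> h / 2 \<le> v \<bullet> w + (U *v w) \<bullet> w / 2"
      using min[of w] by (simp add: cubic_model_def)
    also have "v \<bullet> w + (U *v w) \<bullet> w / 2 = v \<bullet> h + (U *v h) \<bullet> h / 2 + t * (v \<bullet> y + (U *v h) \<bullet> y) + t\<^sup>2 / 2 * (y \<bullet> (U *v y))"
      by (simp add: w_def matrix_vector_right_distrib matrix_vector_mult_scaleR inner_add_left inner_add_right
          inner_commute[of "U *v _"] sym[of h y] power2_eq_square algebra_simps)
    also have "t * (v \<bullet> y + (U *v h) \<bullet> y) = t / 2 * lam * (- 2 * (h \<bullet> y))"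
      by (simp add: v inner_diff_left algebra_simps)
    also have "\<dots> = t\<^sup>2 / 2 * (lam * (y \<bullet> y))"
      unfolding ty[symmetric] by (simp add: power2_eq_square)
    finally have "0 \<le> t\<^sup>2 / 2 * Q y" by (simp add: Q_def algebra_simps)
    moreover have "t \<noteq> 0" using that y by (simp add: t_def)
    ultimately show ?thesis by (simp add: zero_le_mult_iff)
  qed
  have "0 \<le> Q y"
  proof (cases "h \<bullet> y = 0")
    case orth: True
    show ?thesis
    proof (cases "h = 0")
      case False
      have "- Q y \<le> s * (2 * (y \<bullet> (U *v h)) + Q h)" if s: "0 < s" "s \<le> 1" for s
      proof -
        have "0 \<le> Q (y + s *\<^sub>R h)"
          using False orth s by (intro generic) (simp add: inner_add_right)
        also have "Q (y + s *\<^sub>R h) = Q y + s * (2 * (y \<bullet> (U *v h))) + s * (s * Q h)"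
          using orth by (simp add: Q_def matrix_vector_right_distrib matrix_vector_mult_scaleR inner_add_left
              inner_add_right sym[of h y] inner_commute[of y h] algebra_simps)
        also have "s * (s * Q h) \<le> s * Q h"
          using generic[of h] False s by (intro mult_left_mono mult_left_le_one_le) auto
        finally show ?thesis by (simp add: algebra_simps)
      qed
      then have "- Q y \<le> 0" by (rule nonpos_of_le_small_multiples)
      then show ?thesis by simp
    next
      case True
      \<comment> \<open>For \<open>h = 0\<close> there is nothing to reflect; stationarity gives
        \<open>v = 0\<close>, and small multiples of \<open>y\<close> are compared with the value 0
        of the model.\<close>
      have "- Q y \<le> s * (m / 3 * norm y ^ 3)" if s: "0 < s" "s \<le> 1" for s
      proof -
        have "0 \<le> cubic_model v U m (s *\<^sub>R y)"
          using min[of "s *\<^sub>R y"] True by (simp add: cubic_model_def)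
        also have "\<dots> = s\<^sup>2 / 2 * (Q y + s * (m / 3 * norm y ^ 3))"
          using True s by (simp add: cubic_model_def v lam_def Q_def matrix_vector_mult_scaleR inner_commute[of "U *v _"]
              power2_eq_square power3_eq_cube algebra_simps)
        finally show ?thesis using s by (simp add: zero_le_mult_iff)
      qed
      then have "- Q y \<le> 0" by (rule nonpos_of_le_small_multiples)
      then show ?thesis by simp
    qed
  qed (rule generic)
  then show ?thesis by (simp add: Q_def lam_def dot_square_norm)
qed

text \<open>Stationarity paired with \<open>h\<close> eliminates \<open>v\<close> and leaves
  \<open>- (h \<bullet> (U *v h)) / 2 - m / 3 * norm h ^ 3\<close>; the curvature bound in direction
  \<open>h\<close> gives back at most \<open>m / 4 * norm h ^ 3\<close>.\<close>

lemma cubic_minimizer_decrease: "cubic_model v U m h \<le> - (m / 12) * norm h ^ 3"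
proof -
  have "(v + U *v h + (m / 2 * norm h) *\<^sub>R h) \<bullet> h = 0"
    unfolding cubic_minimizer_stationary by simp
  then have "v \<bullet> h = - (h \<bullet> (U *v h)) - m / 2 * norm h ^ 3"
    by (simp add: inner_add_left inner_commute[of h] dot_square_norm power2_eq_square power3_eq_cube)
  then show ?thesis
    using cubic_minimizer_psd[of h]
    by (simp add: cubic_model_def inner_commute[of h] power2_eq_square power3_eq_cube algebra_simps)
qed

end

section \<open>Subsampled increments\<close>

lemma set_pmf_sample:
  assumes "n \<ge> 1" "J \<in> set_pmf (sample n B)"
  shows "size J = B" "set_mset J \<subseteq> {1..n}"
  using assms by (auto simp: sample_def set_replicate_pmf set_pmf_of_set)

lemma real_le_round_up: "r \<le> real (round_up r)"
  unfolding round_up_def by linarith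

lemma one_le_round_up: "1 \<le> round_up r"
  by (simp add: round_up_def)

context cosh_potential
begin

text \<open>Each draw is one application of \<open>potential_step\<close> to the increments
  \<open>c *\<^sub>R a i\<close>; by independence the factors multiply.\<close>

lemma nn_integral_replicate_potential:
  fixes n :: nat
  assumes n: "n \<ge> 1" and a: "\<And>i. i \<in> {1..n} \<Longrightarrow> a i \<in> adm" "\<And>i. i \<in> {1..n} \<Longrightarrow> bd b (a i)"
    and b: "0 \<le> b" and centered: "(\<Sum>i=1..n. a i) = 0" and x: "x \<in> adm"
  shows "(\<integral>\<^sup>+ xs. ennreal (potential (x + c *\<^sub>R (\<Sum>i\<leftarrow>xs. a i))) \<partial>replicate_pmf B (pmf_of_set {1..n}))
      \<le> ennreal (cosh (\<bar>c\<bar> * b) ^ B * potential x)"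
  using x
proof (induction B arbitrary: x)
  case (Suc B)
  have xa: "x + c *\<^sub>R a i \<in> adm" if "i \<in> {1..n}" for i
    using adm_subspace Suc.prems a(1)[OF that] by (simp add: subspace_add subspace_scale)
  have ne: "{1..n} \<noteq> {}" using n by simp
  have "(\<integral>\<^sup>+ xs. ennreal (potential (x + c *\<^sub>R (\<Sum>i\<leftarrow>xs. a i))) \<partial>replicate_pmf (Suc B) (pmf_of_set {1..n}))
     = (\<integral>\<^sup>+ i. \<integral>\<^sup>+ xs. ennreal (potential ((x + c *\<^sub>R a i) + c *\<^sub>R (\<Sum>i\<leftarrow>xs. a i)))
          \<partial>replicate_pmf B (pmf_of_set {1..n}) \<partial>pmf_of_set {1..n})"
    by (simp add: scaleR_right_distrib add.assoc)
  also have "\<dots> \<le> (\<integral>\<^sup>+ i. ennreal (cosh (\<bar>c\<bar> * b) ^ B * potential (x + c *\<^sub>R a i)) \<partial>pmf_of_set {1..n})"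
    using ne by (intro nn_integral_mono_AE) (simp only: AE_measure_pmf_iff set_pmf_of_set finite_atLeastAtMost, intro ballI Suc.IH xa, use ne in \<open>simp add: set_pmf_of_set\<close>)
  also have "\<dots> = ennreal ((\<Sum>i=1..n. cosh (\<bar>c\<bar> * b) ^ B * potential (x + c *\<^sub>R a i)) / real n)"
  proof -
    have "(\<Sum>i=1..n. ennreal (cosh (\<bar>c\<bar> * b) ^ B * potential (x + c *\<^sub>R a i)))
        = ennreal (\<Sum>i=1..n. cosh (\<bar>c\<bar> * b) ^ B * potential (x + c *\<^sub>R a i))"
      by (intro sum_ennreal mult_nonneg_nonneg potential_nonneg xa) auto
    moreover have "0 \<le> (\<Sum>i=1..n. cosh (\<bar>c\<bar> * b) ^ B * potential (x + c *\<^sub>R a i))"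
      by (intro sum_nonneg mult_nonneg_nonneg potential_nonneg xa) auto
    ultimately show ?thesis
      using n ne by (simp add: nn_integral_pmf_of_set divide_ennreal ennreal_of_nat_eq_real_of_nat)
  qed
  also have "\<dots> \<le> ennreal (cosh (\<bar>c\<bar> * b) ^ Suc B * potential x)"
  proof (rule ennreal_leI)
    have "(\<Sum>i=1..n. potential (x + c *\<^sub>R a i)) \<le> real (card {1..n}) * (cosh (\<bar>c\<bar> * b) * potential x)"
      using a b adm_subspace Suc.prems centered
      by (intro potential_step) (auto simp: subspace_scale bd_scale simp flip: scaleR_sum_right)
    then have "cosh (\<bar>c\<bar> * b) ^ B * (\<Sum>i=1..n. potential (x + c *\<^sub>R a i))
        \<le> cosh (\<bar>c\<bar> * b) ^ B * (real n * (cosh (\<bar>c\<bar> * b) * potential x))"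
      by (intro mult_left_mono) auto
    then show "(\<Sum>i=1..n. cosh (\<bar>c\<bar> * b) ^ B * potential (x + c *\<^sub>R a i)) / real n
        \<le> cosh (\<bar>c\<bar> * b) ^ Suc B * potential x"
      using n by (simp add: sum_distrib_left[symmetric] divide_le_eq mult_ac)
  qed
  finally show ?case .
qed simp

text \<open>If the rounded batch size reaches \<open>n\<close>, the estimator uses the exact derivative and no
  error is added; otherwise rounding has not decreased the batch size \<open>\<beta>\<close>.\<close>

lemma nn_integral_sample_potential:
  assumes n: "n \<ge> 1" and a: "\<And>i. i \<in> {1..n} \<Longrightarrow> a i \<in> adm" "\<And>i. i \<in> {1..n} \<Longrightarrow> bd b (a i)"
    and b: "0 \<le> b" and centered: "(\<Sum>i=1..n. a i) = 0" and x: "x \<in> adm"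
    and \<kappa>: "0 \<le> \<kappa>" "\<theta>\<^sup>2 * b\<^sup>2 / 2 \<le> \<kappa> * \<beta>"
  shows "(\<integral>\<^sup>+ J. ennreal (potential (\<theta> *\<^sub>R (x + (if size J < n then (1 / real (size J)) *\<^sub>R (\<Sum>i\<in>#J. a i) else 0))))
        \<partial>sample n (round_up (min (real n) \<beta>)))
      \<le> ennreal (exp \<kappa> * potential (\<theta> *\<^sub>R x))"
proof -
  define B where "B = round_up (min (real n) \<beta>)"
  have B: "B \<ge> 1" "min (real n) \<beta> \<le> real B"
    unfolding B_def by (rule one_le_round_up, rule real_le_round_up)
  have x': "\<theta> *\<^sub>R x \<in> adm" using x adm_subspace by (simp add: subspace_scale)
  show ?thesis
  proof (cases "B < n")
    case False
    then have "(\<integral>\<^sup>+ J. ennreal (potential (\<theta> *\<^sub>R (x + (if size J < n then (1 / real (size J)) *\<^sub>R (\<Sum>i\<in>#J. a i) else 0))))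
        \<partial>sample n B) = (\<integral>\<^sup>+ J. ennreal (potential (\<theta> *\<^sub>R x)) \<partial>sample n B)"
      by (intro nn_integral_cong_AE) (auto simp: AE_measure_pmf_iff set_pmf_sample(1)[OF n])
    also have "\<dots> \<le> ennreal (exp \<kappa> * potential (\<theta> *\<^sub>R x))"
      using \<kappa>(1) mult_right_mono[of 1 "exp \<kappa>" "potential (\<theta> *\<^sub>R x)"] potential_nonneg[OF x']
      by (auto intro!: ennreal_leI)
    finally show ?thesis by (simp add: B_def)
  next
    case True
    define c where "c = \<theta> / real B"
    have "(\<integral>\<^sup>+ J. ennreal (potential (\<theta> *\<^sub>R (x + (if size J < n then (1 / real (size J)) *\<^sub>R (\<Sum>i\<in>#J. a i) else 0))))
        \<partial>sample n B) = (\<integral>\<^sup>+ J. ennreal (potential (\<theta> *\<^sub>R x + c *\<^sub>R (\<Sum>i\<in>#J. a i))) \<partial>sample n B)"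
      using True
      by (intro nn_integral_cong_AE)
        (auto simp: AE_measure_pmf_iff set_pmf_sample(1)[OF n] scaleR_right_distrib c_def)
    also have "\<dots> = (\<integral>\<^sup>+ xs. ennreal (potential (\<theta> *\<^sub>R x + c *\<^sub>R (\<Sum>i\<leftarrow>xs. a i)))
        \<partial>replicate_pmf B (pmf_of_set {1..n}))"
      by (simp add: sample_def sum_mset_sum_list flip: mset_map)
    also have "\<dots> \<le> ennreal (cosh (\<bar>c\<bar> * b) ^ B * potential (\<theta> *\<^sub>R x))"
      by (rule nn_integral_replicate_potential[OF n a b centered x'])
    also have "\<dots> \<le> ennreal (exp \<kappa> * potential (\<theta> *\<^sub>R x))"
    proof (intro ennreal_leI mult_right_mono potential_nonneg x')
      \<comment> \<open>Averaging divides each increment by \<open>B\<close>, so \<open>B\<close>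
        factors with exponents of order \<open>1 / B\<^sup>2\<close> leave \<open>1 / B\<close>: the
        gain from the batch size.\<close>
      have "cosh (\<bar>c\<bar> * b) ^ B \<le> exp ((\<bar>c\<bar> * b)\<^sup>2 / 2) ^ B"
        by (intro power_mono cosh_le_exp_half_square) auto
      also have "\<dots> = exp (real B * ((\<bar>c\<bar> * b)\<^sup>2 / 2))"
        by (rule exp_of_nat_mult[symmetric])
      also have "real B * ((\<bar>c\<bar> * b)\<^sup>2 / 2) = (\<theta>\<^sup>2 * b\<^sup>2 / 2) / real B"
        using B(1) unfolding power_mult_distrib power2_abs
        by (simp add: c_def power_divide) (simp add: power2_eq_square)
      also have "\<dots> \<le> \<kappa>"
      proof -
        have "\<beta> \<le> real B" using B(2) True by linarith
        then have "\<theta>\<^sup>2 * b\<^sup>2 / 2 \<le> \<kappa> * real B"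
          using \<kappa> mult_left_mono[of \<beta> "real B" \<kappa>] by linarith
        then show ?thesis using B(1) by (simp add: divide_le_eq)
      qed
      finally show "cosh (\<bar>c\<bar> * b) ^ B \<le> exp \<kappa>" by simp
    qed
    finally show ?thesis by (simp add: B_def)
  qed
qed

end

section \<open>Potentials along a run\<close>

text \<open>The support of the process as a predicate, so that sure properties (symmetric estimates,
  minimizing steps, descent) follow by rule induction. Only unstopped runs are extended, hence at
  most the last step of a reachable run is short.\<close>

inductive reachable ::
  "nat \<Rightarrow> (nat \<Rightarrow> real^('d::finite) \<Rightarrow> real) \<Rightarrow> (nat \<Rightarrow> real^'d \<Rightarrow> real) \<Rightarrow> (nat \<Rightarrow> real^'d \<Rightarrow> real) \<Rightarrow>
   nat \<Rightarrow> nat \<Rightarrow> real^'d \<Rightarrow> real \<Rightarrow> real \<Rightarrow> 'd rule \<Rightarrow> 'd run \<Rightarrow> bool"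
  for n f Bg Bh Sg Sh x0 \<epsilon> \<rho> sel where
  Nil: "reachable n f Bg Bh Sg Sh x0 \<epsilon> \<rho> sel []"
| snoc: "reachable n f Bg Bh Sg Sh x0 \<epsilon> \<rho> sel r \<Longrightarrow> \<not> stopped \<epsilon> \<rho> r \<Longrightarrow>
    J \<in> set_pmf (sample n (round_up (Bg (length r) (prev_step r)))) \<Longrightarrow>
    I \<in> set_pmf (sample n (round_up (Bh (length r) (prev_step r)))) \<Longrightarrow>
    h \<in> set_pmf (sel r J I) \<Longrightarrow>
    reachable n f Bg Bh Sg Sh x0 \<epsilon> \<rho> sel
      (r @ [Iteration J I (next_iterate x0 r) (next_grad_est n f Sg x0 r J) (next_hess_est n f Sh x0 r I) h])"

context
  fixes n :: nat and f :: "nat \<Rightarrow> real^('d::finite) \<Rightarrow> real" and Bg Bh :: "nat \<Rightarrow> real^'d \<Rightarrow> real"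
    and Sg Sh :: nat and x0 :: "real^'d" and \<epsilon> \<rho> :: real and sel :: "'d rule"
begin

private abbreviation (input) "run \<equiv> srvrc n f Bg Bh Sg Sh x0 \<epsilon> \<rho> sel"
private abbreviation (input) "iter \<equiv> srvrc_iteration n f Bg Bh Sg Sh x0 sel"
private abbreviation (input) "reach \<equiv> reachable n f Bg Bh Sg Sh x0 \<epsilon> \<rho> sel"

lemma set_pmf_srvrc:
  "r \<in> set_pmf (run t) \<Longrightarrow> reach r \<and> length r \<le> t \<and> (\<not> stopped \<epsilon> \<rho> r \<longrightarrow> length r = t)"
proof (induction t arbitrary: r)
  case (Suc t)
  then obtain r' where r': "r' \<in> set_pmf (run t)"
    "r \<in> set_pmf (if stopped \<epsilon> \<rho> r' then return_pmf r' else iter r')"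
    by auto
  show ?case
  proof (cases "stopped \<epsilon> \<rho> r'")
    case False
    then show ?thesis
      using r'(2) Suc.IH[OF r'(1)] by (auto simp: srvrc_iteration_def intro!: reachable.snoc)
  qed (use r'(2) Suc.IH[OF r'(1)] in auto)
qed (simp add: reachable.Nil)

context
  fixes w :: "'d iteration \<Rightarrow> ennreal" and a q :: ennreal and S :: nat
  assumes S: "S \<ge> 1" and q: "1 \<le> q"
    and step: "\<And>r. reach r \<Longrightarrow> \<not> stopped \<epsilon> \<rho> r \<Longrightarrow>
      (\<integral>\<^sup>+ r'. w (last r') \<partial>iter r) \<le> (if length r mod S = 0 then a else q * w (last r))"
begin

text \<open>The integrand looks one iteration ahead and vanishes on stopped runs, which would
  otherwise count their last iteration again. \<open>t mod S\<close> is the time since the last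
  checkpoint, where the bound restarts at \<open>a\<close> whatever the past.\<close>

lemma nn_integral_next_weight:
  "(\<integral>\<^sup>+ r. (if stopped \<epsilon> \<rho> r then 0 else \<integral>\<^sup>+ r'. w (last r') \<partial>iter r) \<partial>run t) \<le> a * q ^ (t mod S)"
proof (induction t)
  case 0
  show ?case using step[OF reachable.Nil] by (simp add: stopped_def)
next
  case (Suc t)
  show ?case
  proof (cases "Suc t mod S = 0")
    case True
    have "(\<integral>\<^sup>+ r. (if stopped \<epsilon> \<rho> r then 0 else \<integral>\<^sup>+ r'. w (last r') \<partial>iter r) \<partial>run (Suc t)) \<le>
        (\<integral>\<^sup>+ r. a \<partial>run (Suc t))"
    proof (intro nn_integral_mono_AE, unfold AE_measure_pmf_iff, intro ballI)
      fix r assume "r \<in> set_pmf (run (Suc t))"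
      from set_pmf_srvrc[OF this] step[of r] True
      show "(if stopped \<epsilon> \<rho> r then 0 else \<integral>\<^sup>+ r'. w (last r') \<partial>iter r) \<le> a" by auto
    qed
    then show ?thesis using True by simp
  next
    case False
    have "(\<integral>\<^sup>+ r. (if stopped \<epsilon> \<rho> r then 0 else \<integral>\<^sup>+ r'. w (last r') \<partial>iter r) \<partial>run (Suc t)) \<le>
        (\<integral>\<^sup>+ r. q * (if stopped \<epsilon> \<rho> r then 0 else w (last r)) \<partial>run (Suc t))"
    proof (intro nn_integral_mono_AE, unfold AE_measure_pmf_iff, intro ballI)
      fix r assume "r \<in> set_pmf (run (Suc t))"
      from set_pmf_srvrc[OF this] step[of r] False
      show "(if stopped \<epsilon> \<rho> r then 0 else \<integral>\<^sup>+ r'. w (last r') \<partial>iter r)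
          \<le> q * (if stopped \<epsilon> \<rho> r then 0 else w (last r))" by auto
    qed
    also have "\<dots> = q * (\<integral>\<^sup>+ r. (if stopped \<epsilon> \<rho> r then 0 else w (last r)) \<partial>run (Suc t))"
      by (intro nn_integral_cmult) simp
    \<comment> \<open>Runs that stop in the iteration just made drop out on the left, hence only an
      inequality.\<close>
    also have "\<dots> \<le> q * (\<integral>\<^sup>+ r. (if stopped \<epsilon> \<rho> r then 0 else \<integral>\<^sup>+ r'. w (last r') \<partial>iter r) \<partial>run t)"
    proof (intro mult_left_mono)
      show "(\<integral>\<^sup>+ r. (if stopped \<epsilon> \<rho> r then 0 else w (last r)) \<partial>run (Suc t))
          \<le> (\<integral>\<^sup>+ r. (if stopped \<epsilon> \<rho> r then 0 else \<integral>\<^sup>+ r'. w (last r') \<partial>iter r) \<partial>run t)"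
        unfolding srvrc.simps nn_integral_bind_pmf
        by (intro nn_integral_mono) (auto intro!: nn_integral_mono)
    qed simp
    also have "\<dots> \<le> q * (a * q ^ (t mod S))"
      by (intro mult_left_mono Suc.IH) simp
    also have "\<dots> = a * q ^ (Suc t mod S)"
      using False by (simp add: mod_Suc mult_ac split: if_splits)
    finally show ?thesis .
  qed
qed

lemma nn_integral_sum_weights:
  "(\<integral>\<^sup>+ r. (\<Sum>x\<leftarrow>r. w x) \<partial>run t) \<le> of_nat t * (a * q ^ (S - 1))"
proof (induction t)
  case (Suc t)
  have last: "(\<integral>\<^sup>+ r'. (\<Sum>x\<leftarrow>r'. w x) \<partial>iter r) = (\<Sum>x\<leftarrow>r. w x) + (\<integral>\<^sup>+ r'. w (last r') \<partial>iter r)" for r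
    by (simp add: srvrc_iteration_def nn_integral_add)
  have "(\<integral>\<^sup>+ r. (\<Sum>x\<leftarrow>r. w x) \<partial>run (Suc t))
      = (\<integral>\<^sup>+ r. (\<Sum>x\<leftarrow>r. w x) + (if stopped \<epsilon> \<rho> r then 0 else \<integral>\<^sup>+ r'. w (last r') \<partial>iter r) \<partial>run t)"
    unfolding srvrc.simps nn_integral_bind_pmf by (intro nn_integral_cong) (auto simp: last)
  also have "\<dots> = (\<integral>\<^sup>+ r. (\<Sum>x\<leftarrow>r. w x) \<partial>run t)
      + (\<integral>\<^sup>+ r. (if stopped \<epsilon> \<rho> r then 0 else \<integral>\<^sup>+ r'. w (last r') \<partial>iter r) \<partial>run t)"
    by (intro nn_integral_add) auto
  also have "\<dots> \<le> of_nat t * (a * q ^ (S - 1)) + a * q ^ (S - 1)"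
  proof (intro add_mono Suc.IH order_trans[OF nn_integral_next_weight] mult_left_mono power_increasing q)
    show "t mod S \<le> S - 1" using S mod_less_divisor[of S t] by linarith
  qed simp
  finally show ?case by (simp add: distrib_right add.commute)
qed simp

text \<open>Markov's inequality for the sum of all weights of a run, so that one estimate covers
  every iteration although their number is random.\<close>

lemma emeasure_large_weight:
  "c * emeasure (run t) {r. \<exists>x\<in>set r. c \<le> w x} \<le> of_nat t * (a * q ^ (S - 1))"
proof -
  have "c * emeasure (run t) {r. \<exists>x\<in>set r. c \<le> w x}
      = (\<integral>\<^sup>+ r. c * indicator {r. \<exists>x\<in>set r. c \<le> w x} r \<partial>run t)"
    by (subst nn_integral_cmult_indicator) auto
  also have "\<dots> \<le> (\<integral>\<^sup>+ r. (\<Sum>x\<leftarrow>r. w x) \<partial>run t)"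
  proof (intro nn_integral_mono)
    fix r :: "'d run"
    have "w x \<le> (\<Sum>x\<leftarrow>r. w x)" if "x \<in> set r" for x
      using that by (induction r) (auto intro: add_increasing add_increasing2)
    then show "c * indicator {r. \<exists>x\<in>set r. c \<le> w x} r \<le> (\<Sum>x\<leftarrow>r. w x)"
      by (auto simp: indicator_def intro: order_trans)
  qed
  also note nn_integral_sum_weights
  finally show ?thesis .
qed

end

end

text \<open>Common form of \<open>batch_grad\<close> and \<open>batch_hess\<close>. For a fixed
  batch it is linear in \<open>D\<close>, so a correction between two iterates is a batch mean of
  differences.\<close>

definition batch_mean :: "nat \<Rightarrow> (nat \<Rightarrow> 'v::real_vector) \<Rightarrow> nat multiset \<Rightarrow> 'v" where
  "batch_mean n D J = (if size J < n then (1 / real (size J)) *\<^sub>R (\<Sum>i\<in>#J. D i)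
     else (1 / real n) *\<^sub>R (\<Sum>i=1..n. D i))"

lemma sum_mset_diff_const:
  "(\<Sum>i\<in>#J. D i - c) = (\<Sum>i\<in>#J. D i) - real (size J) *\<^sub>R (c :: 'v::real_vector)"
  by (induction J) (simp_all add: algebra_simps)

lemma sum_mset_diff: "(\<Sum>i\<in>#J. D i - E i) = (\<Sum>i\<in>#J. D i) - (\<Sum>i\<in>#J. E i :: 'v::real_vector)"
  by (induction J) (simp_all add: algebra_simps)

context cosh_potential
begin

lemma zero_adm: "0 \<in> adm"
  using adm_subspace by (rule subspace_0)

lemma nn_integral_batch_mean_potential:
  fixes D :: "nat \<Rightarrow> 'v" and n :: nat
  defines "c \<equiv> (1 / real n) *\<^sub>R (\<Sum>i=1..n. D i)"
  assumes n: "n \<ge> 1" and D: "\<And>i. i \<in> {1..n} \<Longrightarrow> D i \<in> adm" "\<And>i. i \<in> {1..n} \<Longrightarrow> bd b (D i - c)"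
    and b: "0 \<le> b" and x: "x \<in> adm" and \<kappa>: "0 \<le> \<kappa>" "\<theta>\<^sup>2 * b\<^sup>2 / 2 \<le> \<kappa> * \<beta>"
  shows "(\<integral>\<^sup>+ J. ennreal (potential (\<theta> *\<^sub>R (x + (batch_mean n D J - c)))) \<partial>sample n (round_up (min (real n) \<beta>)))
      \<le> ennreal (exp \<kappa> * potential (\<theta> *\<^sub>R x))"
proof -
  have c: "c \<in> adm"
    unfolding c_def using adm_subspace D(1) by (intro subspace_scale subspace_sum) auto
  have eq: "batch_mean n D J - c = (if size J < n then (1 / real (size J)) *\<^sub>R (\<Sum>i\<in>#J. D i - c) else 0)"
    if J: "J \<in> set_pmf (sample n (round_up (min (real n) \<beta>)))" for J
    using set_pmf_sample(1)[OF n J] one_le_round_up[of "min (real n) \<beta>"]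
    by (simp add: batch_mean_def sum_mset_diff_const scaleR_diff_right) (simp add: c_def)
  have "(\<integral>\<^sup>+ J. ennreal (potential (\<theta> *\<^sub>R (x + (batch_mean n D J - c)))) \<partial>sample n (round_up (min (real n) \<beta>)))
      = (\<integral>\<^sup>+ J. ennreal (potential (\<theta> *\<^sub>R (x + (if size J < n then (1 / real (size J)) *\<^sub>R (\<Sum>i\<in>#J. D i - c) else 0))))
          \<partial>sample n (round_up (min (real n) \<beta>)))"
    by (intro nn_integral_cong_AE) (simp add: AE_measure_pmf_iff eq)
  also have "\<dots> \<le> ennreal (exp \<kappa> * potential (\<theta> *\<^sub>R x))"
  proof (rule nn_integral_sample_potential[OF n _ D(2) b _ x \<kappa>])
    show "D i - c \<in> adm" if "i \<in> {1..n}" for i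
      using adm_subspace D(1)[OF that] c by (rule subspace_diff)
    show "(\<Sum>i=1..n. D i - c) = 0"
      using n by (simp add: sum_subtractf c_def sum_constant_scaleR)
  qed
  finally show ?thesis .
qed

end

text \<open>Between the accumulated exponent \<open>8 * \<psi>\<^sup>2\<close> and the threshold
  exponent \<open>16 * \<psi>\<^sup>2\<close> there must be room for the factor
  \<open>4 * T * D / \<xi> = 2 * exp \<psi>\<close>. Since \<open>exp \<psi> \<ge> 2\<close>, it is
  enough that \<open>2 * \<psi> \<le> 8 * \<psi>\<^sup>2\<close>, which follows from
  \<open>\<psi> \<ge> 1 / 2\<close>.\<close>

lemma union_bound_constant:
  fixes T D \<xi> :: real
  assumes T: "1 \<le> T" and D: "1 \<le> D" and \<xi>: "0 < \<xi>" "\<xi> < 1"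
  defines "\<psi> \<equiv> ln (2 * T * D / \<xi>)"
  shows "2 * (T * D * exp (8 * \<psi>\<^sup>2)) \<le> \<xi> * cosh (16 * \<psi>\<^sup>2)"
proof -
  have TD: "1 \<le> T * D" using mult_mono[OF T D] T by simp
  have X: "2 \<le> 2 * T * D / \<xi>"
    using TD \<xi> by (simp add: le_divide_eq)
  have exp_\<psi>: "exp \<psi> = 2 * T * D / \<xi>"
    using X by (simp add: \<psi>_def)
  have "1 / 2 \<le> \<psi>"
  proof -
    have "ln 2 \<le> \<psi>" using X unfolding \<psi>_def by auto
    then show ?thesis using ln2_ge_two_thirds by linarith
  qed
  then have "2 * \<psi> \<le> 8 * \<psi>\<^sup>2"
    by (simp add: power2_eq_square)
  then have "exp \<psi> * exp \<psi> \<le> exp (8 * \<psi>\<^sup>2)"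
    by (simp flip: exp_add)
  then have "(2 * T * D / \<xi>) * 2 \<le> exp (8 * \<psi>\<^sup>2)"
    using mult_left_mono[OF X, of "2 * T * D / \<xi>"] X unfolding exp_\<psi> by linarith
  then have "2 * (T * D) \<le> \<xi> * (exp (8 * \<psi>\<^sup>2) / 2)"
    using \<xi> by (simp add: field_simps)
  then have "2 * (T * D) * exp (8 * \<psi>\<^sup>2) \<le> \<xi> * (exp (8 * \<psi>\<^sup>2) / 2) * exp (8 * \<psi>\<^sup>2)"
    by (intro mult_right_mono) auto
  also have "\<dots> = \<xi> * (exp (16 * \<psi>\<^sup>2) / 2)"
    by (simp flip: exp_add)
  also have "\<dots> \<le> \<xi> * cosh (16 * \<psi>\<^sup>2)"
    using \<xi> by (intro mult_left_mono) (simp_all add: cosh_field_def)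
  finally show ?thesis by simp
qed

text \<open>\<open>D\<close> stands for the potential of a zero error: 1 for gradients, the
  dimension for Hessians. Each of the two estimators is allowed half of the failure
  probability.\<close>

lemma (in cosh_potential) prob_large_potential:
  fixes err :: "'d::finite iteration \<Rightarrow> 'v" and T S :: nat and D \<theta> \<xi> :: real
  defines "\<psi> \<equiv> ln (2 * real T * D / \<xi>)"
  assumes T: "1 \<le> T" and D: "1 \<le> D" and \<xi>: "0 < \<xi>" "\<xi> < 1" and S: "1 \<le> S"
    and step: "\<And>r. reachable n f Bg Bh Sg Sh x0 \<epsilon> \<rho> sel r \<Longrightarrow> \<not> stopped \<epsilon> \<rho> r \<Longrightarrow>
      (\<integral>\<^sup>+ r'. ennreal (potential (\<theta> *\<^sub>R err (last r'))) \<partial>srvrc_iteration n f Bg Bh Sg Sh x0 sel r)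
        \<le> (if length r mod S = 0 then ennreal (exp (4 * \<psi>\<^sup>2) * D)
            else ennreal (exp (4 * \<psi>\<^sup>2 / real S)) * ennreal (potential (\<theta> *\<^sub>R err (last r))))"
  shows "measure_pmf.prob (srvrc n f Bg Bh Sg Sh x0 \<epsilon> \<rho> sel T)
      {r. \<exists>x\<in>set r. cosh (16 * \<psi>\<^sup>2) \<le> potential (\<theta> *\<^sub>R err x)} \<le> \<xi> / 2"
proof -
  let ?R = "srvrc n f Bg Bh Sg Sh x0 \<epsilon> \<rho> sel T"
  define A where "A = {r. \<exists>x\<in>set r. cosh (16 * \<psi>\<^sup>2) \<le> potential (\<theta> *\<^sub>R err x)}"
  define A' where "A' = {r. \<exists>x\<in>set r. ennreal (cosh (16 * \<psi>\<^sup>2)) \<le> ennreal (potential (\<theta> *\<^sub>R err x))}"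
  have "A \<subseteq> A'" by (auto simp: A_def A'_def intro: ennreal_leI)
  have "ennreal (cosh (16 * \<psi>\<^sup>2)) * emeasure ?R A \<le> ennreal (cosh (16 * \<psi>\<^sup>2)) * emeasure ?R A'"
    using \<open>A \<subseteq> A'\<close> by (intro mult_left_mono emeasure_mono) auto
  also have "\<dots> \<le> of_nat T * (ennreal (exp (4 * \<psi>\<^sup>2) * D) * ennreal (exp (4 * \<psi>\<^sup>2 / real S)) ^ (S - 1))"
    unfolding A'_def by (rule emeasure_large_weight[OF S _ step]) (auto simp flip: ennreal_1 intro!: ennreal_leI)
  also have "\<dots> = ennreal (real T * (exp (4 * \<psi>\<^sup>2) * D * exp (4 * \<psi>\<^sup>2 / real S) ^ (S - 1)))"
    using D by (simp add: ennreal_power ennreal_mult'' flip: ennreal_of_nat_eq_real_of_nat)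
  also have "\<dots> \<le> ennreal (real T * D * exp (8 * \<psi>\<^sup>2))"
  proof (rule ennreal_leI)
    have "exp (4 * \<psi>\<^sup>2 / real S) ^ (S - 1) \<le> exp (4 * \<psi>\<^sup>2 / real S) ^ S"
      by (intro power_increasing) auto
    also have "\<dots> = exp (4 * \<psi>\<^sup>2)"
      using S by (simp flip: exp_of_nat_mult)
    finally have "exp (4 * \<psi>\<^sup>2) * exp (4 * \<psi>\<^sup>2 / real S) ^ (S - 1) \<le> exp (4 * \<psi>\<^sup>2) * exp (4 * \<psi>\<^sup>2)"
      by (intro mult_left_mono) auto
    also have "\<dots> = exp (8 * \<psi>\<^sup>2)" by (simp flip: exp_add)
    finally have "(real T * D) * (exp (4 * \<psi>\<^sup>2) * exp (4 * \<psi>\<^sup>2 / real S) ^ (S - 1)) \<le> (real T * D) * exp (8 * \<psi>\<^sup>2)"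
      using D by (intro mult_left_mono) auto
    then show "real T * (exp (4 * \<psi>\<^sup>2) * D * exp (4 * \<psi>\<^sup>2 / real S) ^ (S - 1)) \<le> real T * D * exp (8 * \<psi>\<^sup>2)"
      by (simp add: mult_ac)
  qed
  finally have "ennreal (cosh (16 * \<psi>\<^sup>2) * measure_pmf.prob ?R A) \<le> ennreal (real T * D * exp (8 * \<psi>\<^sup>2))"
    by (simp add: measure_pmf.emeasure_eq_measure ennreal_mult'')
  then have "cosh (16 * \<psi>\<^sup>2) * measure_pmf.prob ?R A \<le> real T * D * exp (8 * \<psi>\<^sup>2)"
    using D by (subst (asm) ennreal_le_iff) auto
  also have "\<dots> \<le> cosh (16 * \<psi>\<^sup>2) * (\<xi> / 2)"
    using union_bound_constant[of "real T" D \<xi>] T D \<xi> by (simp add: \<psi>_def mult.commute)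
  finally show ?thesis
    by (simp add: A_def mult_le_cancel_left_pos)
qed

section \<open>The error of the estimators\<close>

locale srvrc_setting =
  fixes f :: "nat \<Rightarrow> real^'d \<Rightarrow> real" and F :: "real^'d \<Rightarrow> real" and x0 :: "real^'d"
    and n T Sg Sh :: nat and \<Delta> L \<rho> M \<epsilon> \<xi> :: real
    and Bg Bh :: "nat \<Rightarrow> real^'d \<Rightarrow> real" and sel :: "'d rule"
  assumes n: "n \<ge> 1"
    and F: "F = finite_sum n f"
    and twice_diff: "\<And>i. i \<in> {1..n} \<Longrightarrow> twice_differentiable (f i)"
    and pos: "\<Delta> > 0" "L > 0" "\<rho> > 0" "M > 0"
    and gap: "bdd_below (range F)" "F x0 - (INF x. F x) \<le> \<Delta>"
    and grad_lipschitz: "\<And>i x y. i \<in> {1..n} \<Longrightarrow>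
          norm (grad (f i) x - grad (f i) y) \<le> L * norm (x - y)"
    and hess_lipschitz: "\<And>i x y. i \<in> {1..n} \<Longrightarrow>
          spectral_norm (hess (f i) x - hess (f i) y) \<le> \<rho> * norm (x - y)"
    and grad_bound: "\<And>i x. i \<in> {1..n} \<Longrightarrow> norm (grad (f i) x - grad F x) \<le> M"
    and eps: "\<epsilon> > 0" and xi: "0 < \<xi>" "\<xi> < 1"
    and Sg: "Sg = round_up (sqrt (\<rho> * \<epsilon>) / L * sqrt (min (real n) (M^2 / \<epsilon>^2)))"
    and Sh: "Sh = round_up (sqrt (min (real n) (L^2 / (\<rho> * \<epsilon>))))"
    and T: "T = round_up (40 * \<Delta> * \<rho> powr (1/2) * \<epsilon> powr (-3/2))"
    and Bg: "Bg = (\<lambda>t h. min (real n)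
          (if t mod Sg \<noteq> 0
           then 1440 * L^2 * real Sg * norm h ^ 2 * ln (2 * real T / \<xi>) ^ 2 / \<epsilon>^2
           else 1440 * M^2 * ln (2 * real T / \<xi>) ^ 2 / \<epsilon>^2))"
    and Bh: "Bh = (\<lambda>t h. min (real n)
          (if t mod Sh \<noteq> 0
           then 800 * \<rho> * real Sh * norm h ^ 2 * ln (2 * real T * real CARD('d) / \<xi>) ^ 2 / \<epsilon>
           else 800 * L^2 * ln (2 * real T * real CARD('d) / \<xi>) ^ 2 / (\<rho> * \<epsilon>)))"
    and sel: "minimizing_rule n f (\<lambda>t. 4 * \<rho>) Sg Sh x0 sel"
begin

abbreviation (input) "reach \<equiv> reachable n f Bg Bh Sg Sh x0 \<epsilon> \<rho> sel"
abbreviation (input) "iter \<equiv> srvrc_iteration n f Bg Bh Sg Sh x0 sel"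
abbreviation (input) "run \<equiv> srvrc n f Bg Bh Sg Sh x0 \<epsilon> \<rho> sel T"

definition "\<psi> = ln (2 * real T / \<xi>)"
definition "\<phi> = ln (2 * real T * real CARD('d) / \<xi>)"

lemma T_ge: "1 \<le> T" and Sg_ge: "1 \<le> Sg" and Sh_ge: "1 \<le> Sh"
  by (simp_all add: T Sg Sh one_le_round_up del: One_nat_def)

lemma F_has_derivative: "(F has_derivative (\<lambda>h. h \<bullet> ((1 / real n) *\<^sub>R (\<Sum>i=1..n. grad (f i) x)))) (at x)"
proof -
  have "((\<lambda>x. (1 / real n) * (\<Sum>i=1..n. f i x)) has_derivative (\<lambda>h. (1 / real n) * (\<Sum>i=1..n. h \<bullet> grad (f i) x))) (at x)"
    by (intro has_derivative_mult_right has_derivative_sum twice_differentiableD(1) twice_diff)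
  then show ?thesis
    by (simp add: F finite_sum_def[abs_def] inner_sum_right divide_inverse mult.commute)
qed

lemma grad_F: "grad F x = (1 / real n) *\<^sub>R (\<Sum>i=1..n. grad (f i) x)"
  by (rule grad_eqI) (rule F_has_derivative)

lemma grad_F_has_derivative:
  "(grad F has_derivative (\<lambda>h. ((1 / real n) *\<^sub>R (\<Sum>i=1..n. hess (f i) x)) *v h)) (at x)"
proof -
  have "((\<lambda>x. (1 / real n) *\<^sub>R (\<Sum>i=1..n. grad (f i) x)) has_derivative
      (\<lambda>h. (1 / real n) *\<^sub>R (\<Sum>i=1..n. hess (f i) x *v h))) (at x)"
    by (intro has_derivative_scaleR_right has_derivative_sum twice_differentiableD(2) twice_diff)
  moreover have "(\<Sum>i=1..n. hess (f i) x *v h) = (\<Sum>i=1..n. hess (f i) x) *v h" for h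
    by (induction n) (simp_all add: matrix_vector_mult_add_rdistrib)
  moreover have "grad F = (\<lambda>x. (1 / real n) *\<^sub>R (\<Sum>i=1..n. grad (f i) x))"
    by (simp add: grad_F fun_eq_iff)
  ultimately show ?thesis by (simp add: scaleR_matrix_vector_assoc)
qed

lemma hess_F: "hess F x = (1 / real n) *\<^sub>R (\<Sum>i=1..n. hess (f i) x)"
  by (rule hess_eqI) (rule grad_F_has_derivative)

lemma norm_mean_le:
  assumes "\<And>i. i \<in> {1..n} \<Longrightarrow> norm (a i :: 'b::real_normed_vector) \<le> K"
  shows "norm ((1 / real n) *\<^sub>R (\<Sum>i=1..n. a i)) \<le> K"
  using sum_norm_bound[of "{1..n}" a K] assms n by (simp add: divide_le_eq mult.commute)

lemma hess_F_vector: "hess F x *v v = (1 / real n) *\<^sub>R (\<Sum>i=1..n. hess (f i) x *v v)"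
proof -
  have "(\<Sum>i=1..n. hess (f i) x *v v) = (\<Sum>i=1..n. hess (f i) x) *v v"
    by (induction n) (simp_all add: matrix_vector_mult_add_rdistrib)
  then show ?thesis by (simp add: hess_F scaleR_matrix_vector_assoc)
qed

lemma hess_f_lipschitz:
  assumes "i \<in> {1..n}"
  shows "norm ((hess (f i) x - hess (f i) y) *v v) \<le> \<rho> * norm (x - y) * norm v"
  using norm_matrix_vector_le_spectral_norm[of "hess (f i) x - hess (f i) y" v]
    mult_right_mono[OF hess_lipschitz[OF assms, of x y] norm_ge_zero[of v]] by linarith

lemma hessian_lipschitz_f: "i \<in> {1..n} \<Longrightarrow> hessian_lipschitz (f i) \<rho>"
  by unfold_locales (use pos twice_diff hess_f_lipschitz in auto)

lemma hess_F_lipschitz: "norm ((hess F x - hess F y) *v v) \<le> \<rho> * norm (x - y) * norm v"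
proof -
  have "(hess F x - hess F y) *v v = (1 / real n) *\<^sub>R (\<Sum>i=1..n. (hess (f i) x - hess (f i) y) *v v)"
    by (simp add: matrix_vector_mult_diff_rdistrib hess_F_vector sum_subtractf scaleR_diff_right)
  then show ?thesis using norm_mean_le[OF hess_f_lipschitz] by simp
qed

lemma hessian_lipschitz_F: "hessian_lipschitz F \<rho>"
proof
  show "twice_differentiable F"
    unfolding twice_differentiable_def differentiable_def using F_has_derivative grad_F_has_derivative by blast
qed (use pos hess_F_lipschitz in auto)

sublocale F: hessian_lipschitz F \<rho>
  by (rule hessian_lipschitz_F)

lemma grad_F_lipschitz: "norm (grad F x - grad F y) \<le> L * norm (x - y)"
proof -
  have "grad F x - grad F y = (1 / real n) *\<^sub>R (\<Sum>i=1..n. grad (f i) x - grad (f i) y)"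
    by (simp add: grad_F sum_subtractf scaleR_diff_right)
  then show ?thesis using norm_mean_le[OF grad_lipschitz] by simp
qed

lemma norm_hess_f_le: "i \<in> {1..n} \<Longrightarrow> norm (hess (f i) x *v v) \<le> L * norm v"
  by (rule linear_le_of_lipschitz[OF twice_differentiableD(2)[OF twice_diff] grad_lipschitz])

lemma norm_hess_F_le: "norm (hess F x *v v) \<le> L * norm v"
  by (rule linear_le_of_lipschitz[OF twice_differentiableD(2)[OF F.twice_diff] grad_F_lipschitz])

text \<open>The full-batch branch differentiates the averaged function; \<open>grad_F\<close>
  identifies the result with the average of the gradients.\<close>

lemma batch_grad_eq: "batch_grad n f J x = batch_mean n (\<lambda>i. grad (f i) x) J"
  by (simp add: batch_grad_def batch_mean_def grad_F flip: F)

lemma batch_hess_eq: "batch_hess n f J x = batch_mean n (\<lambda>i. hess (f i) x) J"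
  by (simp add: batch_hess_def batch_mean_def hess_F flip: F)

lemma batch_mean_diff: "batch_mean n D J - batch_mean n E J = batch_mean n (\<lambda>i. D i - E i) J"
  for D E :: "nat \<Rightarrow> 'v::real_vector"
  by (simp add: batch_mean_def sum_mset_diff sum_subtractf scaleR_diff_right)

definition grad_err :: "'d iteration \<Rightarrow> real^'d" where
  "grad_err x = grad_est x - grad F (iterate x)"

definition hess_err :: "'d iteration \<Rightarrow> real^'d^'d" where
  "hess_err x = hess_est x - hess F (iterate x)"

text \<open>The factor 53 is admissible since \<open>2 \<cdot> 53\<^sup>2 \<le> 4 \<cdot> 1440\<close>, which makes the exponent of a
  non-checkpoint step at most \<open>4 \<psi>\<^sup>2 / Sg\<close>, hence \<open>8 \<psi>\<^sup>2\<close> over a whole period; the factor 40 for the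
  Hessian comes from 800 in the same way.\<close>

lemma grad_err_step:
  assumes "reach r"
  shows "(\<integral>\<^sup>+ r'. ennreal (vec.potential ((53 * \<psi>\<^sup>2 / \<epsilon>) *\<^sub>R grad_err (last r'))) \<partial>iter r)
      \<le> (if length r mod Sg = 0 then ennreal (exp (4 * \<psi>\<^sup>2) * 1)
         else ennreal (exp (4 * \<psi>\<^sup>2 / real Sg)) * ennreal (vec.potential ((53 * \<psi>\<^sup>2 / \<epsilon>) *\<^sub>R grad_err (last r))))"
proof -
  define \<theta> where "\<theta> = 53 * \<psi>\<^sup>2 / \<epsilon>"
  define y where "y = next_iterate x0 r"
  have "(\<integral>\<^sup>+ r'. ennreal (vec.potential (\<theta> *\<^sub>R grad_err (last r'))) \<partial>iter r)
      = (\<integral>\<^sup>+ J. ennreal (vec.potential (\<theta> *\<^sub>R (next_grad_est n f Sg x0 r J - grad F y)))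
          \<partial>sample n (round_up (Bg (length r) (prev_step r))))"
    by (simp add: srvrc_iteration_def grad_err_def y_def)
  also have "\<dots> \<le> (if length r mod Sg = 0 then ennreal (exp (4 * \<psi>\<^sup>2) * 1)
         else ennreal (exp (4 * \<psi>\<^sup>2 / real Sg)) * ennreal (vec.potential (\<theta> *\<^sub>R grad_err (last r))))"
  proof (cases "length r mod Sg = 0")
    case True
    have "(\<integral>\<^sup>+ J. ennreal (vec.potential (\<theta> *\<^sub>R (0 + (batch_mean n (\<lambda>i. grad (f i) y) J
          - (1 / real n) *\<^sub>R (\<Sum>i=1..n. grad (f i) y)))))
        \<partial>sample n (round_up (min (real n) (1440 * M^2 * \<psi> ^ 2 / \<epsilon>^2))))
      \<le> ennreal (exp (4 * \<psi>\<^sup>2) * vec.potential (\<theta> *\<^sub>R (0 :: real^'d)))"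
    proof (rule vec.nn_integral_batch_mean_potential[OF n, where b = M])
      show "norm (grad (f i) y - (1 / real n) *\<^sub>R (\<Sum>i=1..n. grad (f i) y)) \<le> M" if "i \<in> {1..n}" for i
        using grad_bound[OF that, of y] by (simp add: grad_F)
      have "0 \<le> \<psi>\<^sup>2 * \<psi>\<^sup>2 * M\<^sup>2 / \<epsilon>\<^sup>2" by simp
      moreover have "\<theta>\<^sup>2 * M\<^sup>2 / 2 = 2809 / 2 * (\<psi>\<^sup>2 * \<psi>\<^sup>2 * M\<^sup>2 / \<epsilon>\<^sup>2)"
        by (simp add: \<theta>_def power_divide power_mult_distrib)
      moreover have "4 * \<psi>\<^sup>2 * (1440 * M^2 * \<psi> ^ 2 / \<epsilon>^2) = 5760 * (\<psi>\<^sup>2 * \<psi>\<^sup>2 * M\<^sup>2 / \<epsilon>\<^sup>2)"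
        by simp
      ultimately show "\<theta>\<^sup>2 * M\<^sup>2 / 2 \<le> 4 * \<psi>\<^sup>2 * (1440 * M^2 * \<psi> ^ 2 / \<epsilon>^2)" by linarith
    qed (use pos in auto)
    then show ?thesis
      using True by (simp add: Bg next_grad_est_def batch_grad_eq grad_F y_def[symmetric] vec_potential_eq
          flip: \<psi>_def)
  next
    case False
    then have r: "r \<noteq> []" by auto
    define x h where "x = iterate (last r)" and "h = step (last r)"
    have y: "y = x + h" using r by (simp add: y_def x_def h_def next_iterate_def)
    have prev: "prev_step r = h" using r by (simp add: prev_step_def h_def)
    define D where "D i = grad (f i) y - grad (f i) x" for i
    have mean: "(1 / real n) *\<^sub>R (\<Sum>i=1..n. D i) = grad F y - grad F x"
      by (simp add: D_def grad_F sum_subtractf scaleR_diff_right)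
    have "(\<integral>\<^sup>+ J. ennreal (vec.potential (\<theta> *\<^sub>R (grad_err (last r) + (batch_mean n D J
          - (1 / real n) *\<^sub>R (\<Sum>i=1..n. D i)))))
        \<partial>sample n (round_up (min (real n) (1440 * L^2 * real Sg * norm h ^ 2 * \<psi> ^ 2 / \<epsilon>^2))))
      \<le> ennreal (exp (4 * \<psi>\<^sup>2 / real Sg) * vec.potential (\<theta> *\<^sub>R grad_err (last r)))"
    \<comment> \<open>The factor 2 comes from centering: \<open>D i\<close> and its mean each have
      norm at most \<open>L * norm h\<close>.\<close>
    proof (rule vec.nn_integral_batch_mean_potential[OF n, where b = "2 * L * norm h"])
      show "norm (D i - (1 / real n) *\<^sub>R (\<Sum>i=1..n. D i)) \<le> 2 * L * norm h" if "i \<in> {1..n}" for i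
        using norm_triangle_ineq4[of "D i" "grad F y - grad F x"] grad_lipschitz[OF that, of y x]
          grad_F_lipschitz[of y x] unfolding mean by (simp add: D_def y)
      define K where "K = \<psi>\<^sup>2 * \<psi>\<^sup>2 * L\<^sup>2 * (norm h)\<^sup>2 / \<epsilon>\<^sup>2"
      have "0 \<le> K" by (simp add: K_def)
      moreover have "4 * \<psi>\<^sup>2 / real Sg * (1440 * L^2 * real Sg * norm h ^ 2 * \<psi> ^ 2 / \<epsilon>^2) = 5760 * K"
        using Sg_ge by (simp add: K_def)
      moreover have "\<theta>\<^sup>2 * (2 * L * norm h)\<^sup>2 / 2 = 5618 * K"
        by (simp add: \<theta>_def K_def power_divide power_mult_distrib)
      ultimately show "\<theta>\<^sup>2 * (2 * L * norm h)\<^sup>2 / 2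
          \<le> 4 * \<psi>\<^sup>2 / real Sg * (1440 * L^2 * real Sg * norm h ^ 2 * \<psi> ^ 2 / \<epsilon>^2)" by simp
    qed (use pos in auto)
    moreover have "next_grad_est n f Sg x0 r J - grad F y = grad_err (last r) + (batch_mean n D J
          - (1 / real n) *\<^sub>R (\<Sum>i=1..n. D i))" for J
      using False unfolding mean
      by (simp add: next_grad_est_def batch_grad_eq batch_mean_diff D_def[abs_def] grad_err_def
          flip: x_def y_def)
    ultimately show ?thesis
      using False by (simp add: Bg prev ennreal_mult' flip: \<psi>_def)
  qed
  finally show ?thesis by (simp only: \<theta>_def)
qed

lemma transpose_hess_f: "i \<in> {1..n} \<Longrightarrow> transpose (hess (f i) x) = hess (f i) x"
  by (rule hessian_lipschitz.transpose_hess[OF hessian_lipschitz_f])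

lemma transpose_batch_mean:
  fixes D :: "nat \<Rightarrow> real^'d^'d"
  assumes "\<And>i. i \<in> {1..n} \<Longrightarrow> transpose (D i) = D i" and J: "set_mset J \<subseteq> {1..n}"
  shows "transpose (batch_mean n D J) = batch_mean n D J"
proof -
  have "transpose (\<Sum>i\<in>#J. D i) = (\<Sum>i\<in>#J. D i)"
    using J by (induction J) (simp_all add: transpose_add assms(1), simp add: transpose_def vec_eq_iff)
  moreover have "(\<Sum>i=1..n. D i) \<in> {X. transpose X = X}"
    using mat.adm_subspace by (rule subspace_sum) (simp add: assms(1))
  ultimately show ?thesis by (simp add: batch_mean_def transpose_scaleR)
qed

lemma reach_symmetric: "reach r \<Longrightarrow> x \<in> set r \<Longrightarrow> transpose (hess_est x) = hess_est x"
proof (induction arbitrary: x rule: reachable.induct)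
  case (snoc r J I h)
  have I: "set_mset I \<subseteq> {1..n}"
    using set_pmf_sample(2)[OF n snoc.hyps(4)] .
  have *: "transpose (batch_hess n f I y) = batch_hess n f I y" for y
    unfolding batch_hess_eq by (rule transpose_batch_mean[OF transpose_hess_f I])
  have "transpose (next_hess_est n f Sh x0 r I) = next_hess_est n f Sh x0 r I"
  proof (cases "length r mod Sh = 0")
    case False
    then have "r \<noteq> []" by auto
    then show ?thesis
      using False snoc.IH[of "last r"] by (simp add: next_hess_est_def transpose_add transpose_diff *)
  qed (simp add: next_hess_est_def *)
  then show ?case using snoc.IH snoc.prems by auto
qed simp

lemma reach_hess_err_symmetric: "reach r \<Longrightarrow> x \<in> set r \<Longrightarrow> transpose (hess_err x) = hess_err x"
  by (simp add: hess_err_def transpose_diff reach_symmetric F.transpose_hess)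

lemma hess_err_step:
  assumes "reach r"
  shows "(\<integral>\<^sup>+ r'. ennreal (mat.potential ((40 * \<phi>\<^sup>2 / sqrt (\<rho> * \<epsilon>)) *\<^sub>R hess_err (last r'))) \<partial>iter r)
      \<le> (if length r mod Sh = 0 then ennreal (exp (4 * \<phi>\<^sup>2) * real CARD('d))
         else ennreal (exp (4 * \<phi>\<^sup>2 / real Sh)) *
           ennreal (mat.potential ((40 * \<phi>\<^sup>2 / sqrt (\<rho> * \<epsilon>)) *\<^sub>R hess_err (last r))))"
proof -
  define \<theta> where "\<theta> = 40 * \<phi>\<^sup>2 / sqrt (\<rho> * \<epsilon>)"
  have \<theta>2: "\<theta>\<^sup>2 = 1600 * (\<phi>\<^sup>2 * \<phi>\<^sup>2) / (\<rho> * \<epsilon>)"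
    using pos eps by (simp add: \<theta>_def power_divide power_mult_distrib power2_eq_square)
  define y where "y = next_iterate x0 r"
  have "(\<integral>\<^sup>+ r'. ennreal (mat.potential (\<theta> *\<^sub>R hess_err (last r'))) \<partial>iter r)
      = (\<integral>\<^sup>+ J. ennreal (mat.potential (\<theta> *\<^sub>R (next_hess_est n f Sh x0 r J - hess F y)))
          \<partial>sample n (round_up (Bh (length r) (prev_step r))))"
    by (simp add: srvrc_iteration_def hess_err_def y_def)
  also have "\<dots> \<le> (if length r mod Sh = 0 then ennreal (exp (4 * \<phi>\<^sup>2) * real CARD('d))
         else ennreal (exp (4 * \<phi>\<^sup>2 / real Sh)) * ennreal (mat.potential (\<theta> *\<^sub>R hess_err (last r))))"
  proof (cases "length r mod Sh = 0")
    case True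
    have "(\<integral>\<^sup>+ J. ennreal (mat.potential (\<theta> *\<^sub>R (0 + (batch_mean n (\<lambda>i. hess (f i) y) J
          - (1 / real n) *\<^sub>R (\<Sum>i=1..n. hess (f i) y)))))
        \<partial>sample n (round_up (min (real n) (800 * L^2 * \<phi> ^ 2 / (\<rho> * \<epsilon>)))))
      \<le> ennreal (exp (4 * \<phi>\<^sup>2) * mat.potential (\<theta> *\<^sub>R (0 :: real^'d^'d)))"
    \<comment> \<open>Unlike the gradients, the Hessians come without a deviation bound;
      \<open>2 * L\<close> adds the bounds \<open>L\<close> on a component and on the mean. The
      constants 40 and 800 meet with equality, here and away from checkpoints.\<close>
    proof (rule mat.nn_integral_batch_mean_potential[OF n, where b = "2 * L"])
      show "\<forall>v. norm ((hess (f i) y - (1 / real n) *\<^sub>R (\<Sum>i=1..n. hess (f i) y)) *v v) \<le> 2 * L * norm v"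
        if "i \<in> {1..n}" for i
      proof
        fix v
        show "norm ((hess (f i) y - (1 / real n) *\<^sub>R (\<Sum>i=1..n. hess (f i) y)) *v v) \<le> 2 * L * norm v"
          using norm_triangle_ineq4[of "hess (f i) y *v v" "hess F y *v v"] norm_hess_f_le[OF that, of y v]
            norm_hess_F_le[of y v] unfolding hess_F[symmetric] matrix_vector_mult_diff_rdistrib by linarith
      qed
      show "\<theta>\<^sup>2 * (2 * L)\<^sup>2 / 2 \<le> 4 * \<phi>\<^sup>2 * (800 * L^2 * \<phi> ^ 2 / (\<rho> * \<epsilon>))"
        using pos eps unfolding \<theta>2 by (simp add: power_mult_distrib field_simps)
      show "(0 :: real^'d^'d) \<in> {X. transpose X = X}" by (rule mat.zero_adm)
    qed (use pos in \<open>auto simp: transpose_hess_f\<close>)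
    then show ?thesis
      using True by (simp add: Bh next_hess_est_def batch_hess_eq hess_F y_def[symmetric] mat_potential_zero
          flip: \<phi>_def)
  next
    case False
    then have r: "r \<noteq> []" by auto
    define x h where "x = iterate (last r)" and "h = step (last r)"
    have y: "y = x + h" using r by (simp add: y_def x_def h_def next_iterate_def)
    have prev: "prev_step r = h" using r by (simp add: prev_step_def h_def)
    define D where "D i = hess (f i) y - hess (f i) x" for i
    have mean: "(1 / real n) *\<^sub>R (\<Sum>i=1..n. D i) = hess F y - hess F x"
      by (simp add: D_def hess_F sum_subtractf scaleR_diff_right)
    have "(\<integral>\<^sup>+ J. ennreal (mat.potential (\<theta> *\<^sub>R (hess_err (last r) + (batch_mean n D J
          - (1 / real n) *\<^sub>R (\<Sum>i=1..n. D i)))))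
        \<partial>sample n (round_up (min (real n) (800 * \<rho> * real Sh * norm h ^ 2 * \<phi> ^ 2 / \<epsilon>))))
      \<le> ennreal (exp (4 * \<phi>\<^sup>2 / real Sh) * mat.potential (\<theta> *\<^sub>R hess_err (last r)))"
    proof (rule mat.nn_integral_batch_mean_potential[OF n, where b = "2 * \<rho> * norm h"])
      show "\<forall>v. norm ((D i - (1 / real n) *\<^sub>R (\<Sum>i=1..n. D i)) *v v) \<le> 2 * \<rho> * norm h * norm v"
        if "i \<in> {1..n}" for i
      proof
        fix v
        show "norm ((D i - (1 / real n) *\<^sub>R (\<Sum>i=1..n. D i)) *v v) \<le> 2 * \<rho> * norm h * norm v"
          using norm_triangle_ineq4[of "D i *v v" "(hess F y - hess F x) *v v"] hess_f_lipschitz[OF that, of y x v]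
            hess_F_lipschitz[of y x v] unfolding mean matrix_vector_mult_diff_rdistrib[of "D i"]
          by (simp add: D_def y)
      qed
      show "\<theta>\<^sup>2 * (2 * \<rho> * norm h)\<^sup>2 / 2
          \<le> 4 * \<phi>\<^sup>2 / real Sh * (800 * \<rho> * real Sh * norm h ^ 2 * \<phi> ^ 2 / \<epsilon>)"
        using pos eps Sh_ge unfolding \<theta>2 by (simp add: power_mult_distrib power2_eq_square field_simps)
      show "hess_err (last r) \<in> {X. transpose X = X}"
        using reach_hess_err_symmetric[OF assms] r by simp
    qed (use pos in \<open>auto simp: D_def transpose_diff transpose_hess_f\<close>)
    moreover have "next_hess_est n f Sh x0 r J - hess F y = hess_err (last r) + (batch_mean n D J
          - (1 / real n) *\<^sub>R (\<Sum>i=1..n. D i))" for J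
      using False unfolding mean
      by (simp add: next_hess_est_def batch_hess_eq batch_mean_diff D_def[abs_def] hess_err_def
          flip: x_def y_def)
    ultimately show ?thesis
      using False by (simp add: Bh prev ennreal_mult' flip: \<phi>_def)
  qed
  finally show ?thesis by (simp only: \<theta>_def)
qed

text \<open>Allows dividing by the squared logarithms, and absorbing costs without a logarithm when
  evaluations are counted.\<close>

lemma log_ge: "1 / 2 \<le> \<psi>" "1 / 2 \<le> \<phi>"
proof -
  have d: "1 \<le> real CARD('d)" by (simp add: Suc_leI)
  have T1: "1 \<le> real T" using T_ge by simp
  have "2 \<le> 2 * real T / \<xi>" using T1 xi by (simp add: le_divide_eq)
  moreover have "2 * real T / \<xi> \<le> 2 * real T * real CARD('d) / \<xi>"
    using d xi T1 by (intro divide_right_mono) auto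
  ultimately have "ln 2 \<le> \<psi>" "ln 2 \<le> \<phi>"
    unfolding \<psi>_def \<phi>_def by auto
  then show "1 / 2 \<le> \<psi>" "1 / 2 \<le> \<phi>" using ln2_ge_two_thirds by linarith+
qed

lemma estimators_accurate:
  "1 - \<xi> \<le> measure_pmf.prob run {r. reach r \<and> length r \<le> T \<and> (\<not> stopped \<epsilon> \<rho> r \<longrightarrow> length r = T) \<and>
     (\<forall>x\<in>set r. norm (grad_err x) \<le> \<epsilon> / 3 \<and>
        (\<forall>v. norm (hess_err x *v v) \<le> 2 / 5 * sqrt (\<rho> * \<epsilon>) * norm v))}"
proof -
  define A where "A = {r :: 'd run. \<exists>x\<in>set r. cosh (16 * \<psi>\<^sup>2) \<le> vec.potential ((53 * \<psi>\<^sup>2 / \<epsilon>) *\<^sub>R grad_err x)}"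
  define B where "B = {r :: 'd run. \<exists>x\<in>set r. cosh (16 * \<phi>\<^sup>2) \<le> mat.potential ((40 * \<phi>\<^sup>2 / sqrt (\<rho> * \<epsilon>)) *\<^sub>R hess_err x)}"
  define G where "G = {r. reach r \<and> length r \<le> T \<and> (\<not> stopped \<epsilon> \<rho> r \<longrightarrow> length r = T) \<and>
     (\<forall>x\<in>set r. norm (grad_err x) \<le> \<epsilon> / 3 \<and>
        (\<forall>v. norm (hess_err x *v v) \<le> 2 / 5 * sqrt (\<rho> * \<epsilon>) * norm v))}"
  have d: "1 \<le> real CARD('d)" by (simp add: Suc_leI)
  have A: "measure_pmf.prob run A \<le> \<xi> / 2"
    using vec.prob_large_potential[OF T_ge order_refl xi Sg_ge, of n f Bg Bh Sg Sh x0 \<epsilon> \<rho> sel "53 * \<psi>\<^sup>2 / \<epsilon>" grad_err]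
      grad_err_step unfolding A_def by (simp only: mult_1_right flip: \<psi>_def)
  have B: "measure_pmf.prob run B \<le> \<xi> / 2"
    using mat.prob_large_potential[OF T_ge d xi Sh_ge, of n f Bg Bh Sg Sh x0 \<epsilon> \<rho> sel "40 * \<phi>\<^sup>2 / sqrt (\<rho> * \<epsilon>)" hess_err]
      hess_err_step unfolding B_def by (simp only: flip: \<phi>_def)
  have good: "r \<in> G" if r: "r \<in> set_pmf run" "r \<notin> A" "r \<notin> B" for r
  proof -
    note inv = set_pmf_srvrc[OF r(1)]
    have "norm (grad_err x) \<le> \<epsilon> / 3 \<and> (\<forall>v. norm (hess_err x *v v) \<le> 2 / 5 * sqrt (\<rho> * \<epsilon>) * norm v)"
      if x: "x \<in> set r" for x
    proof
      have "cosh (53 * \<psi>\<^sup>2 / \<epsilon> * norm (grad_err x)) \<le> cosh (16 * \<psi>\<^sup>2)"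
        using r(2) x eps by (auto simp: A_def vec_potential_eq not_le less_imp_le)
      \<comment> \<open>The scale 53 yields \<open>16 / 53 * \<epsilon>\<close>, just below
        \<open>\<epsilon> / 3\<close>; for the Hessian \<open>16 / 40\<close> is exactly
        \<open>2 / 5\<close>.\<close>
      then have "53 * \<psi>\<^sup>2 / \<epsilon> * norm (grad_err x) \<le> 16 * \<psi>\<^sup>2"
        using eps by (subst (asm) cosh_real_nonneg_le_iff) auto
      then have "\<psi>\<^sup>2 * (53 * norm (grad_err x)) \<le> \<psi>\<^sup>2 * (16 * \<epsilon>)"
        using eps by (simp add: field_simps)
      then have "53 * norm (grad_err x) \<le> 16 * \<epsilon>"
        using log_ge(1) by (subst (asm) mult_le_cancel_left_pos) auto
      then show "norm (grad_err x) \<le> \<epsilon> / 3" using eps by simp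
      have pos': "0 < sqrt (\<rho> * \<epsilon>)" using pos eps by simp
      show "\<forall>v. norm (hess_err x *v v) \<le> 2 / 5 * sqrt (\<rho> * \<epsilon>) * norm v"
      proof
        fix v
        show "norm (hess_err x *v v) \<le> 2 / 5 * sqrt (\<rho> * \<epsilon>) * norm v"
        proof (rule norm_matrix_vector_le_of_mat_potential)
          show "transpose (hess_err x) = hess_err x"
            using inv x reach_hess_err_symmetric by blast
          show "0 < 40 * \<phi>\<^sup>2 / sqrt (\<rho> * \<epsilon>)" using log_ge(2) pos' by simp
          show "0 \<le> 2 / 5 * sqrt (\<rho> * \<epsilon>)" using pos' by simp
          have "40 * \<phi>\<^sup>2 / sqrt (\<rho> * \<epsilon>) * (2 / 5 * sqrt (\<rho> * \<epsilon>)) = 16 * \<phi>\<^sup>2"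
            using pos eps by simp
          then show "mat.potential ((40 * \<phi>\<^sup>2 / sqrt (\<rho> * \<epsilon>)) *\<^sub>R hess_err x)
              \<le> cosh (40 * \<phi>\<^sup>2 / sqrt (\<rho> * \<epsilon>) * (2 / 5 * sqrt (\<rho> * \<epsilon>)))"
            using r(3) x by (auto simp: B_def not_le less_imp_le)
        qed
      qed
    qed
    then show ?thesis using inv by (simp add: G_def)
  qed
  have "measure_pmf.prob run (- G) \<le> measure_pmf.prob run (A \<union> B)"
    by (rule measure_pmf.finite_measure_mono_AE) (auto simp: AE_measure_pmf_iff dest: good)
  also have "\<dots> \<le> measure_pmf.prob run A + measure_pmf.prob run B"
    by (rule measure_Un_le) auto
  also have "\<dots> \<le> \<xi>" using A B by linarith
  finally have "1 - \<xi> \<le> 1 - measure_pmf.prob run (- G)" by simp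
  also have "\<dots> = measure_pmf.prob run G"
    using measure_pmf.prob_compl[of G run] by (simp add: Compl_eq_Diff_UNIV)
  finally show ?thesis by (simp only: G_def)
qed

end

section \<open>Descent and termination\<close>

lemma evaluations_snoc:
  "evaluations S B (r @ [x]) = evaluations S B r
     + (if length r mod S = 0 then 1 else 2) * B (length r) (prev_step r)"
  by (simp add: evaluations_def)

text \<open>The second summand vanishes for \<open>S = 1\<close>, when every iteration is a checkpoint; this
  matters when the unrounded period is below 1.\<close>

lemma evaluations_le:
  fixes N k c :: real and S :: nat
  assumes S: "1 \<le> S" and N: "0 \<le> N" and k: "0 \<le> k" and c: "0 \<le> c"
    and B: "\<And>t h. B t h = min N (if t mod S \<noteq> 0 then c * (norm h)\<^sup>2 else k)"
  shows "evaluations S B (r @ [x]) \<le> min N k * (1 + real (length r) / real S)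
     + (if S = 1 then 0 else 2 * min (N * real (length r)) (c * (\<Sum>y\<leftarrow>r. (norm (step y))\<^sup>2)))"
proof -
  \<comment> \<open>The indices from 0 to \<open>length r\<close> contain
    \<open>1 + length r div S\<close> checkpoints. Every other batch depends on the step before it,
    which is a step of \<open>r\<close>, so the step of \<open>x\<close> does not enter.\<close>
  have "evaluations S B (r @ [x]) \<le> min N k * (1 + real (length r div S))
     + (if S = 1 then 0 else 2 * (\<Sum>y\<leftarrow>r. min N (c * (norm (step y))\<^sup>2)))"
  proof (induction r arbitrary: x rule: rev_induct)
    case Nil
    then show ?case by (simp add: evaluations_def B)
  next
    case (snoc y r)
    have step: "evaluations S B ((r @ [y]) @ [x]) = evaluations S B (r @ [y])
        + (if Suc (length r) mod S = 0 then 1 else 2) * B (Suc (length r)) (step y)"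
      unfolding evaluations_snoc[of S B "r @ [y]"] by (simp add: prev_step_def)
    have nonneg: "0 \<le> min N (c * (norm (step y))\<^sup>2)"
      using N c by simp
    show ?case
    proof (cases "Suc (length r) mod S = 0")
      case True
      then have "Suc (length r) div S = Suc (length r div S)"
        using S by (simp add: div_Suc)
      moreover have "B (Suc (length r)) (step y) = min N k"
        using True by (simp add: B)
      ultimately show ?thesis
        using snoc.IH[of y] True nonneg unfolding step by (auto simp: algebra_simps)
    next
      case False
      then have "S \<noteq> 1" by auto
      moreover have "Suc (length r) div S = length r div S"
        using False by (simp add: div_Suc)
      moreover have "B (Suc (length r)) (step y) = min N (c * (norm (step y))\<^sup>2)"
        using False by (simp add: B)
      ultimately show ?thesis
        using snoc.IH[of y] False unfolding step by (simp add: algebra_simps)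
    qed
  qed
  also have "min N k * (1 + real (length r div S)) \<le> min N k * (1 + real (length r) / real S)"
    using N k by (intro mult_left_mono add_left_mono of_nat_div_le_of_nat) auto
  also have "(\<Sum>y\<leftarrow>r. min N (c * (norm (step y))\<^sup>2)) \<le> min (N * real (length r)) (c * (\<Sum>y\<leftarrow>r. (norm (step y))\<^sup>2))"
  proof (induction r)
    case (Cons y r)
    then show ?case by (simp add: algebra_simps min_def split: if_splits)
  qed simp
  finally show ?thesis by simp
qed

lemma min_mult_le: "1 \<le> c \<Longrightarrow> 0 \<le> a \<Longrightarrow> 0 \<le> b \<Longrightarrow> min a (c * b) \<le> c * min a (b :: real)"
  by (auto simp: min_mult_distrib_left min_le_iff_disj mult_le_cancel_right1)

lemma round_up_le_double:
  assumes "0 \<le> r" "round_up r \<noteq> 1"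
  shows "real (round_up r) \<le> 2 * r"
  using assms unfolding round_up_def by linarith

context srvrc_setting
begin

definition accurate :: "'d iteration \<Rightarrow> bool" where
  "accurate x \<longleftrightarrow> norm (grad_err x) \<le> \<epsilon> / 3 \<and>
     (\<forall>v. norm (hess_err x *v v) \<le> 2 / 5 * sqrt (\<rho> * \<epsilon>) * norm v)"

text \<open>In terms of \<open>p = sqrt \<rho>\<close> and \<open>e = sqrt \<epsilon>\<close> all fractional powers become integral: the stopping
  radius is \<open>e / p\<close> and \<open>T\<close> is about \<open>40 \<Delta> p / e\<^sup>3\<close>.\<close>

context
  fixes p e :: real
  assumes p_def: "p = sqrt \<rho>" and e_def: "e = sqrt \<epsilon>"
begin

lemma p_pos: "0 < p" and e_pos: "0 < e"
  using pos eps by (simp_all add: p_def e_def)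

lemma \<rho>_eq: "\<rho> = p\<^sup>2" and \<epsilon>_eq: "\<epsilon> = e\<^sup>2"
  using pos eps by (simp_all add: p_def e_def)

lemma radius_eq: "sqrt (\<epsilon> / \<rho>) = e / p" and sqrt_\<rho>\<epsilon>: "sqrt (\<rho> * \<epsilon>) = p * e"
  by (simp_all add: p_def e_def real_sqrt_divide real_sqrt_mult)

lemma powr_eq: "\<epsilon> powr (3/2) = e ^ 3" "\<rho> powr (3/2) = p ^ 3" "\<rho> powr (1/2) = p" "\<epsilon> powr (-3/2) = 1 / e ^ 3"
proof -
  have 32: "x\<^sup>2 powr (3/2) = x ^ 3" if "0 < x" for x :: real
  proof -
    have "x\<^sup>2 powr (3/2) = (x powr 2) powr (3/2)" using that by simp
    also have "\<dots> = x powr 3" by (simp only: powr_powr) simp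
    finally show ?thesis using that by simp
  qed
  show "\<epsilon> powr (3/2) = e ^ 3" "\<rho> powr (3/2) = p ^ 3"
    unfolding \<epsilon>_eq \<rho>_eq using 32 e_pos p_pos by auto
  then show "\<epsilon> powr (-3/2) = 1 / e ^ 3"
    using powr_minus_divide[of \<epsilon> "3/2"] by simp
  show "\<rho> powr (1/2) = p" using pos by (simp add: p_def powr_half_sqrt)
qed

lemma reach_minimizer:
  "reach r \<Longrightarrow> x \<in> set r \<Longrightarrow>
    cubic_model (grad_est x) (hess_est x) (4 * \<rho>) (step x) \<le> cubic_model (grad_est x) (hess_est x) (4 * \<rho>) w"
proof (induction arbitrary: x rule: reachable.induct)
  case (snoc r J I h)
  have "is_arg_min (cubic_model (next_grad_est n f Sg x0 r J) (next_hess_est n f Sh x0 r I) (4 * \<rho>)) (\<lambda>_. True) h"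
    using sel snoc.hyps(5) by (auto simp: minimizing_rule_def)
  then show ?case
    using snoc.IH snoc.prems by (auto simp: is_arg_min_def not_less)
qed simp

text \<open>A long step turns the errors, of order \<open>\<epsilon>\<close> and
  \<open>sqrt (\<rho> * \<epsilon>)\<close>, into multiples of \<open>\<rho> * norm h ^ 3\<close>.
  In this unit the model gains \<open>1 / 3\<close>, its excess cubic term
  \<open>2 / 3 - 1 / 6\<close> more; the errors cost \<open>1 / 3\<close> and \<open>1 / 5\<close>,
  so \<open>3 / 10\<close> is left.\<close>

lemma step_decrease:
  assumes r: "reach r" "x \<in> set r" and acc: "accurate x" and large: "e / p < norm (step x)"
  shows "F (iterate x + step x) \<le> F (iterate x) - \<rho> / 4 * norm (step x) ^ 3"
proof -
  define y h where "y = iterate x" and "h = step x"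
  have \<rho>h: "p * e \<le> \<rho> * norm h" "\<epsilon> \<le> \<rho> * (norm h)\<^sup>2"
  proof -
    have *: "e \<le> p * norm h" using large p_pos by (simp add: h_def field_simps)
    then show "p * e \<le> \<rho> * norm h"
      using mult_left_mono[OF *, of p] p_pos by (simp add: \<rho>_eq power2_eq_square mult.assoc)
    show "\<epsilon> \<le> \<rho> * (norm h)\<^sup>2"
      using power_mono[OF *, of 2] e_pos by (simp add: \<rho>_eq \<epsilon>_eq power_mult_distrib)
  qed
  have "cubic_model (grad_est x) (hess_est x) (4 * \<rho>) h \<le> - (4 * \<rho> / 12) * norm h ^ 3"
    unfolding h_def using pos reach_symmetric[OF r] reach_minimizer[OF r]
    by (intro cubic_minimizer_decrease) auto
  then have model: "grad_est x \<bullet> h + (hess_est x *v h) \<bullet> h / 2 + 2 / 3 * (\<rho> * norm h ^ 3) \<le> - (1 / 3) * (\<rho> * norm h ^ 3)"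
    by (simp add: cubic_model_def)
  have "F (y + h) \<le> F y + grad F y \<bullet> h + (hess F y *v h) \<bullet> h / 2 + \<rho> / 6 * norm h ^ 3"
    by (rule F.value_taylor)
  also have "grad F y \<bullet> h = grad_est x \<bullet> h - grad_err x \<bullet> h"
    by (simp add: grad_err_def y_def inner_diff_left)
  also have "(hess F y *v h) \<bullet> h = (hess_est x *v h) \<bullet> h - (hess_err x *v h) \<bullet> h"
    by (simp add: hess_err_def y_def matrix_vector_mult_diff_rdistrib inner_diff_left)
  finally have "F (y + h) \<le> F y - 5 / 6 * (\<rho> * norm h ^ 3) - grad_err x \<bullet> h - (hess_err x *v h) \<bullet> h / 2"
    using model by (simp add: diff_divide_distrib)
  moreover have "- (grad_err x \<bullet> h) \<le> 1 / 3 * (\<rho> * norm h ^ 3)"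
  proof -
    have "- (grad_err x \<bullet> h) \<le> norm (grad_err x) * norm h"
      using Cauchy_Schwarz_ineq2[of "grad_err x" h] by linarith
    also have "\<dots> \<le> (1 / 3 * (\<rho> * (norm h)\<^sup>2)) * norm h"
      using acc \<rho>h(2) unfolding accurate_def by (intro mult_right_mono) auto
    finally show ?thesis by (simp add: power2_eq_square power3_eq_cube)
  qed
  moreover have "- ((hess_err x *v h) \<bullet> h) \<le> 2 / 5 * (\<rho> * norm h ^ 3)"
  proof -
    have "- ((hess_err x *v h) \<bullet> h) \<le> norm (hess_err x *v h) * norm h"
      using Cauchy_Schwarz_ineq2[of "hess_err x *v h" h] by linarith
    also have "\<dots> \<le> (2 / 5 * (p * e) * norm h) * norm h"
      using acc unfolding accurate_def sqrt_\<rho>\<epsilon> by (intro mult_right_mono) auto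
    also have "\<dots> \<le> (2 / 5 * (\<rho> * norm h) * norm h) * norm h"
      using \<rho>h(1) by (intro mult_right_mono mult_left_mono) auto
    finally show ?thesis by (simp add: power3_eq_cube mult.assoc)
  qed
  moreover have "0 \<le> \<rho> * norm h ^ 3" using pos by simp
  ultimately show ?thesis unfolding y_def[symmetric] h_def[symmetric] by linarith
qed

lemma total_decrease:
  "reach r \<Longrightarrow> \<not> stopped \<epsilon> \<rho> r \<Longrightarrow> \<forall>x\<in>set r. accurate x \<Longrightarrow>
    (\<forall>x\<in>set r. e / p < norm (step x)) \<and>
    \<rho> / 4 * (\<Sum>x\<leftarrow>r. norm (step x) ^ 3) \<le> F x0 - F (next_iterate x0 r)"
proof (induction rule: reachable.induct)
  case Nil
  then show ?case by (simp add: next_iterate_def)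
next
  case (snoc r J I h)
  let ?x = "Iteration J I (next_iterate x0 r) (next_grad_est n f Sg x0 r J) (next_hess_est n f Sh x0 r I) h"
  have large: "e / p < norm h"
    using snoc.prems(1) by (simp add: stopped_def radius_eq)
  have "reach (r @ [?x])"
    by (rule reachable.snoc) (use snoc.hyps in auto)
  then have "F (next_iterate x0 r + h) \<le> F (next_iterate x0 r) - \<rho> / 4 * norm h ^ 3"
    using step_decrease[of "r @ [?x]" ?x] snoc.prems large by simp
  moreover have "next_iterate x0 (r @ [?x]) = next_iterate x0 r + h"
    by (simp add: next_iterate_def)
  ultimately show ?case
    using snoc.IH snoc.hyps snoc.prems large by (simp add: distrib_left)
qed

text \<open>Descent bounds the sum of the cubes by \<open>4 * \<Delta> / \<rho>\<close>. As every
  step exceeds \<open>e / p\<close>, replacing all three factors by this radius counts the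
  iterations, and replacing one leaves the sum of squares that governs the batch sizes.\<close>

lemma running_bounds:
  assumes "reach r" "\<not> stopped \<epsilon> \<rho> r" "\<forall>x\<in>set r. accurate x"
  shows "real (length r) \<le> 4 * (\<Delta> * p / e ^ 3)"
    and "(\<Sum>x\<leftarrow>r. (norm (step x))\<^sup>2) \<le> 4 * (\<Delta> / (p * e))"
proof -
  note decrease = total_decrease[OF assms]
  have large: "\<And>x. x \<in> set r \<Longrightarrow> e / p < norm (step x)"
    using decrease by blast
  have "(INF x. F x) \<le> F (next_iterate x0 r)"
    using gap(1) by (rule cINF_lower) simp
  then have "\<rho> / 4 * (\<Sum>x\<leftarrow>r. norm (step x) ^ 3) \<le> \<Delta>"
    using decrease gap(2) by linarith
  then have sum: "p\<^sup>2 * (\<Sum>x\<leftarrow>r. norm (step x) ^ 3) \<le> 4 * \<Delta>"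
    by (simp add: \<rho>_eq)
  have "real (length r) * (e / p) ^ 3 \<le> (\<Sum>x\<leftarrow>r. norm (step x) ^ 3)"
    using large
  proof (induction r)
    case (Cons y r)
    have "(e / p) ^ 3 \<le> norm (step y) ^ 3"
      using Cons.prems[of y] p_pos e_pos by (intro power_mono) auto
    then show ?case using Cons by (simp add: distrib_right)
  qed simp
  then have "p\<^sup>2 * (real (length r) * (e / p) ^ 3) \<le> 4 * \<Delta>"
    using sum p_pos by (meson mult_left_mono order_trans zero_le_power2)
  moreover have "p\<^sup>2 * (real (length r) * (e / p) ^ 3) = real (length r) * e ^ 3 / p"
    using p_pos by (simp add: power_divide power2_eq_square power3_eq_cube)
  ultimately have "real (length r) * e ^ 3 / p \<le> 4 * \<Delta>" by simp
  then show "real (length r) \<le> 4 * (\<Delta> * p / e ^ 3)"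
    using p_pos e_pos by (simp add: pos_divide_le_eq pos_le_divide_eq mult.assoc)
  have "(e / p) * (\<Sum>x\<leftarrow>r. (norm (step x))\<^sup>2) \<le> (\<Sum>x\<leftarrow>r. norm (step x) ^ 3)"
    using large
  proof (induction r)
    case (Cons y r)
    have "(e / p) * (norm (step y))\<^sup>2 \<le> norm (step y) * (norm (step y))\<^sup>2"
      using Cons.prems[of y] by (intro mult_right_mono) auto
    then show ?case using Cons by (simp add: distrib_left power2_eq_square power3_eq_cube)
  qed simp
  then have "p\<^sup>2 * ((e / p) * (\<Sum>x\<leftarrow>r. (norm (step x))\<^sup>2)) \<le> 4 * \<Delta>"
    using sum p_pos by (meson mult_left_mono order_trans zero_le_power2)
  then show "(\<Sum>x\<leftarrow>r. (norm (step x))\<^sup>2) \<le> 4 * (\<Delta> / (p * e))"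
    using p_pos e_pos by (simp add: field_simps power2_eq_square)
qed

text \<open>An unstopped accurate run has at most a tenth of the iterations that \<open>T\<close>
  allows.\<close>

lemma stops:
  assumes "reach r" "\<forall>x\<in>set r. accurate x" and len: "\<not> stopped \<epsilon> \<rho> r \<longrightarrow> length r = T"
  shows "stopped \<epsilon> \<rho> r"
proof (rule ccontr)
  assume "\<not> stopped \<epsilon> \<rho> r"
  then have "real T \<le> 4 * (\<Delta> * p / e ^ 3)"
    using running_bounds(1)[OF assms(1) _ assms(2)] len by simp
  moreover have "40 * (\<Delta> * p / e ^ 3) \<le> real T"
    using real_le_round_up[of "40 * \<Delta> * \<rho> powr (1/2) * \<epsilon> powr (-3/2)", folded T]
    unfolding powr_eq by simp
  moreover have "0 < \<Delta> * p / e ^ 3"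
    using pos p_pos e_pos by simp
  ultimately show False by linarith
qed

text \<open>In units of \<open>e\<^sup>2\<close> the gradient collects \<open>1 / 2\<close> from the
  Taylor remainder, \<open>1 / 3\<close> and \<open>2 / 5\<close> from the estimators and 2 from the
  cubic term. In units of \<open>p * e\<close> the negative curvature collects 2 from the model,
  \<open>2 / 5\<close> from the estimator and 1 from the move by \<open>h\<close>. Both totals are
  below 4, giving 8 and 64, well within 600.\<close>

lemma mu_output:
  assumes r: "reach r" "x \<in> set r" and acc: "accurate x" and small: "norm (step x) \<le> e / p"
  shows "mu F \<rho> (iterate x + step x) \<le> 600 * \<epsilon> powr (3/2)"
proof -
  define y h U where "y = iterate x" and "h = step x" and "U = hess_est x"
  have sym: "transpose U = U" unfolding U_def using reach_symmetric[OF r] .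
  note stationary = cubic_minimizer_stationary[OF sym, of "4 * \<rho>" "grad_est x" h]
  note psd = cubic_minimizer_psd[OF sym, of "4 * \<rho>" "grad_est x" h]
  have min: "\<And>w. cubic_model (grad_est x) U (4 * \<rho>) h \<le> cubic_model (grad_est x) U (4 * \<rho>) w"
    unfolding U_def h_def by (rule reach_minimizer[OF r])
  have h: "norm h \<le> e / p" using small by (simp add: h_def)
  have \<rho>h: "\<rho> * norm h \<le> p * e" "\<rho> * (norm h)\<^sup>2 \<le> e\<^sup>2" "p * e * norm h \<le> e\<^sup>2"
  proof -
    show "\<rho> * norm h \<le> p * e"
      using mult_left_mono[OF h, of "p\<^sup>2"] p_pos by (simp add: \<rho>_eq power2_eq_square)
    show "\<rho> * (norm h)\<^sup>2 \<le> e\<^sup>2"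
      using mult_left_mono[OF power_mono[OF h, of 2], of "p\<^sup>2"] p_pos by (simp add: \<rho>_eq power_divide)
    show "p * e * norm h \<le> e\<^sup>2"
      using mult_left_mono[OF h, of "p * e"] p_pos e_pos by (simp add: power2_eq_square)
  qed
  have gerr: "norm (grad_err x) \<le> e\<^sup>2 / 3" and herr: "\<And>v. norm (hess_err x *v v) \<le> 2 / 5 * (p * e) * norm v"
    using acc by (simp_all add: accurate_def sqrt_\<rho>\<epsilon> flip: \<epsilon>_eq)
  have triangle: "norm (a - b - c + d) \<le> norm a + norm b + norm c + norm d" for a b c d :: "real^'d"
    by norm
  have "grad F (y + h) = (grad F (y + h) - grad F y - hess F y *v h) - grad_err x - hess_err x *v h
      + (grad_est x + U *v h)"
    by (simp add: grad_err_def hess_err_def y_def U_def matrix_vector_mult_diff_rdistrib)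
  also have "grad_est x + U *v h = - ((4 * \<rho> / 2 * norm h) *\<^sub>R h)"
    using stationary min pos by (simp add: eq_neg_iff_add_eq_0)
  finally have eq: "grad F (y + h) = (grad F (y + h) - grad F y - hess F y *v h) - grad_err x - hess_err x *v h
      + - ((4 * \<rho> / 2 * norm h) *\<^sub>R h)" .
  have "norm (grad F (y + h)) \<le> norm (grad F (y + h) - grad F y - hess F y *v h) + norm (grad_err x)
      + norm (hess_err x *v h) + norm ((4 * \<rho> / 2 * norm h) *\<^sub>R h)"
    using triangle[of "grad F (y + h) - grad F y - hess F y *v h" "grad_err x" "hess_err x *v h"
        "- ((4 * \<rho> / 2 * norm h) *\<^sub>R h)"]
    unfolding eq[symmetric] norm_minus_cancel .
  moreover have "norm ((4 * \<rho> / 2 * norm h) *\<^sub>R h) = 2 * (\<rho> * (norm h)\<^sup>2)"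
    using pos by (simp add: power2_eq_square)
  moreover have "norm (grad F (y + h) - grad F y - hess F y *v h) \<le> 1 / 2 * (\<rho> * (norm h)\<^sup>2)"
    using F.gradient_taylor[of y h] by simp
  moreover have "norm (hess_err x *v h) \<le> 2 / 5 * (p * e * norm h)"
    using herr[of h] by (simp only: mult.assoc)
  ultimately have "norm (grad F (y + h)) \<le> 4 * e\<^sup>2"
    using gerr \<rho>h zero_le_power2[of e] by linarith
  then have "norm (grad F (y + h)) powr (3/2) \<le> ((2 * e)\<^sup>2) powr (3/2)"
    by (intro powr_mono2) (auto simp: power_mult_distrib)
  also have "\<dots> = 8 * e ^ 3"
  proof -
    have "(2 * e)\<^sup>2 = 4 * \<epsilon>" by (simp add: \<epsilon>_eq power_mult_distrib)
    moreover have "4 powr (3/2) = (8::real)"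
    proof -
      have "(4::real) powr (3/2) = (2 powr 2) powr (3/2)" by simp
      also have "\<dots> = 2 powr 3" by (simp only: powr_powr) simp
      finally show ?thesis by simp
    qed
    ultimately show ?thesis using eps by (simp add: powr_mult powr_eq)
  qed
  also have "\<dots> \<le> 600 * e ^ 3" using e_pos by simp
  finally have 1: "norm (grad F (y + h)) powr (3/2) \<le> 600 * e ^ 3" .
  have "- (4 * (p * e)) \<le> lambda_min (hess F (y + h))"
  proof (rule lambda_min_ge[OF F.transpose_hess])
    fix v
    have eq: "v \<bullet> (hess F (y + h) *v v) = v \<bullet> (U *v v) - v \<bullet> (hess_err x *v v) + v \<bullet> ((hess F (y + h) - hess F y) *v v)"
      by (simp add: hess_err_def y_def U_def matrix_vector_mult_diff_rdistrib inner_diff_right)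
    have "- (2 * (p * e)) * (norm v)\<^sup>2 \<le> - (4 * \<rho> / 2 * norm h) * (norm v)\<^sup>2"
      using \<rho>h(1) by (intro mult_right_mono) auto
    also have "\<dots> \<le> v \<bullet> (U *v v)"
      by (rule psd) (use pos min in auto)
    finally have a: "- 2 * (p * e * (norm v)\<^sup>2) \<le> v \<bullet> (U *v v)" by simp
    have "v \<bullet> (hess_err x *v v) \<le> norm v * norm (hess_err x *v v)"
      by (rule norm_cauchy_schwarz)
    also have "\<dots> \<le> norm v * (2 / 5 * (p * e) * norm v)"
      by (intro mult_left_mono herr) simp
    finally have b: "v \<bullet> (hess_err x *v v) \<le> 2 / 5 * (p * e * (norm v)\<^sup>2)"
      by (simp add: power2_eq_square mult_ac)
    have "- (v \<bullet> ((hess F (y + h) - hess F y) *v v)) \<le> norm v * norm ((hess F (y + h) - hess F y) *v v)"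
      using Cauchy_Schwarz_ineq2[of v "(hess F (y + h) - hess F y) *v v"] by linarith
    also have "\<dots> \<le> norm v * (p * e * norm v)"
      using F.lipschitz[of "y + h" y v] mult_right_mono[OF \<rho>h(1) norm_ge_zero[of v]]
      by (intro mult_left_mono) auto
    finally have c: "- (v \<bullet> ((hess F (y + h) - hess F y) *v v)) \<le> p * e * (norm v)\<^sup>2"
      by (simp add: power2_eq_square mult_ac)
    have "0 \<le> p * e * (norm v)\<^sup>2" using p_pos e_pos by simp
    then have "- 4 * (p * e * (norm v)\<^sup>2) \<le> v \<bullet> (hess F (y + h) *v v)"
      using a b c unfolding eq by linarith
    then show "- (4 * (p * e)) * (norm v)\<^sup>2 \<le> v \<bullet> (hess F (y + h) *v v)"
      by simp
  qed
  \<comment> \<open>Odd powers are monotone on all reals, so the sign of \<open>lambda_min\<close>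
    needs no case distinction.\<close>
  then have "(- (4 * (p * e))) ^ 3 \<le> lambda_min (hess F (y + h)) ^ 3"
    by (intro power_mono_odd) auto
  then have "- (lambda_min (hess F (y + h)) ^ 3) \<le> 64 * e ^ 3 * p ^ 3"
    by (simp add: power_mult_distrib mult_ac)
  also have "\<dots> \<le> 600 * e ^ 3 * p ^ 3" using e_pos p_pos by simp
  finally have 2: "- (lambda_min (hess F (y + h)) ^ 3) / p ^ 3 \<le> 600 * e ^ 3"
    by (rule mult_imp_div_pos_le[OF zero_less_power[OF p_pos]])
  show ?thesis
    using 1 2 by (simp add: mu_def powr_eq flip: y_def h_def)
qed

section \<open>Counting evaluations\<close>

text \<open>The prefix \<open>r\<close> is still running, so \<open>running_bounds\<close> applies
  to it although the step of \<open>x\<close> may be short. Up to logarithms, checkpoints cost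
  \<open>K\<close> every \<open>Sh\<close> iterations and the other batches sum to a multiple of
  \<open>Y * Sh\<close>; \<open>Sh\<close> near \<open>sqrt K\<close> balances the two.\<close>

lemma hess_evaluations:
  assumes "reach r" "\<not> stopped \<epsilon> \<rho> r" "\<forall>x\<in>set r. accurate x"
  shows "evaluations Sh Bh (r @ [x]) \<le> 10^6 * \<phi> ^ 2 *
     (min (real n) (L^2 / (\<rho> * \<epsilon>))
        + sqrt \<rho> * \<Delta> / \<epsilon> powr (3/2) * sqrt (min (real n) (L^2 / (\<rho> * \<epsilon>))))"
proof -
  define K where "K = min (real n) (L^2 / (\<rho> * \<epsilon>))"
  define Y where "Y = \<Delta> * p / e ^ 3"
  have K: "0 < K" using n pos eps by (simp add: K_def)
  have Y: "0 < Y" using pos p_pos e_pos by (simp add: Y_def)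
  have \<phi>: "1 / 4 \<le> \<phi>\<^sup>2" using power_mono[OF log_ge(2), of 2] by (simp add: power2_eq_square)
  have len: "real (length r) \<le> 4 * Y" and sq: "(\<Sum>x\<leftarrow>r. (norm (step x))\<^sup>2) \<le> 4 * (\<Delta> / (p * e))"
    using running_bounds[OF assms] by (simp_all add: Y_def)
  have Sh_ge_sqrt: "sqrt K \<le> real Sh"
    unfolding Sh K_def by (rule real_le_round_up)
  define c where "c = 800 * \<rho> * real Sh * \<phi>\<^sup>2 / \<epsilon>"
  define k where "k = 800 * \<phi>\<^sup>2 * (L^2 / (\<rho> * \<epsilon>))"
  have ck: "0 \<le> c" "0 \<le> k" using pos eps by (simp_all add: c_def k_def)
  have "evaluations Sh Bh (r @ [x]) \<le> min (real n) k * (1 + real (length r) / real Sh)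
     + (if Sh = 1 then 0 else 2 * min (real n * real (length r)) (c * (\<Sum>y\<leftarrow>r. (norm (step y))\<^sup>2)))"
    by (rule evaluations_le[OF Sh_ge _ ck(2,1)]) (auto simp: Bh c_def k_def \<phi>_def mult_ac)
  also have "\<dots> \<le> 800 * \<phi>\<^sup>2 * (K + 4 * (Y * sqrt K)) + 12800 * \<phi>\<^sup>2 * (Y * sqrt K)"
  proof (rule add_mono)
    have "min (real n) k \<le> 800 * \<phi>\<^sup>2 * K"
      unfolding k_def K_def using \<phi> pos eps by (intro min_mult_le) auto
    then have "min (real n) k * (1 + real (length r) / real Sh) \<le> 800 * \<phi>\<^sup>2 * K * (1 + real (length r) / real Sh)"
      by (intro mult_right_mono) auto
    also have "\<dots> = 800 * \<phi>\<^sup>2 * (K + real (length r) * (K / real Sh))"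
      by (simp add: algebra_simps)
    also have "K / real Sh \<le> sqrt K"
      using Sh_ge Sh_ge_sqrt K mult_left_mono[OF Sh_ge_sqrt, of "sqrt K"] by (simp add: divide_le_eq)
    also have "real (length r) * sqrt K \<le> 4 * Y * sqrt K"
      using len K by (intro mult_right_mono) auto
    finally show "min (real n) k * (1 + real (length r) / real Sh) \<le> 800 * \<phi>\<^sup>2 * (K + 4 * (Y * sqrt K))"
      by (simp add: mult.assoc mult_left_mono)
    show "(if Sh = 1 then 0 else 2 * min (real n * real (length r)) (c * (\<Sum>y\<leftarrow>r. (norm (step y))\<^sup>2)))
        \<le> 12800 * \<phi>\<^sup>2 * (Y * sqrt K)"
    proof (cases "Sh = 1")
      case False
      have "real Sh \<le> 2 * sqrt K"
        using round_up_le_double[of "sqrt K"] False K unfolding Sh K_def by simp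
      then have S: "6400 * \<phi>\<^sup>2 * Y * real Sh \<le> 6400 * \<phi>\<^sup>2 * Y * (2 * sqrt K)"
        using Y by (intro mult_left_mono) auto
      have "2 * (c * (\<Sum>y\<leftarrow>r. (norm (step y))\<^sup>2)) \<le> 2 * (c * (4 * (\<Delta> / (p * e))))"
        using sq ck by (intro mult_left_mono) auto
      also have "\<dots> = 6400 * \<phi>\<^sup>2 * Y * real Sh"
        using p_pos e_pos by (simp add: c_def Y_def \<rho>_eq \<epsilon>_eq power2_eq_square power3_eq_cube) (simp add: mult_ac)
      finally show ?thesis using False S by (simp add: mult.assoc)
    qed (use Y K in simp)
  qed
  also have "\<dots> \<le> 10^6 * \<phi>\<^sup>2 * (K + Y * sqrt K)"
  proof -
    have "0 \<le> \<phi>\<^sup>2 * K" "0 \<le> \<phi>\<^sup>2 * (Y * sqrt K)" using Y K by simp_all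
    then show ?thesis by (simp add: algebra_simps)
  qed
  finally show ?thesis
    by (simp add: K_def Y_def powr_eq p_def mult_ac)
qed

text \<open>\<open>sqrt K\<close> is the minimum of \<open>sqrt n\<close> and
  \<open>M / \<epsilon>\<close>, so \<open>W\<close> provides the last two members of the triple
  minimum; the first is the trivial cost of \<open>n\<close> per iteration. As
  \<open>W = p * K / a\<close>, that one takes over when the unrounded period \<open>a\<close> is at
  most \<open>K / n\<close>, and then \<open>Sg = 1\<close>.\<close>

lemma grad_evaluations:
  assumes "reach r" "\<not> stopped \<epsilon> \<rho> r" "\<forall>x\<in>set r. accurate x"
  shows "evaluations Sg Bg (r @ [x]) \<le> 10^6 * \<psi> ^ 2 *
     (min (real n) (M^2 / \<epsilon>^2)
        + \<Delta> / \<epsilon> powr (3/2) * min (sqrt \<rho> * real n)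
            (min (L * sqrt (real n) / sqrt \<epsilon>) (L * M / \<epsilon> powr (3/2))))"
proof -
  define K where "K = min (real n) (M^2 / \<epsilon>^2)"
  define Y where "Y = \<Delta> * p / e ^ 3"
  define W where "W = L * sqrt K / e"
  define Z where "Z = min (p * real n) W"
  have K: "0 < K" "K \<le> real n" using n pos eps by (simp_all add: K_def)
  have Y: "0 < Y" using pos p_pos e_pos by (simp add: Y_def)
  have W: "0 < W" using pos K e_pos by (simp add: W_def)
  have Z: "0 < Z" using W n p_pos by (simp add: Z_def)
  define X where "X = \<Delta> / e ^ 3"
  have X: "0 < X" using pos e_pos by (simp add: X_def)
  have YX: "Y = X * p" by (simp add: X_def Y_def)
  have \<psi>: "1 / 4 \<le> \<psi>\<^sup>2" using power_mono[OF log_ge(1), of 2] by (simp add: power2_eq_square)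
  have len: "real (length r) \<le> 4 * Y" and sq: "(\<Sum>x\<leftarrow>r. (norm (step x))\<^sup>2) \<le> 4 * (\<Delta> / (p * e))"
    using running_bounds[OF assms] by (simp_all add: Y_def)
  define a where "a = p * e / L * sqrt K"
  have a: "0 < a" using p_pos e_pos pos K by (simp add: a_def)
  have Sg_a: "Sg = round_up a"
    by (simp add: Sg a_def K_def sqrt_\<rho>\<epsilon>)
  have Sg_ge_a: "a \<le> real Sg"
    unfolding Sg_a by (rule real_le_round_up)
  define c where "c = 1440 * L^2 * real Sg * \<psi>\<^sup>2 / \<epsilon>^2"
  define k where "k = 1440 * \<psi>\<^sup>2 * (M^2 / \<epsilon>^2)"
  have ck: "0 \<le> c" "0 \<le> k" by (simp_all add: c_def k_def)
  have "evaluations Sg Bg (r @ [x]) \<le> min (real n) k * (1 + real (length r) / real Sg)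
     + (if Sg = 1 then 0 else 2 * min (real n * real (length r)) (c * (\<Sum>y\<leftarrow>r. (norm (step y))\<^sup>2)))"
    by (rule evaluations_le[OF Sg_ge _ ck(2,1)]) (auto simp: Bg c_def k_def \<psi>_def mult_ac)
  also have "\<dots> \<le> 1440 * \<psi>\<^sup>2 * (K + 4 * (X * Z)) + 23040 * \<psi>\<^sup>2 * (X * Z)"
  proof (rule add_mono)
    have "min (real n) k \<le> 1440 * \<psi>\<^sup>2 * K"
      unfolding k_def K_def using \<psi> by (intro min_mult_le) auto
    then have "min (real n) k * (1 + real (length r) / real Sg) \<le> 1440 * \<psi>\<^sup>2 * K * (1 + real (length r) / real Sg)"
      by (intro mult_right_mono) auto
    also have "\<dots> = 1440 * \<psi>\<^sup>2 * (K + real (length r) * (K / real Sg))"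
      by (simp add: algebra_simps)
    also have "real (length r) * (K / real Sg) \<le> 4 * Y * (K / real Sg)"
      using len K by (intro mult_right_mono) auto
    also have "4 * Y * (K / real Sg) = 4 * (X * (p * (K / real Sg)))"
      by (simp add: YX)
    also have "p * (K / real Sg) \<le> Z"
      unfolding Z_def
    proof (rule min.boundedI)
      have "K / real Sg \<le> K" using Sg_ge K by (simp add: divide_le_eq)
      then show "p * (K / real Sg) \<le> p * real n" using K p_pos by (intro mult_left_mono) auto
      have "K / real Sg \<le> K / a" using Sg_ge_a a K by (intro divide_left_mono) auto
      also have "\<dots> = sqrt K * L / (p * e)"
        using K pos p_pos e_pos by (simp add: a_def field_simps)
      finally have "p * (K / real Sg) \<le> p * (sqrt K * L / (p * e))"
        using p_pos by (intro mult_left_mono) auto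
      then show "p * (K / real Sg) \<le> W" using p_pos by (simp add: W_def mult.commute)
    qed
    finally show "min (real n) k * (1 + real (length r) / real Sg) \<le> 1440 * \<psi>\<^sup>2 * (K + 4 * (X * Z))"
      using X by (simp add: mult_left_mono)
    show "(if Sg = 1 then 0 else 2 * min (real n * real (length r)) (c * (\<Sum>y\<leftarrow>r. (norm (step y))\<^sup>2)))
        \<le> 23040 * \<psi>\<^sup>2 * (X * Z)"
    proof (cases "Sg = 1")
      case False
      \<comment> \<open>Rounding at most doubles \<open>a\<close> unless it lifts a value below 1 up
        to 1; in that excluded case every iteration is a checkpoint and the term is 0.\<close>
      have "real Sg \<le> 2 * a"
        using round_up_le_double[of a] False a unfolding Sg_a by simp
      then have S: "11520 * \<psi>\<^sup>2 * (L\<^sup>2 * \<Delta> / (e ^ 5 * p)) * real Sg \<le> 11520 * \<psi>\<^sup>2 * (L\<^sup>2 * \<Delta> / (e ^ 5 * p)) * (2 * a)"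
        using pos p_pos e_pos by (intro mult_left_mono) auto
      have "2 * (c * (\<Sum>y\<leftarrow>r. (norm (step y))\<^sup>2)) \<le> 2 * (c * (4 * (\<Delta> / (p * e))))"
        using sq ck by (intro mult_left_mono) auto
      also have "\<dots> = 11520 * \<psi>\<^sup>2 * (L\<^sup>2 * \<Delta> / (e ^ 5 * p)) * real Sg"
        by (simp add: c_def \<epsilon>_eq power_mult[symmetric] power_numeral_reduce) (simp add: mult_ac)
      also note S
      also have "11520 * \<psi>\<^sup>2 * (L\<^sup>2 * \<Delta> / (e ^ 5 * p)) * (2 * a) = 23040 * \<psi>\<^sup>2 * (X * W)"
        using p_pos e_pos pos by (simp add: a_def X_def W_def power_numeral_reduce) (simp add: mult_ac)
      finally have 1: "2 * (c * (\<Sum>y\<leftarrow>r. (norm (step y))\<^sup>2)) \<le> 23040 * \<psi>\<^sup>2 * (X * W)" .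
      have "2 * (real n * real (length r)) \<le> 2 * (real n * (4 * Y))"
        using len by (intro mult_left_mono) auto
      also have "\<dots> = 8 * (X * (p * real n))" by (simp add: YX)
      also have "\<dots> \<le> (23040 * \<psi>\<^sup>2) * (X * (p * real n))"
        using \<psi> X p_pos by (intro mult_right_mono) auto
      finally have 2: "2 * (real n * real (length r)) \<le> 23040 * \<psi>\<^sup>2 * (X * (p * real n))" .
      have "2 * min (real n * real (length r)) (c * (\<Sum>y\<leftarrow>r. (norm (step y))\<^sup>2)) \<le> 23040 * \<psi>\<^sup>2 * (X * Z)"
      proof (cases "p * real n \<le> W")
        case True
        have "2 * min (real n * real (length r)) (c * (\<Sum>y\<leftarrow>r. (norm (step y))\<^sup>2)) \<le> 2 * (real n * real (length r))"
          by simp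
        also note 2
        finally show ?thesis using True by (simp only: Z_def min_def if_True)
      next
        case False
        have "2 * min (real n * real (length r)) (c * (\<Sum>y\<leftarrow>r. (norm (step y))\<^sup>2))
            \<le> 2 * (c * (\<Sum>y\<leftarrow>r. (norm (step y))\<^sup>2))"
          by simp
        also note 1
        finally show ?thesis using False by (simp only: Z_def min_def if_False)
      qed
      then show ?thesis using False by simp
    qed (use X Z in simp)
  qed
  also have "\<dots> \<le> 10^6 * \<psi>\<^sup>2 * (K + X * Z)"
  proof -
    have "0 \<le> \<psi>\<^sup>2 * K" "0 \<le> \<psi>\<^sup>2 * (X * Z)" using X Z K by simp_all
    then show ?thesis by (simp add: algebra_simps)
  qed
  finally have bound: "evaluations Sg Bg (r @ [x]) \<le> 10^6 * \<psi>\<^sup>2 * (K + X * Z)" .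
  have W_eq: "W = min (L * sqrt (real n) / e) (L * M / e ^ 3)"
  proof -
    have "M / \<epsilon> = sqrt (M\<^sup>2 / \<epsilon>\<^sup>2)"
      using pos eps by (simp add: real_sqrt_divide)
    then have "sqrt K = min (sqrt (real n)) (M / \<epsilon>)"
      by (simp add: K_def min_def)
    then have "L / e * sqrt K = min (L / e * sqrt (real n)) (L / e * (M / \<epsilon>))"
      using pos e_pos by (simp add: min_mult_distrib_left)
    then show ?thesis by (simp add: W_def \<epsilon>_eq power_numeral_reduce mult.commute)
  qed
  show ?thesis
    using bound by (simp only: K_def X_def Z_def W_eq powr_eq p_def[symmetric] e_def[symmetric])
qed

lemma srvrc_guarantee:
  "1 - \<xi> \<le> measure_pmf.prob run
      {r. (\<exists>x_out. srvrc_output \<epsilon> \<rho> x0 r = Some x_out \<and> mu F \<rho> x_out \<le> 600 * \<epsilon> powr (3/2)) \<and>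
          evaluations Sh Bh r
            \<le> 10^6 * \<phi> ^ 2 *
               (min (real n) (L^2 / (\<rho> * \<epsilon>))
                 + sqrt \<rho> * \<Delta> / \<epsilon> powr (3/2) * sqrt (min (real n) (L^2 / (\<rho> * \<epsilon>)))) \<and>
          evaluations Sg Bg r
            \<le> 10^6 * \<psi> ^ 2 *
               (min (real n) (M^2 / \<epsilon>^2)
                 + \<Delta> / \<epsilon> powr (3/2) *
                    min (sqrt \<rho> * real n)
                      (min (L * sqrt (real n) / sqrt \<epsilon>) (L * M / \<epsilon> powr (3/2))))}"
    (is "_ \<le> measure_pmf.prob run ?G")
proof -
  have "r \<in> ?G" if r: "reach r" "length r \<le> T" "\<not> stopped \<epsilon> \<rho> r \<longrightarrow> length r = T" "\<forall>x\<in>set r. accurate x" for r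
  proof -
    have stopped: "stopped \<epsilon> \<rho> r" using stops r by blast
    from r(1) show ?thesis
    proof cases
      case Nil
      then show ?thesis using stopped by (simp add: stopped_def)
    next
      case (snoc r' J I h)
      \<comment> \<open>The split separates the final short step, which determines the output, from
        the prefix of long steps, which determines the cost.\<close>
      define x where "x = last r"
      have r_eq: "r = r' @ [x]" and x: "x \<in> set r" using snoc(1) by (simp_all add: x_def)
      have acc: "\<forall>x\<in>set r'. accurate x" using r(4) r_eq by simp
      have out: "srvrc_output \<epsilon> \<rho> x0 r = Some (iterate x + step x)"
        using stopped r_eq by (simp add: srvrc_output_def next_iterate_def)
      have "norm (step x) \<le> e / p"
        using stopped by (simp add: stopped_def x_def radius_eq)
      then have "mu F \<rho> (iterate x + step x) \<le> 600 * \<epsilon> powr (3/2)"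
        using mu_output[OF r(1) x] r(4) x by blast
      with out hess_evaluations[OF snoc(2,3) acc, of x] grad_evaluations[OF snoc(2,3) acc, of x]
      show ?thesis by (simp only: r_eq mem_Collect_eq) blast
    qed
  qed
  then have "measure_pmf.prob run {r. reach r \<and> length r \<le> T \<and> (\<not> stopped \<epsilon> \<rho> r \<longrightarrow> length r = T) \<and>
     (\<forall>x\<in>set r. accurate x)} \<le> measure_pmf.prob run ?G"
    by (intro measure_pmf.finite_measure_mono) auto
  with estimators_accurate show ?thesis by (simp only: accurate_def)
qed

end

end

theorem corollary4p3:
  fixes f :: "nat \<Rightarrow> real^'d \<Rightarrow> real" and F :: "real^'d \<Rightarrow> real" and x0 :: "real^'d"
    and n T Sg Sh :: nat and \<Delta> L \<rho> M \<epsilon> \<xi> :: real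
    and Bg Bh :: "nat \<Rightarrow> real^'d \<Rightarrow> real" and sel :: "'d rule"
  assumes n: "n \<ge> 1"
    and F: "F = finite_sum n f"
    and twice_diff: "\<And>i. i \<in> {1..n} \<Longrightarrow> twice_differentiable (f i)"
    and pos: "\<Delta> > 0" "L > 0" "\<rho> > 0" "M > 0"
    and gap: "bdd_below (range F)" "F x0 - (INF x. F x) \<le> \<Delta>"
    and grad_lipschitz: "\<And>i x y. i \<in> {1..n} \<Longrightarrow>
          norm (grad (f i) x - grad (f i) y) \<le> L * norm (x - y)"
    and hess_lipschitz: "\<And>i x y. i \<in> {1..n} \<Longrightarrow>
          spectral_norm (hess (f i) x - hess (f i) y) \<le> \<rho> * norm (x - y)"
    and grad_bound: "\<And>i x. i \<in> {1..n} \<Longrightarrow> norm (grad (f i) x - grad F x) \<le> M"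
    and eps: "\<epsilon> > 0" and xi: "0 < \<xi>" "\<xi> < 1"
    and Sg: "Sg = round_up (sqrt (\<rho> * \<epsilon>) / L * sqrt (min (real n) (M^2 / \<epsilon>^2)))"
    and Sh: "Sh = round_up (sqrt (min (real n) (L^2 / (\<rho> * \<epsilon>))))"
    and T: "T = round_up (40 * \<Delta> * \<rho> powr (1/2) * \<epsilon> powr (-3/2))"
    and Bg: "Bg = (\<lambda>t h. min (real n)
          (if t mod Sg \<noteq> 0
           then 1440 * L^2 * real Sg * norm h ^ 2 * ln (2 * real T / \<xi>) ^ 2 / \<epsilon>^2
           else 1440 * M^2 * ln (2 * real T / \<xi>) ^ 2 / \<epsilon>^2))"
    and Bh: "Bh = (\<lambda>t h. min (real n)
          (if t mod Sh \<noteq> 0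
           then 800 * \<rho> * real Sh * norm h ^ 2 * ln (2 * real T * real CARD('d) / \<xi>) ^ 2 / \<epsilon>
           else 800 * L^2 * ln (2 * real T * real CARD('d) / \<xi>) ^ 2 / (\<rho> * \<epsilon>)))"
    and sel: "minimizing_rule n f (\<lambda>t. 4 * \<rho>) Sg Sh x0 sel"
  shows "measure_pmf.prob (srvrc n f Bg Bh Sg Sh x0 \<epsilon> \<rho> sel T)
      {r. (\<exists>x_out. srvrc_output \<epsilon> \<rho> x0 r = Some x_out \<and> mu F \<rho> x_out \<le> 600 * \<epsilon> powr (3/2)) \<and>
          evaluations Sh Bh r
            \<le> 10^6 * ln (2 * real T * real CARD('d) / \<xi>) ^ 2 *
               (min (real n) (L^2 / (\<rho> * \<epsilon>))
                 + sqrt \<rho> * \<Delta> / \<epsilon> powr (3/2) * sqrt (min (real n) (L^2 / (\<rho> * \<epsilon>)))) \<and>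
          evaluations Sg Bg r
            \<le> 10^6 * ln (2 * real T / \<xi>) ^ 2 *
               (min (real n) (M^2 / \<epsilon>^2)
                 + \<Delta> / \<epsilon> powr (3/2) *
                    min (sqrt \<rho> * real n)
                      (min (L * sqrt (real n) / sqrt \<epsilon>) (L * M / \<epsilon> powr (3/2))))}
    \<ge> 1 - \<xi>"
proof -
  interpret srvrc_setting f F x0 n T Sg Sh \<Delta> L \<rho> M \<epsilon> \<xi> Bg Bh sel
    by unfold_locales (fact assms)+
  show ?thesis
    \<comment> \<open>The two reflexivities instantiate \<open>p\<close> and \<open>e\<close> as the
      square roots of \<open>\<rho>\<close> and \<open>\<epsilon>\<close>.\<close>
    using srvrc_guarantee[OF refl refl] unfolding \<psi>_def \<phi>_def .
qed

end
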